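(* Let $m>\tfrac52$, $s\in\mathbb{R}$, $T>0$, let $(\varphi,\tau):[0,T)\to G^m$ be a $C^2$-curve that is a magnetic geodesic of $(G^m,\mathcal{G}^{\dot H^1},s\,\Phi^*\mathrm{d}\alpha)$, and let $$(u,\rho)=(\varphi_t\circ\varphi^{-1},\tau_t\circ\varphi^{-1})\in C\big([0,T),T_{(\mathrm{id},0)}G^m\big)\cap C^1\big([0,T),T_{(\mathrm{id},0)}G^{m-1}\big)$$ be the corresponding solution of the magnetic two-component Hunter–Saxton system. Then $$\lim_{t\nearrow T}\|u_x(t,\cdot)\|_{C^0}=\infty$$ if and only if $$\lim_{t\nearrow T}\Phi(\varphi(t),\tau(t))\in\partial\,\mathcal{U}^{m-1}.$$
   Context: **The group $G^m$.** $\mathbb{S}^1=\mathbb{R}/\mathbb{Z}$, $\mathbb{S}^1_{4\pi}=\mathbb{R}/4\pi\mathbb{Z}$. $\mathrm{Diff}^m_0(\mathbb{S}^1)$ is the group of orientation-preserving diffeomorphisms of $\mathbb{S}^1$ of Sobolev class $H^m$ fixing the point $0$, and $G^m=\mathrm{Diff}^m_0(\mathbb{S}^1)\rtimes H^{m-1}(\mathbb{S}^1,\mathbb{S}^1_{4\pi})$, with tangent spaces identified with $\{(U_1,U_2)\in H^m(\mathbb{S}^1,\mathbb{R})\times H^{m-1}(\mathbb{S}^1,\mathbb{R}):U_1(0)=0\}$ and metric $$\mathcal{G}^{\dot H^1}_{(\varphi,\tau)}\big((U_1,U_2),(V_1,V_2)\big)=\frac14\int_{\mathbb{S}^1}\Big(\frac{U_{1x}V_{1x}}{\varphi_x}+U_2V_2\,\varphi_x\Big)\mathrm{d}x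 .$$ **Madelung transform.** $\Phi(\varphi,\tau)=\sqrt{\varphi_x}\,e^{\mathrm{i}\tau/2}$, a map from $G^m$ to $\mathcal{U}^{m-1}=\{f\in H^{m-1}(\mathbb{S}^1,\mathbb{C}):\|f\|_{L^2}=1,\ f(x)\ne0\ \forall x\}$. The set $\mathcal{U}^{m-1}$ is open in the $L^2$-unit sphere of $H^{m-1}(\mathbb{S}^1,\mathbb{C})$ (with the $H^{m-1}$ topology), and $\partial\,\mathcal U^{m-1}$ is its boundary there. The one-form is $\alpha_f(F)=\tfrac12\mathrm{Re}\langle\mathrm{i}f,F\rangle_{L^2}$. **Magnetic geodesics.** For a Riemannian manifold $(M,g)$ and a closed two-form $\sigma$, the Lorentz force $Y$ is defined by $g_q(Y_qv,w)=\sigma_q(v,w)$; a magnetic geodesic of $(M,g,\sigma)$ is a curve with $\nabla_{\dot\gamma}\dot\gamma=Y_\gamma\dot\gamma$. **The PDE.** The magnetic two-component Hunter–Saxton system of strength $s$ is $$u_{tx}=-\tfrac12u_x^2-u\,u_{xx}+\tfrac12\rho^2-\big(s\rho+2(c^2-s\delta)\big),\qquad \rho_t=-(\rho u)_x+s\,u_x,$$ with conserved quantities $c^2=\frac14\int_{\mathbb{S}^1}(u_x^2+\rho^2)\,\mathrm{d}x$ and $\delta=\frac12\int_{\mathbb{S}^1}\rho\,\mathrm{d}x$. If $(\varphi,\tau)$ is a magnetic geodesic of $(G^m,\mathcal{G}^{\dot H^1},s\,\Phi^*\mathrm{d}\alpha)$, then $(u,\rho)=(\varphi_t\circ\varphi^{-1},\tau_t\circ\varphi^{-1})$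 solves this system, and conversely. *)

theory Defs
  imports "HOL-Analysis.Analysis" "HOL-Library.Function_Algebras"
begin

section \<open>Sobolev spaces on the circle\<close>

text \<open>
  Functions on \<open>\<real>/\<int>\<close> are 1-periodic functions on \<open>\<real>\<close>. The order \<open>r\<close> is real, and only orders
  \<open>r > 1/2\<close> occur below, where every \<open>H\<^sup>r\<close> class has a unique continuous representative;
  the elements of \<open>sobolev r\<close> are these representatives.
\<close>

definition fourier :: "(real \<Rightarrow> complex) \<Rightarrow> int \<Rightarrow> complex" where
  "fourier f k = integral {0..1} (\<lambda>x. f x * exp (- (2 * of_real pi * \<i> * of_int k * of_real x)))"

definition sobolev :: "real \<Rightarrow> (real \<Rightarrow> complex) set" where
  "sobolev r = {f. continuous_on UNIV f \<and> (\<forall>x. f (x + 1) = f x) \<and>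
     (\<lambda>k. (1 + (real_of_int k)\<^sup>2) powr r * (cmod (fourier f k))\<^sup>2) summable_on UNIV}"

definition sobolev_norm :: "real \<Rightarrow> (real \<Rightarrow> complex) \<Rightarrow> real" where
  "sobolev_norm r f =
     sqrt (\<Sum>\<^sub>\<infinity>k. (1 + (real_of_int k)\<^sup>2) powr r * (cmod (fourier f k))\<^sup>2)"

definition sobolev_real :: "real \<Rightarrow> (real \<Rightarrow> real) set" where
  "sobolev_real r = {f. (\<lambda>x. complex_of_real (f x)) \<in> sobolev r}"

definition sobolev_real_norm :: "real \<Rightarrow> (real \<Rightarrow> real) \<Rightarrow> real" where
  "sobolev_real_norm r f = sobolev_norm r (\<lambda>x. complex_of_real (f x))"

definition L2_inner :: "(real \<Rightarrow> complex) \<Rightarrow> (real \<Rightarrow> complex) \<Rightarrow> complex" where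
  "L2_inner f g = integral {0..1} (\<lambda>x. f x * cnj (g x))"

definition L2_norm :: "(real \<Rightarrow> complex) \<Rightarrow> real" where
  "L2_norm f = sqrt (integral {0..1} (\<lambda>x. (cmod (f x))\<^sup>2))"

section \<open>The group and its tangent spaces\<close>

text \<open>
  A diffeomorphism of the circle fixing 0 is represented by its lift to \<open>\<real>\<close> fixing 0. For
  \<open>m > 3/2\<close> the conditions on \<open>\<phi>\<close> below make \<open>\<phi>\<close> a \<open>C\<^sup>1\<close> diffeomorphism with
  \<open>\<phi> (x + 1) = \<phi> x + 1\<close>.
\<close>

definition Diff0 :: "real \<Rightarrow> (real \<Rightarrow> real) set" where
  "Diff0 m = {\<phi>. (\<lambda>x. \<phi> x - x) \<in> sobolev_real m \<and> \<phi> 0 = 0 \<and>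
     (\<forall>x. \<exists>d>0. (\<phi> has_real_derivative d) (at x))}"

text \<open>
  A map from \<open>\<real>/\<int>\<close> to \<open>\<real>/4\<pi>\<int>\<close> is represented by a lift \<open>\<real> \<Rightarrow> \<real>\<close>; \<open>k\<close> is its degree. The lift is
  unique up to a constant in \<open>4\<pi>\<int>\<close>. A continuous curve of such maps lifts to a continuous curve of
  lifts, again uniquely up to a constant in \<open>4\<pi>\<int>\<close> (independent of time), and no notion below
  depends on this constant. So a curve in the group is given by a curve in \<open>Gm m\<close>.
\<close>

definition circle_map_lifts :: "real \<Rightarrow> (real \<Rightarrow> real) set" where
  "circle_map_lifts r = {\<tau>. \<exists>k::int. (\<lambda>x. \<tau> x - 4 * pi * of_int k * x) \<in> sobolev_real r}"

type_synonym fpair = "(real \<Rightarrow> real) \<times> (real \<Rightarrow> real)"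

definition Gm :: "real \<Rightarrow> fpair set" where
  "Gm m = Diff0 m \<times> circle_map_lifts (m - 1)"

text \<open>
  All tangent spaces are identified with \<open>tangent m\<close>; \<open>Gm m\<close> is open in a disjoint union of
  affine spaces (one for each degree) modelled on it.
\<close>

definition tangent :: "real \<Rightarrow> fpair set" where
  "tangent m = {U \<in> sobolev_real m \<times> sobolev_real (m - 1). fst U 0 = 0}"

definition tangent_norm :: "real \<Rightarrow> fpair \<Rightarrow> real" where
  "tangent_norm m U =
     sqrt ((sobolev_real_norm m (fst U))\<^sup>2 + (sobolev_real_norm (m - 1) (snd U))\<^sup>2)"

definition scl :: "real \<Rightarrow> fpair \<Rightarrow> fpair" where
  "scl a U = ((\<lambda>x. a * fst U x), (\<lambda>x. a * snd U x))"

section \<open>Curves\<close>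

text \<open>
  These notions apply to curves in \<open>Gm m\<close> and to curves in \<open>tangent m\<close>. Differences
  are required to lie in \<open>tangent m\<close>, since the norm is only meaningful there; for a curve in
  \<open>Gm m\<close> this says that the degree of the second component is constant.
\<close>

definition continuous_curve :: "real \<Rightarrow> real set \<Rightarrow> (real \<Rightarrow> fpair) \<Rightarrow> bool" where
  "continuous_curve m I c \<longleftrightarrow> (\<forall>t\<in>I. \<forall>r\<in>I. c r - c t \<in> tangent m) \<and>
     (\<forall>t\<in>I. ((\<lambda>r. tangent_norm m (c r - c t)) \<longlongrightarrow> 0) (at t within I))"

definition has_curve_derivative ::
    "real \<Rightarrow> real set \<Rightarrow> (real \<Rightarrow> fpair) \<Rightarrow> (real \<Rightarrow> fpair) \<Rightarrow> bool" where
  "has_curve_derivative m I c c' \<longleftrightarrow> (\<forall>t\<in>I. \<forall>r\<in>I. c r - c t \<in> tangent m) \<and>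
     (\<forall>t\<in>I. c' t \<in> tangent m \<and>
        ((\<lambda>r. tangent_norm m (scl (1 / (r - t)) (c r - c t) - c' t)) \<longlongrightarrow> 0) (at t within I))"

definition C1_curve :: "real \<Rightarrow> real set \<Rightarrow> (real \<Rightarrow> fpair) \<Rightarrow> (real \<Rightarrow> fpair) \<Rightarrow> bool" where
  "C1_curve m I c c' \<longleftrightarrow> has_curve_derivative m I c c' \<and> continuous_curve m I c'"

definition C2_curve ::
    "real \<Rightarrow> real set \<Rightarrow> (real \<Rightarrow> fpair) \<Rightarrow> (real \<Rightarrow> fpair) \<Rightarrow> (real \<Rightarrow> fpair) \<Rightarrow> bool" where
  "C2_curve m I c c' c'' \<longleftrightarrow> C1_curve m I c c' \<and> C1_curve m I c' c''"

section \<open>Magnetic geodesics\<close>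

text \<open>
  Here \<open>M\<close> is locally an open subset of an affine space modelled on \<open>E\<close>, with a (weak) Riemannian
  metric \<open>g\<close>. The Levi-Civita connection is given by its Christoffel map \<open>\<Gamma>\<close>:
  \<open>\<nabla>\<^sub>V W = D\<^sub>V W + \<Gamma>\<^sub>q(V, W)\<close>. It is torsion free (\<open>\<Gamma>\<close> symmetric) and metric (the last
  clause, which is \<open>V g(W, Z) = g(\<nabla>\<^sub>V W, Z) + g(W, \<nabla>\<^sub>V Z)\<close> for constant vector fields \<open>W, Z\<close>).
\<close>

definition levi_civita ::
    "fpair set \<Rightarrow> fpair set \<Rightarrow> (fpair \<Rightarrow> fpair \<Rightarrow> fpair \<Rightarrow> real) \<Rightarrow>
     (fpair \<Rightarrow> fpair \<Rightarrow> fpair \<Rightarrow> fpair) \<Rightarrow> bool" where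
  "levi_civita M E g \<Gamma> \<longleftrightarrow> (\<forall>q\<in>M.
     (\<forall>V\<in>E. \<forall>W\<in>E. \<Gamma> q V W \<in> E \<and> \<Gamma> q V W = \<Gamma> q W V) \<and>
     (\<forall>V\<in>E. \<forall>V'\<in>E. \<forall>W\<in>E. \<forall>a. \<Gamma> q (V + scl a V') W = \<Gamma> q V W + scl a (\<Gamma> q V' W)) \<and>
     (\<forall>V\<in>E. \<forall>W\<in>E. \<forall>Z\<in>E.
        ((\<lambda>\<epsilon>. g (q + scl \<epsilon> V) W Z) has_real_derivative
           g q (\<Gamma> q V W) Z + g q W (\<Gamma> q V Z)) (at 0)))"

definition lorentz_force ::
    "fpair set \<Rightarrow> fpair set \<Rightarrow> (fpair \<Rightarrow> fpair \<Rightarrow> fpair \<Rightarrow> real) \<Rightarrow>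
     (fpair \<Rightarrow> fpair \<Rightarrow> fpair \<Rightarrow> real) \<Rightarrow> (fpair \<Rightarrow> fpair \<Rightarrow> fpair) \<Rightarrow> bool" where
  "lorentz_force M E g \<sigma> Y \<longleftrightarrow>
     (\<forall>q\<in>M. \<forall>V\<in>E. Y q V \<in> E \<and> (\<forall>W\<in>E. g q (Y q V) W = \<sigma> q V W))"

definition magnetic_geodesic ::
    "fpair set \<Rightarrow> fpair set \<Rightarrow> (fpair \<Rightarrow> fpair \<Rightarrow> fpair \<Rightarrow> real) \<Rightarrow>
     (fpair \<Rightarrow> fpair \<Rightarrow> fpair \<Rightarrow> real) \<Rightarrow> real set \<Rightarrow>
     (real \<Rightarrow> fpair) \<Rightarrow> (real \<Rightarrow> fpair) \<Rightarrow> (real \<Rightarrow> fpair) \<Rightarrow> bool" where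
  "magnetic_geodesic M E g \<sigma> I c c' c'' \<longleftrightarrow> (\<forall>t\<in>I. c t \<in> M) \<and>
     (\<exists>\<Gamma> Y. levi_civita M E g \<Gamma> \<and> lorentz_force M E g \<sigma> Y \<and>
        (\<forall>t\<in>I. c'' t + \<Gamma> (c t) (c' t) (c' t) = Y (c t) (c' t)))"

definition H1_metric :: "fpair \<Rightarrow> fpair \<Rightarrow> fpair \<Rightarrow> real" where
  "H1_metric q U V = 1/4 * integral {0..1} (\<lambda>x.
     deriv (fst U) x * deriv (fst V) x / deriv (fst q) x + snd U x * snd V x * deriv (fst q) x)"

section \<open>Madelung transform and magnetic two-form\<close>

definition madelung :: "fpair \<Rightarrow> real \<Rightarrow> complex" where
  "madelung q = (\<lambda>x. of_real (sqrt (deriv (fst q) x)) * exp (\<i> * of_real (snd q x / 2)))"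

definition d_madelung :: "fpair \<Rightarrow> fpair \<Rightarrow> real \<Rightarrow> complex" where
  "d_madelung q U = (\<lambda>x. vector_derivative (\<lambda>\<epsilon>. madelung (q + scl \<epsilon> U) x) (at 0))"

definition alpha :: "(real \<Rightarrow> complex) \<Rightarrow> (real \<Rightarrow> complex) \<Rightarrow> real" where
  "alpha f F = 1/2 * Re (L2_inner (\<lambda>x. \<i> * f x) F)"

text \<open>
  The formula for \<open>\<alpha>\<close> makes sense on the whole linear space, where the exterior derivative
  (normalised by \<open>d\<alpha>(F, H) = F \<alpha>(H) - H \<alpha>(F) - \<alpha>([F, H])\<close>) can be computed with constant vector
  fields; restriction to the sphere commutes with it.
\<close>

definition d_alpha ::
    "(real \<Rightarrow> complex) \<Rightarrow> (real \<Rightarrow> complex) \<Rightarrow> (real \<Rightarrow> complex) \<Rightarrow> real" where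
  "d_alpha f F H = deriv (\<lambda>\<epsilon>. alpha (\<lambda>x. f x + of_real \<epsilon> * F x) H) 0
                 - deriv (\<lambda>\<epsilon>. alpha (\<lambda>x. f x + of_real \<epsilon> * H x) F) 0"

definition pullback_d_alpha :: "fpair \<Rightarrow> fpair \<Rightarrow> fpair \<Rightarrow> real" where
  "pullback_d_alpha q U V = d_alpha (madelung q) (d_madelung q U) (d_madelung q V)"

definition sphere_set :: "real \<Rightarrow> (real \<Rightarrow> complex) set" where
  "sphere_set r = {f \<in> sobolev r. L2_norm f = 1}"

definition sphere_topology :: "real \<Rightarrow> (real \<Rightarrow> complex) topology" where
  "sphere_topology r = subtopology
     (Metric_space.mtopology (sobolev r) (\<lambda>f g. sobolev_norm r (\<lambda>x. f x - g x))) (sphere_set r)"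

definition nonvanishing :: "real \<Rightarrow> (real \<Rightarrow> complex) set" where
  "nonvanishing r = {f \<in> sphere_set r. \<forall>x. f x \<noteq> 0}"

section \<open>The magnetic two-component Hunter--Saxton system\<close>

text \<open>\<open>u_t\<close> and \<open>\<rho>_t\<close> are the time derivatives of the curves \<open>u\<close> and \<open>\<rho>\<close>.\<close>

definition magnetic_2HS ::
    "real \<Rightarrow> real set \<Rightarrow> (real \<Rightarrow> real \<Rightarrow> real) \<Rightarrow> (real \<Rightarrow> real \<Rightarrow> real) \<Rightarrow>
     (real \<Rightarrow> real \<Rightarrow> real) \<Rightarrow> (real \<Rightarrow> real \<Rightarrow> real) \<Rightarrow> bool" where
  "magnetic_2HS s I u \<rho> u_t \<rho>_t \<longleftrightarrow> (\<forall>t\<in>I.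
     let c2 = 1/4 * integral {0..1} (\<lambda>x. (deriv (u t) x)\<^sup>2 + (\<rho> t x)\<^sup>2);
         \<delta> = 1/2 * integral {0..1} (\<rho> t)
     in \<forall>x. deriv (u_t t) x =
              - 1/2 * (deriv (u t) x)\<^sup>2 - u t x * deriv (deriv (u t)) x + 1/2 * (\<rho> t x)\<^sup>2
              - (s * \<rho> t x + 2 * (c2 - s * \<delta>)) \<and>
            \<rho>_t t x = - deriv (\<lambda>y. \<rho> t y * u t y) x + s * deriv (u t) x)"

end

theory Submission
  imports Defs
begin

text \<open>
  In Lagrangian coordinates the transport terms of the system disappear, and
  \<open>f(t) = \<Phi>(\<phi>(t), \<tau>(t))\<close> satisfies, pointwise in \<open>x\<close>, the linear equation
  \<open>f\<^sub>t\<^sub>t = \<i> s f\<^sub>t - \<kappa> f\<close> with \<open>\<kappa> = c\<^sup>2 - s \<delta>\<close>, which is constant in time. Hence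
  \<open>f(t, x) = A(t) f(0, x) + B(t) f\<^sub>t(0, x)\<close> with scalar functions \<open>A, B\<close> defined for all
  times, so the limit \<open>F\<close> of \<open>f(t)\<close> as \<open>t \<nearrow> T\<close> always exists in the sphere, and it lies on
  the boundary of the nonvanishing functions if and only if it has a zero. Now
  \<open>u\<^sub>x \<circ> \<phi> = 2 Re (f\<^sub>t / f)\<close>. If \<open>F\<close> has no zero, this stays bounded near \<open>T\<close>. If
  \<open>F(x) = 0\<close>, the Wronskian forces \<open>f\<^sub>t(T, x) \<noteq> 0\<close>, so \<open>x\<close> is a simple zero in time and
  \<open>f\<^sub>t / f\<close> behaves like \<open>1 / (t - T)\<close>.

  That \<open>f(0)\<close> and \<open>f\<^sub>t(0)\<close> belong to \<open>H\<^sup>m\<^sup>-\<^sup>1\<close> needs that space to be closed under products,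
  \<open>exp\<close> and powers of positive functions, for a real order \<open>m - 1 > 3/2\<close>; this is read off the
  Fourier coefficients.
\<close>

subsection \<open>Fourier coefficients\<close>

text \<open>The Riccati equation for \<open>w = u_x \<circ> \<phi>\<close>, coupled to
  \<open>\<tau>_t\<close>, is what \<open>f\<close> linearises: half of
  \<open>w + \<i> \<tau>_t\<close> is the logarithmic time derivative of \<open>f\<close>. The
  coefficient \<open>\<kappa>\<close> is built from integrals over the circle, so the linear
  equation becomes autonomous only through two conservation laws:
  \<open>(\<tau>_t - s) \<phi>_x\<close> is constant at each particle, and the total energy is
  constant in time. Removing the transport terms requires a jointly continuous \<open>u_xx\<close>.
  It lies in the Sobolev space of order \<open>m - 2\<close>, which exceeds 1/2 because
  \<open>m > 5/2\<close>. Since the solution formula has scalar coefficients, convergence in the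
  Sobolev norm reduces to membership of two initial functions, with no estimate for composition with
  diffeomorphisms. For a real order there is no Leibniz rule to count derivatives with. Products are
  handled as convolutions of coefficients, and the square root by a binomial series; for the latter
  the relevant smallness is that of the sup norm, not of the Sobolev norm.\<close>

definition circ :: "(real \<Rightarrow> complex) \<Rightarrow> bool" where
  "circ f \<longleftrightarrow> continuous_on UNIV f \<and> (\<forall>x. f (x + 1) = f x)"

definition chi :: "int \<Rightarrow> real \<Rightarrow> complex" where
  "chi k x = exp (2 * of_real pi * \<i> * of_int k * of_real x)"

lemma circ_cont: "circ f \<Longrightarrow> continuous_on S f"
  by (auto simp: circ_def intro: continuous_on_subset)

lemma circ_per: "circ f \<Longrightarrow> f (x + 1) = f x"
  by (auto simp: circ_def)

lemma circ_frac:
  assumes "circ f" shows "f (frac x) = f x"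
proof -
  have nat: "f (y + of_nat n) = f y" for y n
  proof (induction n)
    case (Suc n)
    then show ?case using circ_per[OF assms, of "y + of_nat n"] by (simp add: add_ac)
  qed simp
  have "f (y + of_int k) = f y" for y k
  proof (cases "k \<ge> 0")
    case True
    then show ?thesis using nat[of y "nat k"] by simp
  next
    case False
    then show ?thesis using nat[of "y + of_int k" "nat (-k)"] by simp
  qed
  from this[of "frac x" "\<lfloor>x\<rfloor>"] show ?thesis by (simp add: frac_def)
qed

lemma circ_ball:
  assumes "circ f" "\<And>x. x \<in> {0..1} \<Longrightarrow> P (f x)"
  shows "P (f x)"
  using assms(2)[of "frac x"] frac_lt_1[of x] by (simp add: circ_frac[OF assms(1)] less_imp_le)

lemma circ_bounded:
  assumes "circ f" obtains B where "B > 0" "\<And>x. cmod (f x) \<le> B"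
proof -
  have "compact (f ` {0..1})"
    using assms by (intro compact_continuous_image circ_cont) auto
  then obtain B where B: "B > 0" "\<forall>y\<in>f ` {0..1}. cmod y \<le> B"
    using compact_imp_bounded bounded_pos by blast
  show thesis
    using that[OF B(1)] circ_ball[OF assms, of "\<lambda>y. cmod y \<le> B"] B(2) by auto
qed

section \<open>Characters of the circle\<close>

lemma chi_add: "chi (j + k) x = chi j x * chi k x"
  by (simp add: chi_def algebra_simps flip: exp_add)

lemma chi_0 [simp]: "chi 0 x = 1"
  by (simp add: chi_def)

lemma norm_chi [simp]: "cmod (chi k x) = 1"
  by (simp add: chi_def)

lemma chi_1_cis: "chi 1 x = cis (2 * pi * x)"
  by (simp add: chi_def cis_conv_exp mult_ac)

lemma cnj_chi: "cnj (chi k x) = chi (-k) x"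
  by (simp add: chi_def exp_cnj)

lemma continuous_chi [continuous_intros]: "continuous_on S (chi k)"
  unfolding chi_def by (intro continuous_intros)

lemma chi_int: "chi k 1 = 1"
proof -
  have "chi k 1 = exp (2 * of_real pi * \<i> * of_int k)" by (simp add: chi_def)
  also have "\<dots> = 1" by (subst exp_eq_1) (auto intro: exI[of _ k])
  finally show ?thesis .
qed

lemma chi_per: "chi k (x + 1) = chi k x"
proof -
  have "chi k (x + 1) = chi k x * chi k 1"
    unfolding chi_def exp_add[symmetric] by (rule arg_cong[where f = exp]) (simp add: algebra_simps)
  then show ?thesis by (simp add: chi_int)
qed

lemma circ_chi [intro!, simp]: "circ (chi k)"
  by (auto simp: circ_def chi_per intro: continuous_intros)

lemma circ_const [intro!, simp]: "circ (\<lambda>_. c)"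
  by (auto simp: circ_def)

lemma circ_add [intro!]: "circ f \<Longrightarrow> circ g \<Longrightarrow> circ (\<lambda>x. f x + g x)"
  by (auto simp: circ_def intro!: continuous_intros)

lemma circ_diff [intro!]: "circ f \<Longrightarrow> circ g \<Longrightarrow> circ (\<lambda>x. f x - g x)"
  by (auto simp: circ_def intro!: continuous_intros)

lemma circ_mult [intro!]: "circ f \<Longrightarrow> circ g \<Longrightarrow> circ (\<lambda>x. f x * g x)"
  by (auto simp: circ_def intro!: continuous_intros)

lemma circ_power [intro!]: "circ f \<Longrightarrow> circ (\<lambda>x. f x ^ n)"
  by (auto simp: circ_def intro!: continuous_intros)

lemma circ_cnj [intro!]: "circ f \<Longrightarrow> circ (\<lambda>x. cnj (f x))"
  by (auto simp: circ_def intro!: continuous_intros)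

lemma circ_sum [intro!]: "(\<And>i. i \<in> K \<Longrightarrow> circ (f i)) \<Longrightarrow> circ (\<lambda>x. \<Sum>i\<in>K. f i x)"
  by (auto simp: circ_def intro!: continuous_intros)

lemma circ_integrable [intro]: "circ f \<Longrightarrow> f integrable_on {a..b}"
  by (auto intro!: integrable_continuous_interval circ_cont)

text \<open>The filter is arbitrary because it serves both nets of finite partial sums of Fourier
  series and sequences of partial sums of power series.\<close>

lemma circ_uniform_limit:
  assumes "uniform_limit UNIV f g F" "\<And>n. circ (f n)" "F \<noteq> bot"
  shows "circ g"
  unfolding circ_def
proof (intro conjI allI)
  show "continuous_on UNIV g"
    by (rule uniform_limit_theorem[OF _ assms(1,3)]) (use assms(2) in \<open>auto simp: circ_def\<close>)
  fix x
  have "((\<lambda>n. f n (x + 1)) \<longlongrightarrow> g (x + 1)) F" "((\<lambda>n. f n x) \<longlongrightarrow> g x) F"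
    using assms(1) by (auto intro: tendsto_uniform_limitI)
  then show "g (x + 1) = g x"
    using assms(2,3) by (auto simp: circ_per intro: tendsto_unique)
qed

section \<open>Linearity, shifts, limits and derivatives of coefficients\<close>

lemma fourier_eq: "fourier f k = integral {0..1} (\<lambda>x. f x * chi (-k) x)"
  by (simp add: fourier_def chi_def)

lemma fourier_add: "circ f \<Longrightarrow> circ g \<Longrightarrow> fourier (\<lambda>x. f x + g x) k = fourier f k + fourier g k"
  unfolding fourier_eq by (simp add: distrib_right, subst integral_add) auto

lemma fourier_diff: "circ f \<Longrightarrow> circ g \<Longrightarrow> fourier (\<lambda>x. f x - g x) k = fourier f k - fourier g k"
  unfolding fourier_eq by (simp add: left_diff_distrib, subst integral_diff) auto

lemma fourier_scale: "fourier (\<lambda>x. c * f x) k = c * fourier f k"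
  unfolding fourier_eq by (simp add: mult.assoc)

lemma fourier_chi_mult: "fourier (\<lambda>x. chi j x * f x) k = fourier f (k - j)"
proof -
  have "chi j x * f x * chi (-k) x = f x * (chi j x * chi (-k) x)" for x by simp
  also have "chi j x * chi (-k) x = chi (j - k) x" for x
    using chi_add[of j "-k" x] by simp
  finally have "chi j x * f x * chi (-k) x = f x * chi (j - k) x" for x .
  then show ?thesis unfolding fourier_eq by (simp only: minus_diff_eq)
qed

lemma fourier_sum:
  assumes "finite K" "\<And>i. i \<in> K \<Longrightarrow> circ (f i)"
  shows "fourier (\<lambda>x. \<Sum>i\<in>K. f i x) k = (\<Sum>i\<in>K. fourier (f i) k)"
  using assms
proof (induction K rule: finite_induct)
  case empty
  then show ?case by (simp add: fourier_eq)
next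
  case (insert i K)
  then have "fourier (\<lambda>x. \<Sum>i\<in>insert i K. f i x) k = fourier (\<lambda>x. f i x + (\<Sum>i\<in>K. f i x)) k"
    by simp
  also have "\<dots> = fourier (f i) k + fourier (\<lambda>x. \<Sum>i\<in>K. f i x) k"
    by (rule fourier_add) (use insert in auto)
  finally show ?case using insert by simp
qed

lemma norm_integral_unit_le:
  fixes f :: "real \<Rightarrow> complex"
  assumes "continuous_on {0..1} f" "\<And>x. x \<in> {0..1} \<Longrightarrow> cmod (f x) \<le> B"
  shows "cmod (integral {0..1} f) \<le> B"
  using integral_bound[of 0 1 f B] assms by simp

lemma fourier_bound:
  assumes "circ f" "\<And>x. cmod (f x) \<le> B"
  shows "cmod (fourier f k) \<le> B"
  unfolding fourier_eq
  by (rule norm_integral_unit_le)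
     (use assms in \<open>auto simp: norm_mult intro!: circ_cont\<close>)

lemma fourier_tendsto:
  assumes "uniform_limit UNIV f g F" "\<And>n. circ (f n)" "F \<noteq> bot"
  shows "((\<lambda>n. fourier (f n) k) \<longlongrightarrow> fourier g k) F"
proof -
  note g = circ_uniform_limit[OF assms]
  show ?thesis
  proof (rule tendstoI)
    fix e :: real assume e: "e > 0"
    have "\<forall>\<^sub>F n in F. \<forall>x\<in>UNIV. dist (f n x) (g x) < e/2"
      using uniform_limitD[OF assms(1), of "e/2"] e by simp
    then show "\<forall>\<^sub>F n in F. dist (fourier (f n) k) (fourier g k) < e"
    proof (rule eventually_mono)
      fix n assume n: "\<forall>x\<in>UNIV. dist (f n x) (g x) < e/2"
      have "cmod (fourier (\<lambda>x. f n x - g x) k) \<le> e/2"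
        by (rule fourier_bound) (use assms g n in \<open>auto simp: dist_norm less_imp_le\<close>)
      then show "dist (fourier (f n) k) (fourier g k) < e"
        using assms(2)[of n] g e by (simp add: fourier_diff dist_norm)
    qed
  qed
qed

text \<open>Integration by parts over one period; periodicity cancels the boundary terms. Besides
  decay of coefficients it gives orthogonality of characters, and recovers a function from its
  derivative up to the mean.\<close>

lemma fourier_parts:
  assumes f: "\<And>x. (f has_vector_derivative f' x) (at x)" and "circ f" "circ f'"
  shows "fourier f' k = 2 * pi * \<i> * k * fourier f k"
proof -
  have chi': "(chi (-k) has_vector_derivative (-(2 * pi * \<i> * k)) * chi (-k) x) (at x within S)" for x S
    unfolding chi_def
    by (rule has_vector_derivative_eq_rhs, rule has_vector_derivative_real_field,
        (rule derivative_eq_intros refl | simp)+)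
  have "((\<lambda>x. f x * ((-(2 * pi * \<i> * k)) * chi (-k) x) + f' x * chi (-k) x) has_integral
        (f 1 * chi (-k) 1 - f 0 * chi (-k) 0)) {0..1}"
  proof (rule fundamental_theorem_of_calculus)
    fix x :: real
    show "((\<lambda>x. f x * chi (-k) x) has_vector_derivative
        (f x * ((-(2 * pi * \<i> * k)) * chi (-k) x) + f' x * chi (-k) x)) (at x within {0..1})"
      by (rule has_vector_derivative_mult[OF has_vector_derivative_at_within[OF f] chi'])
  qed simp
  also have "f 1 * chi (-k) 1 - f 0 * chi (-k) 0 = 0"
    using circ_per[OF assms(2), of 0] circ_per[OF circ_chi, of "-k" 0] by simp
  finally have "0 = integral {0..1} (\<lambda>x. (-(2 * pi * \<i> * k)) * (f x * chi (-k) x) + f' x * chi (-k) x)"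
    by (simp add: has_integral_iff mult_ac)
  also have "\<dots> = integral {0..1} (\<lambda>x. (-(2 * pi * \<i> * k)) * (f x * chi (-k) x)) + fourier f' k"
    unfolding fourier_eq using assms by (intro integral_add circ_integrable circ_mult circ_const circ_chi)
  also have "\<dots> = (-(2 * pi * \<i> * k)) * fourier f k + fourier f' k"
    unfolding fourier_eq by simp
  finally show ?thesis by (simp add: algebra_simps)
qed

text \<open>The constant 1 has derivative 0, so integration by parts kills all its coefficients
  except the mean; the shift rule transfers this to \<open>chi j\<close>.\<close>

lemma fourier_chi: "fourier (chi j) k = (if j = k then 1 else 0)"
proof -
  have c: "fourier (\<lambda>x. 1) i = (if i = 0 then 1 else 0)" for i
  proof (cases "i = 0")
    case True then show ?thesis by (simp add: fourier_eq)
  next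
    case False
    have "fourier (\<lambda>x. 0) i = 2 * pi * \<i> * i * fourier (\<lambda>x. 1) i"
      by (rule fourier_parts) auto
    then show ?thesis using False by (simp add: fourier_eq)
  qed
  show ?thesis using fourier_chi_mult[of j "\<lambda>x. 1" k] c[of "k - j"] by simp
qed

subsection \<open>Uniqueness and inversion\<close>

text \<open>By Stone--Weierstrass the polynomials below approximate every continuous function on the circle.\<close>

lemma fourier_zero_mult_polynomial:
  fixes p :: "complex \<Rightarrow> real"
  assumes "real_polynomial_function p"
  shows "circ f \<Longrightarrow> (\<And>k. fourier f k = 0) \<Longrightarrow>
    circ (\<lambda>x. of_real (p (chi 1 x)) * f x) \<and> (\<forall>k. fourier (\<lambda>x. of_real (p (chi 1 x)) * f x) k = 0)"
  using assms
proof (induction arbitrary: f rule: real_polynomial_function.induct)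
  case (linear p)
  note f = linear.prems
  from linear interpret bounded_linear p by simp
  \<comment> \<open>A real-linear functional on the plane has the form
    \<open>c * z + d * cnj z\<close>, fixed by its values at 1 and \<open>\<i>\<close>. On the
    circle, multiplication by it combines two index shifts, which preserve the vanishing of all
    coefficients.\<close>
  define a where "a = complex_of_real (p 1)"
  define b where "b = complex_of_real (p \<i>)"
  define c where "c = (a - \<i> * b) / 2"
  define d where "d = (a + \<i> * b) / 2"
  have p: "of_real (p (chi 1 x)) = c * chi 1 x + d * chi (-1) x" for x
  proof -
    have "p (chi 1 x) = p (Re (chi 1 x) *\<^sub>R 1 + Im (chi 1 x) *\<^sub>R \<i>)"
      by (rule arg_cong[where f=p]) (simp add: complex_eq_iff)
    also have "\<dots> = Re (chi 1 x) * p 1 + Im (chi 1 x) * p \<i>"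
      by (simp only: add scaleR real_scaleR_def)
    finally have "p (chi 1 x) = Re (chi 1 x) * p 1 + Im (chi 1 x) * p \<i>" .
    then show ?thesis
      unfolding a_def b_def c_def d_def cnj_chi[symmetric] by (simp add: complex_eq_iff field_simps)
  qed
  have eq: "(\<lambda>x. of_real (p (chi 1 x)) * f x) =
     (\<lambda>x. c * (chi 1 x * f x) + d * (chi (-1) x * f x))"
    unfolding p by (simp add: algebra_simps)
  have "fourier (\<lambda>x. of_real (p (chi 1 x)) * f x) k = 0" for k
    unfolding eq
    by (subst fourier_add) (use f in \<open>auto simp: fourier_scale fourier_chi_mult\<close>)
  moreover have "circ (\<lambda>x. of_real (p (chi 1 x)) * f x)"
    unfolding eq using f by auto
  ultimately show ?case by blast
next
  case (const c)
  then show ?case by (auto simp: fourier_scale)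
next
  case (add p q)
  have eq: "(\<lambda>x. of_real (p (chi 1 x) + q (chi 1 x)) * f x) =
     (\<lambda>x. of_real (p (chi 1 x)) * f x + of_real (q (chi 1 x)) * f x)"
    by (simp add: algebra_simps)
  show ?case unfolding eq
    using add.IH(1)[OF add.prems] add.IH(2)[OF add.prems] by (auto simp: fourier_add)
next
  case (mult p q)
  have eq: "(\<lambda>x. of_real (p (chi 1 x) * q (chi 1 x)) * f x) =
     (\<lambda>x. of_real (p (chi 1 x)) * (of_real (q (chi 1 x)) * f x))"
    by (simp add: algebra_simps)
  show ?case unfolding eq
    using mult.IH(1) mult.IH(2)[OF mult.prems] by simp
qed

text \<open>\<open>Arg2pi\<close> jumps at 1, so continuity of the descended function is not read
  off its formula. Its graph is the continuous image of the compact interval, hence closed, and a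
  map into a compact set with closed graph is continuous.\<close>

lemma circ_factor:
  fixes h :: "real \<Rightarrow> real"
  assumes "continuous_on UNIV h" "\<And>x. h (x + 1) = h x"
  obtains g where "continuous_on (sphere 0 1) g" "\<And>x. g (chi 1 x) = h x"
proof -
  have ch: "circ (\<lambda>x. of_real (h x))"
    using assms by (auto simp: circ_def intro!: continuous_intros)
  define g where "g z = h (Arg2pi z / (2 * pi))" for z
  have sph: "z = chi 1 (Arg2pi z / (2*pi))" if "z \<in> sphere 0 1" for z
    using that Arg2pi_eq[of z] by (simp add: chi_1_cis cis_conv_exp)
  have inj: "h x = h y" if "chi 1 x = chi 1 y" for x y
  proof -
    have "cis (2*pi*x) = cis (2*pi*y)" using that by (simp add: chi_1_cis)
    then have "sin (2*pi*x) = sin (2*pi*y) \<and> cos (2*pi*x) = cos (2*pi*y)"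
      by (simp add: complex_eq_iff)
    then obtain n where "2*pi*x = 2*pi*y + 2 * pi * of_int n"
      using sin_cos_eq_iff by blast
    then have "2*pi*x = 2*pi*(y + of_int n)" by (simp add: algebra_simps)
    then have "x = y + of_int n" by simp
    then have "frac x = frac y" by (simp add: frac_def)
    then show ?thesis
      using circ_frac[OF ch, of x] circ_frac[OF ch, of y] by simp
  qed
  have g: "g (chi 1 x) = h x" for x
    unfolding g_def by (rule inj) (subst sph[symmetric], auto)
  have "(\<lambda>z. (z, g z)) ` sphere 0 1 = (\<lambda>x. (chi 1 x, h x)) ` {0..1}"
  proof (intro set_eqI iffI)
    fix y assume "y \<in> (\<lambda>z. (z, g z)) ` sphere 0 1"
    then obtain z where z: "z \<in> sphere 0 1" "y = (z, g z)" by auto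
    have "y = (\<lambda>x. (chi 1 x, h x)) (Arg2pi z / (2*pi))"
      using sph[OF z(1)] z(2) by (simp add: g_def)
    moreover have "Arg2pi z / (2*pi) \<in> {0..1}"
      using Arg2pi_ge_0[of z] Arg2pi_lt_2pi[of z] by (simp add: divide_simps)
    ultimately show "y \<in> (\<lambda>x. (chi 1 x, h x)) ` {0..1}" by blast
  next
    fix y assume "y \<in> (\<lambda>x. (chi 1 x, h x)) ` {0..1}"
    then obtain x where x: "y = (chi 1 x, h x)" by auto
    have "y = (\<lambda>z. (z, g z)) (chi 1 x)" "chi 1 x \<in> sphere 0 1" using x g by auto
    then show "y \<in> (\<lambda>z. (z, g z)) ` sphere 0 1" by blast
  qed
  moreover have "compact ((\<lambda>x. (chi 1 x, h x)) ` {0..1})"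
    by (intro compact_continuous_image continuous_intros continuous_on_subset[OF assms(1)]) auto
  ultimately have "closed ((\<lambda>z. (z, g z)) ` sphere 0 1)"
    by (simp add: compact_imp_closed)
  moreover have "g \<in> sphere 0 1 \<rightarrow> h ` {0..1}"
    using Arg2pi_ge_0 Arg2pi_lt_2pi by (auto simp: g_def divide_simps less_imp_le intro!: imageI)
  moreover have "compact (h ` {0..1})"
    by (intro compact_continuous_image continuous_on_subset[OF assms(1)]) auto
  ultimately have "continuous_on (sphere 0 1) g"
    using continuous_from_closed_graph by blast
  with g show thesis using that by blast
qed

text \<open>By polynomial approximation \<open>f\<close> is orthogonal to every real continuous
  periodic function. Taking \<open>Re f\<close> and \<open>Im f\<close> as test functions and
  combining them gives the integral of \<open>cnj f * f\<close>, so \<open>|f|^2\<close> integrates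
  to 0.\<close>

lemma fourier_zero_imp_zero:
  assumes f: "circ f" and 0: "\<And>k. fourier f k = 0"
  shows "f x = 0"
proof -
  have orth: "integral {0..1} (\<lambda>x. of_real (h x) * f x) = 0"
    if h: "continuous_on UNIV h" "\<And>x. h (x + 1) = h x" for h
  proof -
    have ch: "circ (\<lambda>x. of_real (h x))"
      using h by (auto simp: circ_def intro!: continuous_intros)
    obtain g where g: "continuous_on (sphere 0 1) g" "\<And>x. g (chi 1 x) = h x"
      using circ_factor[OF h] by blast
    obtain B where B: "B > 0" "\<And>x. cmod (f x) \<le> B" using circ_bounded[OF f] by blast
    have "cmod (integral {0..1} (\<lambda>x. of_real (h x) * f x)) \<le> e" if e: "e > 0" for e
    proof -
      obtain p where p: "real_polynomial_function p" "\<And>z. z \<in> sphere 0 1 \<Longrightarrow> \<bar>g z - p z\<bar> < e / B"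
        using Stone_Weierstrass_real_polynomial_function[OF compact_sphere g(1), of "e / B"] e B by auto
      have pf: "circ (\<lambda>x. of_real (p (chi 1 x)) * f x)" "fourier (\<lambda>x. of_real (p (chi 1 x)) * f x) 0 = 0"
        using fourier_zero_mult_polynomial[OF p(1) f 0] by auto
      have hf: "circ (\<lambda>x. of_real (h x) * f x)" using ch f by auto
      have "integral {0..1} (\<lambda>x. of_real (h x) * f x) =
          fourier (\<lambda>x. of_real (h x) * f x - of_real (p (chi 1 x)) * f x) 0"
        using pf hf by (simp add: fourier_diff) (simp add: fourier_eq)
      also have "cmod \<dots> \<le> e"
      proof (rule fourier_bound)
        fix x
        have "cmod (of_real (h x) * f x - of_real (p (chi 1 x)) * f x) = \<bar>h x - p (chi 1 x)\<bar> * cmod (f x)"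
          by (simp add: norm_mult flip: left_diff_distrib of_real_diff)
        also have "\<dots> \<le> (e / B) * B"
          using p(2)[of "chi 1 x"] B e by (intro mult_mono) (auto simp: g(2))
        finally show "cmod (of_real (h x) * f x - of_real (p (chi 1 x)) * f x) \<le> e" using B by simp
      qed (use pf hf in auto)
      finally show ?thesis .
    qed
    then have "cmod (integral {0..1} (\<lambda>x. of_real (h x) * f x)) \<le> 0"
      by (rule field_le_epsilon) simp
    then show ?thesis by simp
  qed
  have c: "circ (\<lambda>x. of_real (Re (f x)))" "circ (\<lambda>x. of_real (Im (f x)))"
    using f by (auto simp: circ_def intro!: continuous_intros)
  have "integral {0..1} (\<lambda>x. of_real (Re (f x)) * f x - \<i> * (of_real (Im (f x)) * f x)) = 0"
    by (subst integral_diff)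
       (use c f orth[of "\<lambda>x. Re (f x)"] orth[of "\<lambda>x. Im (f x)"]
         in \<open>auto simp: circ_def intro!: continuous_intros\<close>)
  also have "(\<lambda>x. of_real (Re (f x)) * f x - \<i> * (of_real (Im (f x)) * f x)) = (\<lambda>x. of_real ((cmod (f x))\<^sup>2))"
    by (rule ext) (simp only: complex_norm_square, simp add: complex_eq_iff)
  finally have "integral {0..1} (\<lambda>x. complex_of_real ((cmod (f x))\<^sup>2)) = 0" .
  moreover have "integral {0..1} (\<lambda>x. complex_of_real ((cmod (f x))\<^sup>2)) =
      of_real (integral {0..1} (\<lambda>x. (cmod (f x))\<^sup>2))"
    by (rule integral_linear[OF _ bounded_linear_of_real, unfolded o_def])
       (intro integrable_continuous_interval continuous_intros circ_cont[OF f])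
  ultimately have "integral {0..1} (\<lambda>x. (cmod (f x))\<^sup>2) = 0" by simp
  then have "\<forall>x\<in>{0..1}. (cmod (f x))\<^sup>2 = 0"
    by (subst (asm) integral_eq_0_iff) (auto intro!: continuous_intros circ_cont[OF f])
  then show ?thesis
    using circ_ball[OF f, of "\<lambda>y. y = 0"] by auto
qed

lemma fourier_inject:
  assumes "circ f" "circ g" "\<And>k. fourier f k = fourier g k"
  shows "f = g"
proof
  fix x
  have "f x - g x = 0"
    by (rule fourier_zero_imp_zero[of "\<lambda>x. f x - g x"]) (use assms in \<open>auto simp: fourier_diff\<close>)
  then show "f x = g x" by simp
qed

lemma uniform_limit_fourier_series:
  assumes "(\<lambda>k. cmod (c k)) summable_on UNIV"
  shows "uniform_limit UNIV (\<lambda>K x. \<Sum>k\<in>K. c k * chi k x) (\<lambda>x. \<Sum>\<^sub>\<infinity>k. c k * chi k x)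
      (finite_subsets_at_top UNIV)"
  using assms by (intro Weierstrass_m_test_general[where M = "\<lambda>k. cmod (c k)"]) (auto simp: norm_mult)

text \<open>A finite partial sum whose index set contains \<open>j\<close> already has the exact
  coefficient \<open>c j\<close>, and coefficients pass to uniform limits.\<close>

lemma
  assumes c: "(\<lambda>k. cmod (c k)) summable_on UNIV"
  shows circ_fourier_series: "circ (\<lambda>x. \<Sum>\<^sub>\<infinity>k. c k * chi k x)"
    and fourier_fourier_series: "fourier (\<lambda>x. \<Sum>\<^sub>\<infinity>k. c k * chi k x) j = c j"
proof -
  note ul = uniform_limit_fourier_series[OF c]
  have circ: "circ (\<lambda>x. \<Sum>k\<in>K. c k * chi k x)" for K
    by (intro circ_sum circ_mult circ_const circ_chi)
  show "circ (\<lambda>x. \<Sum>\<^sub>\<infinity>k. c k * chi k x)"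
    by (rule circ_uniform_limit[OF ul circ]) simp
  have lim: "((\<lambda>K. fourier (\<lambda>x. \<Sum>k\<in>K. c k * chi k x) j) \<longlongrightarrow> fourier (\<lambda>x. \<Sum>\<^sub>\<infinity>k. c k * chi k x) j)
      (finite_subsets_at_top UNIV)"
    by (rule fourier_tendsto[OF ul circ]) simp
  have "\<forall>\<^sub>F K in finite_subsets_at_top UNIV. fourier (\<lambda>x. \<Sum>k\<in>K. c k * chi k x) j = c j"
    using eventually_finite_subsets_at_top_weakI[of UNIV "\<lambda>K. finite K"]
  proof (rule eventually_mono[OF eventually_conj])
    show "\<forall>\<^sub>F K in finite_subsets_at_top UNIV. j \<in> K"
      unfolding eventually_finite_subsets_at_top by (auto intro!: exI[of _ "{j}"])
    fix K assume K: "finite K \<and> j \<in> K"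
    have "fourier (\<lambda>x. \<Sum>k\<in>K. c k * chi k x) j = (\<Sum>k\<in>K. if k = j then c j else 0)"
    proof -
      have "fourier (\<lambda>x. \<Sum>k\<in>K. c k * chi k x) j = (\<Sum>k\<in>K. fourier (\<lambda>x. c k * chi k x) j)"
        using K by (intro fourier_sum) auto
      also have "\<dots> = (\<Sum>k\<in>K. if k = j then c j else 0)"
        by (intro sum.cong refl) (auto simp: fourier_scale fourier_chi)
      finally show ?thesis .
    qed
    also have "\<dots> = c j" using K by simp
    finally show "fourier (\<lambda>x. \<Sum>k\<in>K. c k * chi k x) j = c j" .
  qed auto
  then have "((\<lambda>K. fourier (\<lambda>x. \<Sum>k\<in>K. c k * chi k x) j) \<longlongrightarrow> c j) (finite_subsets_at_top UNIV)"
    by (rule tendsto_eventually)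
  then show "fourier (\<lambda>x. \<Sum>\<^sub>\<infinity>k. c k * chi k x) j = c j"
    using lim tendsto_unique finite_subsets_at_top_neq_bot by blast
qed

text \<open>Both sides are continuous and share all coefficients, so uniqueness replaces a pointwise
  convergence argument.\<close>

lemma fourier_inversion:
  assumes "circ f" "(\<lambda>k. cmod (fourier f k)) summable_on UNIV"
  shows "f = (\<lambda>x. \<Sum>\<^sub>\<infinity>k. fourier f k * chi k x)"
  by (rule fourier_inject)
     (use assms in \<open>auto simp: circ_fourier_series fourier_fourier_series\<close>)

subsection \<open>Sobolev bounds\<close>

text \<open>The square root of the weight in \<open>sobolev_norm\<close>, so that the norm is the l2
  norm of \<open>weight r k * cmod (fourier f k)\<close>; the exponent is additive in
  \<open>r\<close>.\<close>

definition weight :: "real \<Rightarrow> int \<Rightarrow> real" where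
  "weight r k = (1 + (real_of_int k)\<^sup>2) powr (r / 2)"

text \<open>A norm bound tested on finite frequency sets. It expresses finiteness and size at once,
  avoids infinite sums, and survives limits of the individual coefficients.\<close>

definition sobolev_le :: "real \<Rightarrow> (real \<Rightarrow> complex) \<Rightarrow> real \<Rightarrow> bool" where
  "sobolev_le r f M \<longleftrightarrow> (\<forall>K. finite K \<longrightarrow> L2_set (\<lambda>k. weight r k * cmod (fourier f k)) K \<le> M)"

text \<open>A bound in the Wiener algebra of absolutely convergent Fourier series, encoded in the
  same finite form.\<close>

definition wiener_le :: "(real \<Rightarrow> complex) \<Rightarrow> real \<Rightarrow> bool" where
  "wiener_le f A \<longleftrightarrow> (\<forall>K. finite K \<longrightarrow> (\<Sum>k\<in>K. cmod (fourier f k)) \<le> A)"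

lemma weight_pos [simp]: "weight r k > 0"
proof -
  have "1 + (real_of_int k)\<^sup>2 > 0" by (simp add: add_pos_nonneg)
  then show ?thesis by (simp add: weight_def)
qed

lemma weight_nonneg [simp]: "weight r k \<ge> 0"
  using weight_pos[of r k] by linarith

lemma weight_add: "weight (r + r') k = weight r k * weight r' k"
  by (simp add: weight_def add_divide_distrib powr_add)

lemma weight_0 [simp]: "weight r 0 = 1" "weight 0 k = 1"
proof -
  have "1 + (real_of_int k)\<^sup>2 > 0" by (simp add: add_pos_nonneg)
  then show "weight r 0 = 1" "weight 0 k = 1" by (auto simp: weight_def)
qed

lemma weight_mono: "r \<le> r' \<Longrightarrow> weight r k \<le> weight r' k"
  unfolding weight_def by (intro powr_mono) auto

lemma weight_square: "(weight r k)\<^sup>2 = (1 + (real_of_int k)\<^sup>2) powr r"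
proof -
  have "1 + (real_of_int k)\<^sup>2 > 0" by (simp add: add_pos_nonneg)
  then show ?thesis by (simp add: weight_def power2_eq_square flip: powr_add)
qed

lemma abs_le_weight: "\<bar>real_of_int k\<bar> \<le> weight 1 k"
proof -
  have "\<bar>real_of_int k\<bar> = sqrt ((real_of_int k)\<^sup>2)" by simp
  also have "\<dots> \<le> sqrt (1 + (real_of_int k)\<^sup>2)" by (intro real_sqrt_le_mono) simp
  also have "\<dots> = weight 1 k" by (simp add: weight_def powr_half_sqrt)
  finally show ?thesis .
qed

text \<open>Lets the weight at an output frequency of a product fall on one of the two input
  frequencies, for any real order. The factor comes from \<open>1 + (i + j)^2 \<le> 4 * M\<close>
  with \<open>M\<close> the larger of the two base weights, raised to the power
  \<open>r / 2\<close>.\<close>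

lemma weight_split:
  assumes "r \<ge> 0" shows "weight r (i + j) \<le> 2 powr r * (weight r i + weight r j)"
proof -
  define M where "M = max (1 + (real_of_int i)\<^sup>2) (1 + (real_of_int j)\<^sup>2)"
  have M: "M > 0" by (auto simp: M_def less_max_iff_disj add_pos_nonneg)
  have "(real_of_int (i + j))\<^sup>2 \<le> 2 * (real_of_int i)\<^sup>2 + 2 * (real_of_int j)\<^sup>2"
    using zero_le_power2[of "real_of_int i - real_of_int j"] by (simp add: power2_eq_square algebra_simps)
  moreover have "1 + (real_of_int i)\<^sup>2 \<le> M" "1 + (real_of_int j)\<^sup>2 \<le> M" by (auto simp: M_def)
  ultimately have "1 + (real_of_int (i + j))\<^sup>2 \<le> 4 * M" by linarith
  then have "weight r (i + j) \<le> (4 * M) powr (r/2)"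
    unfolding weight_def using assms by (intro powr_mono2) auto
  also have "\<dots> = (2 powr 2) powr (r/2) * M powr (r/2)"
    using M by (simp add: powr_mult)
  also have "\<dots> = 2 powr r * M powr (r/2)" by (simp only: powr_powr) simp
  also have "M powr (r/2) \<le> weight r i + weight r j"
    using weight_nonneg[of r i] weight_nonneg[of r j]
    by (auto simp: M_def max_def weight_def split: if_splits)
  finally show ?thesis by simp
qed

lemma sobolev_leD: "sobolev_le r f M \<Longrightarrow> finite K \<Longrightarrow> L2_set (\<lambda>k. weight r k * cmod (fourier f k)) K \<le> M"
  by (auto simp: sobolev_le_def)

lemma sobolev_le_nonneg: "sobolev_le r f M \<Longrightarrow> M \<ge> 0"
  using sobolev_leD[of r f M "{}"] by simp

lemma sobolev_le_mono: "sobolev_le r f M \<Longrightarrow> r' \<le> r \<Longrightarrow> M \<le> M' \<Longrightarrow> sobolev_le r' f M'"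
  unfolding sobolev_le_def
proof (intro allI impI)
  fix K :: "int set" assume a: "\<forall>K. finite K \<longrightarrow> L2_set (\<lambda>k. weight r k * cmod (fourier f k)) K \<le> M" "r' \<le> r" "M \<le> M'" "finite K"
  have "L2_set (\<lambda>k. weight r' k * cmod (fourier f k)) K \<le> L2_set (\<lambda>k. weight r k * cmod (fourier f k)) K"
    using a by (intro L2_set_mono mult_right_mono weight_mono) auto
  then show "L2_set (\<lambda>k. weight r' k * cmod (fourier f k)) K \<le> M'" using a by fastforce
qed

lemma sobolev_summand:
  "(1 + (real_of_int k)\<^sup>2) powr r * (cmod (fourier f k))\<^sup>2 = (weight r k * cmod (fourier f k))\<^sup>2"
  by (simp add: power_mult_distrib weight_square)

lemma sobolev_le_imp_sobolev:
  assumes "circ f" "sobolev_le r f M"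
  shows "f \<in> sobolev r" "sobolev_norm r f \<le> M"
proof -
  have b: "(\<Sum>k\<in>K. (weight r k * cmod (fourier f k))\<^sup>2) \<le> M\<^sup>2" if "finite K" for K
    using sobolev_leD[OF assms(2) that] unfolding L2_set_def by (rule sqrt_le_D)
  have s: "(\<lambda>k. (weight r k * cmod (fourier f k))\<^sup>2) summable_on UNIV"
    by (rule nonneg_bdd_above_summable_on) (use b in \<open>auto intro!: bdd_aboveI[of _ "M\<^sup>2"]\<close>)
  show "f \<in> sobolev r"
    using assms(1) s by (simp add: sobolev_def circ_def sobolev_summand)
  have "(\<Sum>\<^sub>\<infinity>k. (weight r k * cmod (fourier f k))\<^sup>2) \<le> M\<^sup>2"
    using s b by (intro infsum_le_finite_sums) auto
  then have "sqrt (\<Sum>\<^sub>\<infinity>k. (weight r k * cmod (fourier f k))\<^sup>2) \<le> sqrt (M\<^sup>2)"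
    by (rule real_sqrt_le_mono)
  then show "sobolev_norm r f \<le> M"
    unfolding sobolev_norm_def sobolev_summand using sobolev_le_nonneg[OF assms(2)] by simp
qed

lemma sobolevD:
  assumes "f \<in> sobolev r"
  shows "circ f" "sobolev_le r f (sobolev_norm r f)"
proof -
  show "circ f" using assms by (simp add: sobolev_def circ_def)
  have s: "(\<lambda>k. (weight r k * cmod (fourier f k))\<^sup>2) summable_on UNIV"
    using assms by (simp add: sobolev_def sobolev_summand)
  show "sobolev_le r f (sobolev_norm r f)"
    unfolding sobolev_le_def L2_set_def sobolev_norm_def sobolev_summand
    by (intro allI impI real_sqrt_le_mono finite_sum_le_infsum s) auto
qed

lemma sobolev_norm_nonneg [simp]: "sobolev_norm r f \<ge> 0"
  unfolding sobolev_norm_def by (intro real_sqrt_ge_zero infsum_nonneg) auto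

lemma sobolev_le_add:
  assumes "circ f" "circ g" "sobolev_le r f M" "sobolev_le r g N"
  shows "sobolev_le r (\<lambda>x. f x + g x) (M + N)"
  unfolding sobolev_le_def
proof (intro allI impI)
  fix K :: "int set" assume K: "finite K"
  have "L2_set (\<lambda>k. weight r k * cmod (fourier (\<lambda>x. f x + g x) k)) K
      \<le> L2_set (\<lambda>k. weight r k * cmod (fourier f k) + weight r k * cmod (fourier g k)) K"
    by (intro L2_set_mono)
       (use assms in \<open>auto simp: fourier_add norm_triangle_ineq simp flip: distrib_left intro!: mult_left_mono\<close>)
  also have "\<dots> \<le> L2_set (\<lambda>k. weight r k * cmod (fourier f k)) K + L2_set (\<lambda>k. weight r k * cmod (fourier g k)) K"
    by (rule L2_set_triangle_ineq)
  also have "\<dots> \<le> M + N" using sobolev_leD[OF assms(3) K] sobolev_leD[OF assms(4) K] by linarith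
  finally show "L2_set (\<lambda>k. weight r k * cmod (fourier (\<lambda>x. f x + g x) k)) K \<le> M + N" .
qed

lemma sobolev_le_scale:
  assumes "sobolev_le r f M" shows "sobolev_le r (\<lambda>x. c * f x) (cmod c * M)"
  unfolding sobolev_le_def
proof (intro allI impI)
  fix K :: "int set" assume K: "finite K"
  have "L2_set (\<lambda>k. weight r k * cmod (fourier (\<lambda>x. c * f x) k)) K
      = cmod c * L2_set (\<lambda>k. weight r k * cmod (fourier f k)) K"
    by (subst L2_set_right_distrib) (auto simp: fourier_scale norm_mult mult_ac)
  also have "\<dots> \<le> cmod c * M" using sobolev_leD[OF assms K] by (intro mult_left_mono) auto
  finally show "L2_set (\<lambda>k. weight r k * cmod (fourier (\<lambda>x. c * f x) k)) K \<le> cmod c * M" .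
qed

lemma sobolev_le_sum:
  assumes "finite I" "\<And>i. i \<in> I \<Longrightarrow> circ (f i)" "\<And>i. i \<in> I \<Longrightarrow> sobolev_le r (f i) (M i)"
  shows "sobolev_le r (\<lambda>x. \<Sum>i\<in>I. f i x) (\<Sum>i\<in>I. M i)"
  using assms
proof (induction I rule: finite_induct)
  case empty
  then show ?case by (simp add: sobolev_le_def fourier_eq L2_set_def)
next
  case (insert i I)
  then have "sobolev_le r (\<lambda>x. f i x + (\<Sum>i\<in>I. f i x)) (M i + (\<Sum>i\<in>I. M i))"
    by (intro sobolev_le_add) auto
  then show ?case using insert by simp
qed

lemma sobolev_le_chi: "sobolev_le r (chi j) (weight r j)"
  unfolding sobolev_le_def
proof (intro allI impI)
  fix K :: "int set" assume K: "finite K"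
  have "(\<Sum>k\<in>K. (weight r k * cmod (fourier (chi j) k))\<^sup>2) = (\<Sum>k\<in>K. if k = j then (weight r j)\<^sup>2 else 0)"
    by (intro sum.cong) (auto simp: fourier_chi)
  also have "\<dots> \<le> (weight r j)\<^sup>2" using K by simp
  finally show "L2_set (\<lambda>k. weight r k * cmod (fourier (chi j) k)) K \<le> weight r j"
    unfolding L2_set_def by (intro real_le_lsqrt) (auto intro: sum_nonneg)
qed

lemma sobolev_le_one: "sobolev_le r (\<lambda>_. 1) 1"
proof -
  have "chi 0 = (\<lambda>_. 1)" by (rule ext) simp
  then show ?thesis using sobolev_le_chi[of r 0] by simp
qed

lemma L2_set_tendsto:
  assumes "\<And>k. k \<in> K \<Longrightarrow> ((\<lambda>n. f n k) \<longlongrightarrow> g k) F"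
  shows "((\<lambda>n. L2_set (f n) K) \<longlongrightarrow> L2_set g K) F"
  unfolding L2_set_def by (intro tendsto_intros assms)

text \<open>Weak closedness of balls: a finite set of coefficients converges under uniform
  convergence, so the bound passes to the limit without convergence in the Sobolev norm.\<close>

lemma sobolev_le_limit:
  assumes "uniform_limit UNIV f g F" "\<And>n. circ (f n)" "F \<noteq> bot" "\<And>n. sobolev_le r (f n) M"
  shows "sobolev_le r g M"
  unfolding sobolev_le_def
proof (intro allI impI)
  fix K :: "int set" assume K: "finite K"
  have "((\<lambda>n. L2_set (\<lambda>k. weight r k * cmod (fourier (f n) k)) K) \<longlongrightarrow>
      L2_set (\<lambda>k. weight r k * cmod (fourier g k)) K) F"
    by (intro L2_set_tendsto tendsto_intros fourier_tendsto[OF assms(1-3)])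
  then show "L2_set (\<lambda>k. weight r k * cmod (fourier g k)) K \<le> M"
    by (rule tendsto_upperbound) (use sobolev_leD[OF assms(4) K] assms(3) in auto)
qed

lemma sobolev_add:
  assumes "f \<in> sobolev r" "g \<in> sobolev r"
  shows "(\<lambda>x. f x + g x) \<in> sobolev r"
    "sobolev_norm r (\<lambda>x. f x + g x) \<le> sobolev_norm r f + sobolev_norm r g"
proof -
  have "circ (\<lambda>x. f x + g x)" using sobolevD(1)[OF assms(1)] sobolevD(1)[OF assms(2)] by auto
  from sobolev_le_imp_sobolev[OF this sobolev_le_add] sobolevD[OF assms(1)] sobolevD[OF assms(2)]
  show "(\<lambda>x. f x + g x) \<in> sobolev r"
    "sobolev_norm r (\<lambda>x. f x + g x) \<le> sobolev_norm r f + sobolev_norm r g" by blast+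
qed

lemma sobolev_scale:
  assumes "f \<in> sobolev r"
  shows "(\<lambda>x. c * f x) \<in> sobolev r" "sobolev_norm r (\<lambda>x. c * f x) \<le> cmod c * sobolev_norm r f"
proof -
  have "circ (\<lambda>x. c * f x)" using sobolevD(1)[OF assms] by auto
  from sobolev_le_imp_sobolev[OF this sobolev_le_scale[OF sobolevD(2)[OF assms]]]
  show "(\<lambda>x. c * f x) \<in> sobolev r" "sobolev_norm r (\<lambda>x. c * f x) \<le> cmod c * sobolev_norm r f" .
qed

lemma sobolev_diff:
  assumes "f \<in> sobolev r" "g \<in> sobolev r"
  shows "(\<lambda>x. f x - g x) \<in> sobolev r"
  using sobolev_add(1)[OF assms(1) sobolev_scale(1)[OF assms(2), of "-1"]] by simp

lemma sobolev_chi: "chi k \<in> sobolev r"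
  using sobolev_le_imp_sobolev(1)[OF circ_chi sobolev_le_chi] .

lemma sobolev_one: "(\<lambda>_. 1) \<in> sobolev r"
  using sobolev_le_imp_sobolev(1)[OF circ_const sobolev_le_one] .

lemma sobolev_const: "(\<lambda>_. c) \<in> sobolev r"
  using sobolev_scale(1)[OF sobolev_one, of c] by simp

subsection \<open>Embeddings\<close>

text \<open>Each natural number is \<open>\<bar>k\<bar>\<close> for at most two integers; splitting
  by sign makes the absolute value injective.\<close>

lemma sum_int_bounded:
  fixes g :: "nat \<Rightarrow> real"
  assumes "summable g" "\<And>n. g n \<ge> 0" "finite K"
  shows "(\<Sum>k\<in>K. g (nat \<bar>k\<bar>)) \<le> 2 * suminf g"
proof -
  have a: "(\<Sum>k\<in>L. g (nat \<bar>k\<bar>)) \<le> suminf g" if "finite L" "inj_on (\<lambda>k. nat \<bar>k\<bar>) L" for L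
  proof -
    have "(\<Sum>k\<in>L. g (nat \<bar>k\<bar>)) = sum g ((\<lambda>k. nat \<bar>k\<bar>) ` L)"
      using that by (simp add: sum.reindex)
    also have "\<dots> \<le> suminf g" using that assms by (intro sum_le_suminf) auto
    finally show ?thesis .
  qed
  have "(\<Sum>k\<in>K. g (nat \<bar>k\<bar>)) = (\<Sum>k\<in>K\<inter>{0..}. g (nat \<bar>k\<bar>)) + (\<Sum>k\<in>K\<inter>{..<0}. g (nat \<bar>k\<bar>))"
    using assms(3) by (subst sum.union_disjoint[symmetric]) (auto intro!: sum.cong)
  also have "\<dots> \<le> suminf g + suminf g"
    using assms(3) by (intro add_mono a) (auto simp: inj_on_def)
  finally show ?thesis by simp
qed

lemma weight_L2_bound:
  assumes "r > 1/2"
  obtains C where "C > 0" "\<And>K. finite K \<Longrightarrow> L2_set (weight (-r)) K \<le> C"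
proof -
  \<comment> \<open>The value at 0 is set by hand: \<open>0 powr (-2*r)\<close> is 0, while the
    weight at frequency 0 is 1. The remaining series converges because
    \<open>2 * r > 1\<close>.\<close>
  define g where "g n = (if n = 0 then 1 else real n powr (-2*r))" for n
  have "summable (\<lambda>n. real n powr (-2*r))" using assms by (simp add: summable_real_powr_iff)
  then have g: "summable g"
    by (rule summable_comparison_test'[of _ 1]) (auto simp: g_def)
  have g0: "g n \<ge> 0" for n by (simp add: g_def)
  have le: "(weight (-r) k)\<^sup>2 \<le> g (nat \<bar>k\<bar>)" for k
  proof (cases "k = 0")
    case False
    have "(weight (-r) k)\<^sup>2 = (1 + (real_of_int k)\<^sup>2) powr (-r)" by (rule weight_square)
    also have "\<dots> \<le> ((real_of_int k)\<^sup>2) powr (-r)"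
      using False assms by (intro powr_mono2') auto
    also have "\<dots> = (\<bar>real_of_int k\<bar> powr 2) powr (-r)" using False by simp
    also have "\<dots> = \<bar>real_of_int k\<bar> powr (-2*r)" by (simp only: powr_powr) simp
    also have "\<dots> = g (nat \<bar>k\<bar>)" using False by (simp add: g_def)
    finally show ?thesis .
  qed (simp add: g_def)
  have "L2_set (weight (-r)) K \<le> sqrt (2 * suminf g) + 1" if "finite K" for K
  proof -
    have "(\<Sum>k\<in>K. (weight (-r) k)\<^sup>2) \<le> (\<Sum>k\<in>K. g (nat \<bar>k\<bar>))" by (intro sum_mono le)
    also have "\<dots> \<le> 2 * suminf g" by (rule sum_int_bounded[OF g g0 that])
    finally have "sqrt (\<Sum>k\<in>K. (weight (-r) k)\<^sup>2) \<le> sqrt (2 * suminf g)" by (rule real_sqrt_le_mono)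
    then show ?thesis unfolding L2_set_def by linarith
  qed
  moreover have "sqrt (2 * suminf g) + 1 > 0" using suminf_nonneg[OF g g0] by (simp add: add_nonneg_pos)
  ultimately show thesis using that by blast
qed

text \<open>Cauchy-Schwarz against the square-summable weights of order \<open>-r\<close>. The
  constant is uniform in the coefficients; every passage from l2 bounds to absolute summability goes
  through it.\<close>

lemma weighted_cauchy_schwarz:
  assumes "r > 1/2"
  obtains C where "C > 0" "\<And>a K. finite K \<Longrightarrow> (\<Sum>k\<in>K. \<bar>a k\<bar>) \<le> C * L2_set (\<lambda>k. weight r k * a k) K"
proof -
  obtain C where C: "C > 0" "\<And>K. finite K \<Longrightarrow> L2_set (weight (-r)) K \<le> C"
    using weight_L2_bound[OF assms] by blast
  have "(\<Sum>k\<in>K. \<bar>a k\<bar>) \<le> C * L2_set (\<lambda>k. weight r k * a k) K" if "finite K" for a K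
  proof -
    have 1: "weight (-r) k * weight r k = 1" for k by (simp flip: weight_add)
    have "(\<Sum>k\<in>K. \<bar>a k\<bar>) = (\<Sum>k\<in>K. \<bar>weight (-r) k\<bar> * \<bar>weight r k * a k\<bar>)"
      by (intro sum.cong refl) (simp add: abs_mult 1 flip: mult.assoc)
    also have "\<dots> \<le> L2_set (weight (-r)) K * L2_set (\<lambda>k. weight r k * a k) K"
      by (rule L2_set_mult_ineq)
    also have "\<dots> \<le> C * L2_set (\<lambda>k. weight r k * a k) K"
      by (intro mult_right_mono C that) auto
    finally show ?thesis .
  qed
  with C(1) show thesis using that by blast
qed

lemma sobolev_wiener:
  assumes "r > 1/2"
  obtains C where "C > 0" "\<And>f M. sobolev_le r f M \<Longrightarrow> wiener_le f (C * M)"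
proof -
  obtain C where C: "C > 0" "\<And>a K. finite K \<Longrightarrow> (\<Sum>k\<in>K. \<bar>a k\<bar>) \<le> C * L2_set (\<lambda>k. weight r k * a k) K"
    using weighted_cauchy_schwarz[OF assms] by blast
  have "wiener_le f (C * M)" if "sobolev_le r f M" for f M
    unfolding wiener_le_def
  proof (intro allI impI)
    fix K :: "int set" assume K: "finite K"
    have "(\<Sum>k\<in>K. cmod (fourier f k)) \<le> C * L2_set (\<lambda>k. weight r k * cmod (fourier f k)) K"
      using C(2)[OF K, of "\<lambda>k. cmod (fourier f k)"] by simp
    also have "\<dots> \<le> C * M" using C(1) sobolev_leD[OF that K] by simp
    finally show "(\<Sum>k\<in>K. cmod (fourier f k)) \<le> C * M" .
  qed
  with C(1) show thesis using that by blast
qed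

lemma wiener_le_summable: "wiener_le f A \<Longrightarrow> (\<lambda>k. cmod (fourier f k)) summable_on UNIV"
  by (rule nonneg_bdd_above_summable_on) (auto simp: wiener_le_def intro!: bdd_aboveI[of _ A])

lemma wiener_le_sup:
  assumes "circ f" "wiener_le f A" shows "cmod (f x) \<le> A"
proof -
  note s = wiener_le_summable[OF assms(2)]
  have "f x = (\<Sum>\<^sub>\<infinity>k. fourier f k * chi k x)"
    using fourier_inversion[OF assms(1) s] by (rule fun_cong)
  also have "cmod \<dots> \<le> (\<Sum>\<^sub>\<infinity>k. cmod (fourier f k * chi k x))"
    by (rule norm_infsum_bound) (use s in \<open>simp add: norm_mult\<close>)
  also have "\<dots> = (\<Sum>\<^sub>\<infinity>k. cmod (fourier f k))" by (simp add: norm_mult)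
  also have "\<dots> \<le> A" using s assms(2) by (intro infsum_le_finite_sums) (auto simp: wiener_le_def)
  finally show ?thesis .
qed

lemma sobolev_sup:
  assumes "r > 1/2"
  obtains C where "C > 0" "\<And>f x. f \<in> sobolev r \<Longrightarrow> cmod (f x) \<le> C * sobolev_norm r f"
  using sobolev_wiener[OF assms] wiener_le_sup sobolevD by metis

text \<open>The increment of a primitive over one period does not depend on the starting point and
  equals the mean \<open>fourier g 0\<close>; hence mean zero makes the primitive periodic.\<close>

lemma circ_antiderivative:
  assumes "circ g" "fourier g 0 = 0"
  obtains G where "circ G" "\<And>x. (G has_vector_derivative g x) (at x)"
proof -
  have "\<exists>G. \<forall>x::real. -\<infinity> < ereal x \<longrightarrow> ereal x < \<infinity> \<longrightarrow> (G has_vector_derivative g x) (at x)"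
    by (rule einterval_antiderivative)
       (use circ_cont[OF assms(1), of UNIV] in \<open>auto simp: continuous_on_eq_continuous_at\<close>)
  then obtain G where G: "\<And>x. (G has_vector_derivative g x) (at x)" by auto
  have "G (x + 1) - G x = G (0 + 1) - G 0" for x
  proof (rule has_derivative_zero_unique[where f = "\<lambda>x. G (x + 1) - G x" and s = UNIV])
    fix x
    have "((\<lambda>x. G (x + 1) - G x) has_vector_derivative g (x + 1) - g x) (at x)"
    proof (intro has_vector_derivative_diff G)
      have "((\<lambda>x::real. x + 1) has_vector_derivative 1) (at x)"
        by (auto intro!: derivative_eq_intros)
      from vector_diff_chain_at[OF this G]
      show "((\<lambda>x. G (x + 1)) has_vector_derivative g (x + 1)) (at x)"
        by (simp add: o_def)
    qed
    then show "((\<lambda>x. G (x + 1) - G x) has_derivative (\<lambda>h. 0)) (at x)"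
      by (simp add: circ_per[OF assms(1)] has_vector_derivative_def)
  qed auto
  moreover have "(g has_integral G 1 - G 0) {0..1}"
    by (rule fundamental_theorem_of_calculus) (auto intro: has_vector_derivative_at_within G)
  then have "G 1 - G 0 = 0" using assms(2) by (simp add: fourier_eq has_integral_iff)
  ultimately have per: "G (x + 1) = G x" for x
    by (metis add_0 eq_iff_diff_eq_0)
  have "continuous_on UNIV G"
    using has_vector_derivative_continuous[OF G] by (auto simp: continuous_on_eq_continuous_at)
  with per have "circ G" by (simp add: circ_def)
  with G show thesis using that by blast
qed

text \<open>The candidate derivative is built from the coefficients
  \<open>2 * pi * \<i> * k * fourier f k\<close>, absolutely summable since
  \<open>r - 1 > 1/2\<close>. It is integrated, and the primitive is identified with
  \<open>f\<close> by uniqueness of coefficients, so no series is differentiated term by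
  term.\<close>

lemma sobolev_C1:
  assumes r: "r > 3/2" and f: "circ f" "sobolev_le r f M"
  obtains f' where "\<And>x. (f has_vector_derivative f' x) (at x)" "circ f'"
    "sobolev_le (r - 1) f' (2 * pi * M)"
proof -
  define c where "c k = 2 * pi * \<i> * k * fourier f k" for k
  obtain C where C: "C > 0" "\<And>a K. finite K \<Longrightarrow> (\<Sum>k\<in>K. \<bar>a k\<bar>) \<le> C * L2_set (\<lambda>k. weight (r-1) k * a k) K"
    using weighted_cauchy_schwarz[of "r - 1"] r by auto
  have cb: "L2_set (\<lambda>k. weight (r-1) k * cmod (c k)) K \<le> 2 * pi * M" if "finite K" for K
  proof -
    have "L2_set (\<lambda>k. weight (r-1) k * cmod (c k)) K \<le> L2_set (\<lambda>k. 2 * pi * (weight r k * cmod (fourier f k))) K"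
    proof (rule L2_set_mono)
      fix k
      have "weight (r-1) k * cmod (c k) = 2 * pi * ((weight (r-1) k * \<bar>real_of_int k\<bar>) * cmod (fourier f k))"
        by (simp add: c_def norm_mult)
      also have "\<dots> \<le> 2 * pi * ((weight (r-1) k * weight 1 k) * cmod (fourier f k))"
        using abs_le_weight[of k] by (intro mult_left_mono mult_right_mono) auto
      also have "weight (r-1) k * weight 1 k = weight r k" by (simp flip: weight_add)
      finally show "weight (r-1) k * cmod (c k) \<le> 2 * pi * (weight r k * cmod (fourier f k))" .
    qed auto
    also have "\<dots> = 2 * pi * L2_set (\<lambda>k. weight r k * cmod (fourier f k)) K"
      by (rule L2_set_right_distrib[symmetric]) simp
    also have "\<dots> \<le> 2 * pi * M" using sobolev_leD[OF f(2) that] by simp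
    finally show ?thesis .
  qed
  have "(\<Sum>k\<in>K. cmod (c k)) \<le> C * (2 * pi * M)" if "finite K" for K
  proof -
    have "(\<Sum>k\<in>K. cmod (c k)) \<le> C * L2_set (\<lambda>k. weight (r-1) k * cmod (c k)) K"
      using C(2)[OF that, of "\<lambda>k. cmod (c k)"] by simp
    also have "\<dots> \<le> C * (2 * pi * M)" using C(1) cb[OF that] by (intro mult_left_mono) auto
    finally show ?thesis .
  qed
  then have c: "(\<lambda>k. cmod (c k)) summable_on UNIV"
    by (intro nonneg_bdd_above_summable_on) (auto intro!: bdd_aboveI[of _ "C * (2 * pi * M)"])
  define g where "g x = (\<Sum>\<^sub>\<infinity>k. c k * chi k x)" for x
  have g: "circ g" "\<And>k. fourier g k = c k"
    unfolding g_def using c by (auto simp: circ_fourier_series fourier_fourier_series)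
  have "fourier g 0 = 0" by (simp add: g c_def)
  then obtain G where G: "circ G" "\<And>x. (G has_vector_derivative g x) (at x)"
    using circ_antiderivative[OF g(1)] by blast
  \<comment> \<open>The derivative determines every coefficient except the mean; \<open>d\<close>
    corrects that one.\<close>
  define d where "d = fourier f 0 - fourier G 0"
  have "f = (\<lambda>x. G x + d * chi 0 x)"
  proof (rule fourier_inject)
    fix k
    have "k = 0 \<or> fourier f k = fourier G k"
      using fourier_parts[OF G(2) G(1) g(1), of k] g(2)[of k] by (simp add: c_def)
    moreover have "fourier (\<lambda>x. G x + d * chi 0 x) k = fourier G k + d * fourier (chi 0) k"
      using G(1) fourier_add[of G "\<lambda>x. d * chi 0 x" k] fourier_scale[of d "chi 0" k] by auto
    ultimately show "fourier f k = fourier (\<lambda>x. G x + d * chi 0 x) k"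
      by (auto simp: fourier_chi d_def)
  qed (use f G in auto)
  then have "f = (\<lambda>x. G x + d)" by simp
  then have "(f has_vector_derivative g x) (at x)" for x
    using has_vector_derivative_add[OF G(2) has_vector_derivative_const[of d], of x] by simp
  moreover have "sobolev_le (r - 1) g (2 * pi * M)"
    using cb by (auto simp: sobolev_le_def g)
  ultimately show thesis using that g(1) by blast
qed

text \<open>Expand the nonnegative integral of \<open>|f - S|^2\<close> for the partial sum
  \<open>S\<close> over \<open>K\<close>: the pairing of \<open>f\<close> with \<open>S\<close> and
  the squared norm of \<open>S\<close> both equal \<open>P\<close>, which leaves \<open>P\<close> at
  most the integral of \<open>|f|^2\<close>.\<close>

lemma bessel:
  assumes "circ f" "\<And>x. cmod (f x) \<le> B" "finite K"
  shows "L2_set (\<lambda>k. cmod (fourier f k)) K \<le> B"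
proof -
  have B: "B \<ge> 0" using assms(2) norm_ge_zero order_trans by blast
  define S where "S x = (\<Sum>k\<in>K. fourier f k * chi k x)" for x
  have S: "circ S" unfolding S_def by auto
  have fS: "fourier S k = fourier f k" if "k \<in> K" for k
  proof -
    have "fourier S k = (\<Sum>j\<in>K. fourier (\<lambda>x. fourier f j * chi j x) k)"
      unfolding S_def using assms(3) by (intro fourier_sum) auto
    also have "\<dots> = (\<Sum>j\<in>K. if j = k then fourier f k else 0)"
      by (intro sum.cong refl) (auto simp: fourier_scale fourier_chi)
    also have "\<dots> = fourier f k" using that assms(3) by simp
    finally show ?thesis .
  qed
  define P where "P = (\<Sum>k\<in>K. (cmod (fourier f k))\<^sup>2)"
  have ip: "integral {0..1} (\<lambda>x. h x * cnj (S x)) = (\<Sum>k\<in>K. fourier h k * cnj (fourier f k))"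
    if "circ h" for h
  proof -
    have "integral {0..1} (\<lambda>x. h x * cnj (S x)) =
        integral {0..1} (\<lambda>x. \<Sum>k\<in>K. cnj (fourier f k) * (h x * chi (-k) x))"
      by (simp add: S_def cnj_chi sum_distrib_left mult_ac)
    also have "\<dots> = (\<Sum>k\<in>K. integral {0..1} (\<lambda>x. cnj (fourier f k) * (h x * chi (-k) x)))"
      by (rule integral_sum) (use assms(3) that in auto)
    also have "\<dots> = (\<Sum>k\<in>K. fourier h k * cnj (fourier f k))"
      by (simp only: integral_mult_right fourier_eq[symmetric] mult.commute)
    finally show ?thesis .
  qed
  have P: "of_real P = (\<Sum>k\<in>K. fourier f k * cnj (fourier f k))"
    unfolding P_def of_real_sum complex_norm_square ..
  have fSi: "integral {0..1} (\<lambda>x. f x * cnj (S x)) = of_real P" using ip[OF assms(1)] P by simp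
  have SSi: "integral {0..1} (\<lambda>x. S x * cnj (S x)) = of_real P" using ip[OF S] P by (simp add: fS)
  have i1: "(\<lambda>x. f x * cnj (S x)) integrable_on {0..1}" "(\<lambda>x. S x * cnj (S x)) integrable_on {0..1}"
    using assms(1) S by auto
  have Re: "integral {0..1} (\<lambda>x. Re (h x)) = Re (integral {0..1} h)" if "h integrable_on {0..1}" for h
    using integral_linear[OF that bounded_linear_Re] by (simp add: o_def)
  have rfS: "integral {0..1} (\<lambda>x. Re (f x * cnj (S x))) = P" using Re[OF i1(1)] fSi by simp
  have rSS: "integral {0..1} (\<lambda>x. (cmod (S x))\<^sup>2) = P"
  proof -
    have "(\<lambda>x. (cmod (S x))\<^sup>2) = (\<lambda>x. Re (S x * cnj (S x)))"
      by (rule ext) (simp only: cmod_power2, simp add: power2_eq_square)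
    then show ?thesis using Re[OF i1(2)] SSi by simp
  qed
  have c: "continuous_on {0..1} f" "continuous_on {0..1} S" using assms(1) S circ_cont by auto
  have "0 \<le> integral {0..1} (\<lambda>x. (cmod (f x - S x))\<^sup>2)"
    by (intro integral_nonneg integrable_continuous_interval continuous_intros c) auto
  also have "(\<lambda>x. (cmod (f x - S x))\<^sup>2) =
      (\<lambda>x. ((cmod (f x))\<^sup>2 - 2 * Re (f x * cnj (S x))) + (cmod (S x))\<^sup>2)"
    by (rule ext) (simp only: cmod_power2, simp add: power2_eq_square algebra_simps)
  also have "integral {0..1} \<dots> = (integral {0..1} (\<lambda>x. (cmod (f x))\<^sup>2) - 2 * P) + P"
    by (subst integral_add integral_diff, (intro integrable_continuous_interval continuous_intros c)+)+
       (simp add: rfS rSS del: times_complex.simps complex_cnj)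
  also have "integral {0..1} (\<lambda>x. (cmod (f x))\<^sup>2) \<le> integral {0..1} (\<lambda>x::real. B\<^sup>2)"
    by (rule integral_le) (auto intro!: integrable_continuous_interval continuous_intros c power_mono assms)
  finally have "P \<le> B\<^sup>2" by simp
  then have "sqrt P \<le> sqrt (B\<^sup>2)" by (rule real_sqrt_le_mono)
  then show ?thesis using B by (simp add: L2_set_def P_def)
qed

text \<open>The weight of order 1 is at most \<open>1 + 2 * pi * \<bar>k\<bar>\<close>, so the
  coefficients of \<open>f\<close> and \<open>f'\<close> control it and Bessel turns them into sup
  norms. The constant is independent of \<open>f\<close>, which allows its application to all powers
  of one function.\<close>

lemma C1_wiener:
  obtains C where "C > 0" "\<And>f f' X Y. (\<And>x. (f has_vector_derivative f' x) (at x)) \<Longrightarrow> circ f \<Longrightarrow> circ f' \<Longrightarrow>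
     (\<And>x. cmod (f x) \<le> X) \<Longrightarrow> (\<And>x. cmod (f' x) \<le> Y) \<Longrightarrow> wiener_le f (C * (X + Y))"
proof -
  obtain C where C: "C > 0" "\<And>a K. finite K \<Longrightarrow> (\<Sum>k\<in>K. \<bar>a k\<bar>) \<le> C * L2_set (\<lambda>k. weight 1 k * a k) K"
    using weighted_cauchy_schwarz[of 1] by auto
  have "wiener_le f (C * (X + Y))" if d: "\<And>x. (f has_vector_derivative f' x) (at x)"
    and f: "circ f" "circ f'" and b: "\<And>x. cmod (f x) \<le> X" "\<And>x. cmod (f' x) \<le> Y" for f f' X Y
    unfolding wiener_le_def
  proof (intro allI impI)
    fix K :: "int set" assume K: "finite K"
    have "(\<Sum>k\<in>K. cmod (fourier f k)) \<le> C * L2_set (\<lambda>k. weight 1 k * cmod (fourier f k)) K"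
      using C(2)[OF K, of "\<lambda>k. cmod (fourier f k)"] by simp
    also have "L2_set (\<lambda>k. weight 1 k * cmod (fourier f k)) K \<le> L2_set (\<lambda>k. cmod (fourier f k) + cmod (fourier f' k)) K"
    proof (rule L2_set_mono)
      fix k
      have "weight 1 k = sqrt (1 + (real_of_int k)\<^sup>2)" by (simp add: weight_def powr_half_sqrt)
      also have "\<dots> \<le> sqrt ((1 + \<bar>real_of_int k\<bar>)\<^sup>2)"
        by (intro real_sqrt_le_mono) (simp add: power2_sum)
      finally have "weight 1 k \<le> 1 + \<bar>real_of_int k\<bar>" by simp
      also have "\<dots> \<le> 1 + 2 * pi * \<bar>real_of_int k\<bar>"
        using pi_ge_two mult_right_mono[of 1 "2 * pi" "\<bar>real_of_int k\<bar>"] by simp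
      finally have "weight 1 k * cmod (fourier f k) \<le> (1 + 2 * pi * \<bar>real_of_int k\<bar>) * cmod (fourier f k)"
        by (intro mult_right_mono) auto
      also have "\<dots> = cmod (fourier f k) + cmod (fourier f' k)"
        by (simp add: fourier_parts[OF d f] norm_mult algebra_simps)
      finally show "weight 1 k * cmod (fourier f k) \<le> cmod (fourier f k) + cmod (fourier f' k)" .
    qed auto
    also have "\<dots> \<le> L2_set (\<lambda>k. cmod (fourier f k)) K + L2_set (\<lambda>k. cmod (fourier f' k)) K"
      by (rule L2_set_triangle_ineq)
    also have "\<dots> \<le> X + Y" by (intro add_mono bessel f b K)
    finally show "(\<Sum>k\<in>K. cmod (fourier f k)) \<le> C * (X + Y)" using C(1) by simp
  qed
  with C(1) show thesis using that by blast
qed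

subsection \<open>The Sobolev algebra\<close>

lemma L2_set_sum_le:
  assumes "finite J"
  shows "L2_set (\<lambda>k. \<Sum>j\<in>J. g j k) K \<le> (\<Sum>j\<in>J. L2_set (g j) K)"
  using assms
proof (induction J rule: finite_induct)
  case empty
  then show ?case by (simp add: L2_set_def)
next
  case (insert j J)
  have "L2_set (\<lambda>k. g j k + (\<Sum>j\<in>J. g j k)) K \<le> L2_set (g j) K + L2_set (\<lambda>k. \<Sum>j\<in>J. g j k) K"
    by (rule L2_set_triangle_ineq)
  then show ?case using insert by simp
qed

text \<open>Young's inequality for l1 and l2: translation only moves the finite index set, and the
  bound on \<open>v\<close> holds for every finite set.\<close>

lemma young_convolution:
  fixes a v :: "int \<Rightarrow> real"
  assumes J: "finite J" and K: "finite K" and a: "\<And>j. a j \<ge> 0" "(\<Sum>j\<in>J. a j) \<le> A"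
    and v: "\<And>I. finite I \<Longrightarrow> L2_set v I \<le> N"
  shows "L2_set (\<lambda>k. \<Sum>j\<in>J. a j * v (k - j)) K \<le> A * N"
proof -
  have N: "N \<ge> 0" using v[of "{}"] by simp
  have "L2_set (\<lambda>k. \<Sum>j\<in>J. a j * v (k - j)) K \<le> (\<Sum>j\<in>J. L2_set (\<lambda>k. a j * v (k - j)) K)"
    by (rule L2_set_sum_le[OF J])
  also have "\<dots> \<le> (\<Sum>j\<in>J. a j * N)"
  proof (rule sum_mono)
    fix j
    have "L2_set (\<lambda>k. v (k - j)) K = L2_set v ((\<lambda>k. k - j) ` K)"
      unfolding L2_set_def by (subst sum.reindex) (auto simp: inj_on_def)
    also have "\<dots> \<le> N" using K by (intro v) auto
    finally have "a j * L2_set (\<lambda>k. v (k - j)) K \<le> a j * N" using a(1) by (rule mult_left_mono)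
    then show "L2_set (\<lambda>k. a j * v (k - j)) K \<le> a j * N"
      by (simp add: L2_set_right_distrib a)
  qed
  also have "\<dots> \<le> A * N" using a N by (simp add: mult_right_mono flip: sum_distrib_right)
  finally show ?thesis .
qed

text \<open>Multiplying \<open>g\<close> by a finite partial sum of \<open>f\<close> combines shifts
  of its coefficients; uniform convergence of these sums gives the full convolution.\<close>

lemma fourier_mult:
  assumes "circ f" "circ g" "wiener_le f A"
  shows "((\<lambda>J. \<Sum>j\<in>J. fourier f j * fourier g (k - j)) \<longlongrightarrow> fourier (\<lambda>x. f x * g x) k)
    (finite_subsets_at_top UNIV)"
proof -
  note s = wiener_le_summable[OF assms(3)]
  obtain B where B: "\<And>x. cmod (f x) \<le> B" using circ_bounded[OF assms(1)] by blast
  obtain B' where B': "\<And>x. cmod (g x) \<le> B'" using circ_bounded[OF assms(2)] by blast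
  have "uniform_limit UNIV (\<lambda>J x. \<Sum>j\<in>J. fourier f j * chi j x) f (finite_subsets_at_top UNIV)"
    by (subst (2) fourier_inversion[OF assms(1) s]) (rule uniform_limit_fourier_series[OF s])
  then have "uniform_limit UNIV (\<lambda>J x. (\<Sum>j\<in>J. fourier f j * chi j x) * g x) (\<lambda>x. f x * g x)
      (finite_subsets_at_top UNIV)"
    by (intro uniform_lim_mult uniform_limit_const) (auto simp: bounded_iff intro: B B')
  then have "((\<lambda>J. fourier (\<lambda>x. (\<Sum>j\<in>J. fourier f j * chi j x) * g x) k) \<longlongrightarrow> fourier (\<lambda>x. f x * g x) k)
      (finite_subsets_at_top UNIV)"
    by (rule fourier_tendsto) (use assms in auto)
  moreover have "\<forall>\<^sub>F J in finite_subsets_at_top UNIV.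
      fourier (\<lambda>x. (\<Sum>j\<in>J. fourier f j * chi j x) * g x) k = (\<Sum>j\<in>J. fourier f j * fourier g (k - j))"
  proof (rule eventually_finite_subsets_at_top_weakI)
    fix J :: "int set" assume J: "finite J"
    have "(\<lambda>x. (\<Sum>j\<in>J. fourier f j * chi j x) * g x) = (\<lambda>x. \<Sum>j\<in>J. fourier f j * (chi j x * g x))"
      by (simp add: sum_distrib_right mult.assoc)
    then have "fourier (\<lambda>x. (\<Sum>j\<in>J. fourier f j * chi j x) * g x) k
        = (\<Sum>j\<in>J. fourier (\<lambda>x. fourier f j * (chi j x * g x)) k)"
      using J assms by (simp only:) (rule fourier_sum, auto)
    then show "fourier (\<lambda>x. (\<Sum>j\<in>J. fourier f j * chi j x) * g x) k = (\<Sum>j\<in>J. fourier f j * fourier g (k - j))"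
      by (simp add: fourier_scale fourier_chi_mult)
  qed
  ultimately show ?thesis by (rule Lim_transform_eventually)
qed

text \<open>A tame product estimate: the Sobolev bound of each factor meets only the Wiener bound of
  the other. Keeping the two bounds separate is what later makes squaring gain a small
  factor.\<close>

lemma sobolev_le_mult:
  assumes r: "r \<ge> 0" and f: "circ f" "wiener_le f A" "sobolev_le r f M" and g: "circ g" "wiener_le g B" "sobolev_le r g N"
  shows "sobolev_le r (\<lambda>x. f x * g x) (2 powr r * (A * N + B * M))"
  unfolding sobolev_le_def
proof (intro allI impI)
  fix K :: "int set" assume K: "finite K"
  define a where "a k = cmod (fourier f k)" for k
  define b where "b k = cmod (fourier g k)" for k
  have bound: "L2_set (\<lambda>k. weight r k * cmod (\<Sum>j\<in>J. fourier f j * fourier g (k - j))) K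
      \<le> 2 powr r * (A * N + B * M)" if J: "finite J" for J
  proof -
    \<comment> \<open>After substituting \<open>i = k - j\<close> in the second half, the index set
      would depend on \<open>k\<close>. \<open>I\<close> collects all these frequencies, and the
      terms are nonnegative, so summing over \<open>I\<close> only enlarges the sum.\<close>
    define I where "I = (\<lambda>(k, j). k - j) ` (K \<times> J)"
    have I: "finite I" using J K by (simp add: I_def)
    have "L2_set (\<lambda>k. weight r k * cmod (\<Sum>j\<in>J. fourier f j * fourier g (k - j))) K
        \<le> L2_set (\<lambda>k. 2 powr r * ((\<Sum>j\<in>J. a j * (weight r (k-j) * b (k-j))) + (\<Sum>i\<in>I. b i * (weight r (k-i) * a (k-i))))) K"
    proof (rule L2_set_mono)
      fix k assume k: "k \<in> K"
      have "weight r k * cmod (\<Sum>j\<in>J. fourier f j * fourier g (k - j)) \<le> weight r k * (\<Sum>j\<in>J. a j * b (k - j))"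
        by (intro mult_left_mono order.trans[OF norm_sum]) (auto simp: a_def b_def norm_mult)
      also have "\<dots> = (\<Sum>j\<in>J. weight r k * (a j * b (k - j)))" by (rule sum_distrib_left)
      also have "\<dots> \<le> (\<Sum>j\<in>J. 2 powr r * (weight r j + weight r (k-j)) * (a j * b (k - j)))"
      proof (intro sum_mono mult_right_mono)
        fix j show "weight r k \<le> 2 powr r * (weight r j + weight r (k-j))"
          using weight_split[OF r, of j "k - j"] by simp
      qed (auto simp: a_def b_def)
      also have "\<dots> = 2 powr r * ((\<Sum>j\<in>J. a j * (weight r (k-j) * b (k-j))) + (\<Sum>j\<in>J. b (k-j) * (weight r j * a j)))"
        by (simp add: sum_distrib_left algebra_simps flip: sum.distrib)
      also have "(\<Sum>j\<in>J. b (k-j) * (weight r j * a j)) = (\<Sum>i\<in>(\<lambda>j. k - j) ` J. b i * (weight r (k-i) * a (k-i)))"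
        by (subst sum.reindex) (auto simp: inj_on_def)
      also have "\<dots> \<le> (\<Sum>i\<in>I. b i * (weight r (k-i) * a (k-i)))"
        using k I by (intro sum_mono2) (auto simp: I_def a_def b_def)
      finally show "weight r k * cmod (\<Sum>j\<in>J. fourier f j * fourier g (k - j)) \<le>
         2 powr r * ((\<Sum>j\<in>J. a j * (weight r (k-j) * b (k-j))) + (\<Sum>i\<in>I. b i * (weight r (k-i) * a (k-i))))"
        by simp
    qed auto
    also have "\<dots> = 2 powr r * L2_set (\<lambda>k. (\<Sum>j\<in>J. a j * (weight r (k-j) * b (k-j))) + (\<Sum>i\<in>I. b i * (weight r (k-i) * a (k-i)))) K"
      by (rule L2_set_right_distrib[symmetric]) simp
    also have "\<dots> \<le> 2 powr r * (L2_set (\<lambda>k. \<Sum>j\<in>J. a j * (weight r (k-j) * b (k-j))) K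
        + L2_set (\<lambda>k. \<Sum>i\<in>I. b i * (weight r (k-i) * a (k-i))) K)"
      by (intro mult_left_mono L2_set_triangle_ineq) auto
    also have "\<dots> \<le> 2 powr r * (A * N + B * M)"
    proof (intro mult_left_mono add_mono)
      show "L2_set (\<lambda>k. \<Sum>j\<in>J. a j * (weight r (k-j) * b (k-j))) K \<le> A * N"
        by (rule young_convolution[of J K a A "\<lambda>k. weight r k * b k"])
           (use J K f g in \<open>auto simp: a_def b_def wiener_le_def sobolev_le_def\<close>)
      show "L2_set (\<lambda>k. \<Sum>i\<in>I. b i * (weight r (k-i) * a (k-i))) K \<le> B * M"
        by (rule young_convolution[of I K b B "\<lambda>k. weight r k * a k"])
           (use I K f g in \<open>auto simp: a_def b_def wiener_le_def sobolev_le_def\<close>)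
    qed auto
    finally show ?thesis .
  qed
  have "((\<lambda>J. L2_set (\<lambda>k. weight r k * cmod (\<Sum>j\<in>J. fourier f j * fourier g (k - j))) K) \<longlongrightarrow>
      L2_set (\<lambda>k. weight r k * cmod (fourier (\<lambda>x. f x * g x) k)) K) (finite_subsets_at_top UNIV)"
    by (intro L2_set_tendsto tendsto_intros fourier_mult[OF f(1) g(1) f(2)])
  then show "L2_set (\<lambda>k. weight r k * cmod (fourier (\<lambda>x. f x * g x) k)) K \<le> 2 powr r * (A * N + B * M)"
    by (rule tendsto_upperbound) (auto intro: eventually_finite_subsets_at_top_weakI bound)
qed

lemma sobolev_algebra:
  assumes r: "r > 1/2"
  obtains D where "D > 0"
    "\<And>f g. f \<in> sobolev r \<Longrightarrow> g \<in> sobolev r \<Longrightarrow> (\<lambda>x. f x * g x) \<in> sobolev r"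
    "\<And>f g. f \<in> sobolev r \<Longrightarrow> g \<in> sobolev r \<Longrightarrow>
      sobolev_norm r (\<lambda>x. f x * g x) \<le> D * sobolev_norm r f * sobolev_norm r g"
proof -
  obtain C where C: "C > 0" "\<And>f M. sobolev_le r f M \<Longrightarrow> wiener_le f (C * M)"
    by (rule sobolev_wiener[OF r]) blast
  have *: "(\<lambda>x. f x * g x) \<in> sobolev r \<and>
      sobolev_norm r (\<lambda>x. f x * g x) \<le> (2 powr r * (2 * C)) * sobolev_norm r f * sobolev_norm r g"
    if "f \<in> sobolev r" "g \<in> sobolev r" for f g
  proof -
    note f = sobolevD[OF that(1)] and g = sobolevD[OF that(2)]
    have "sobolev_le r (\<lambda>x. f x * g x)
      (2 powr r * ((C * sobolev_norm r f) * sobolev_norm r g + (C * sobolev_norm r g) * sobolev_norm r f))"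
      by (rule sobolev_le_mult) (use r f g C in auto)
    then have "sobolev_le r (\<lambda>x. f x * g x) ((2 powr r * (2 * C)) * sobolev_norm r f * sobolev_norm r g)"
      by (simp add: algebra_simps)
    then show ?thesis using sobolev_le_imp_sobolev f g by blast
  qed
  show thesis by (rule that[of "2 powr r * (2 * C)"]) (use * C(1) in auto)
qed

lemma sobolev_mult: "r > 1/2 \<Longrightarrow> f \<in> sobolev r \<Longrightarrow> g \<in> sobolev r \<Longrightarrow> (\<lambda>x. f x * g x) \<in> sobolev r"
  by (rule sobolev_algebra[of r]) blast+

lemma sobolev_power: "r > 1/2 \<Longrightarrow> f \<in> sobolev r \<Longrightarrow> (\<lambda>x. f x ^ n) \<in> sobolev r"
proof (induction n)
  case 0
  then show ?case using sobolev_one by simp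
next
  case (Suc n)
  then show ?case using sobolev_mult[of r f "\<lambda>x. f x ^ n"] by simp
qed

text \<open>A power series in \<open>f\<close> stays in the Sobolev space as soon as its partial sums are bounded there,
  by weak closedness of balls.\<close>

lemma sobolev_power_series:
  assumes r: "r > 1/2" and f: "f \<in> sobolev r"
    and bd: "\<And>N. (\<Sum>n<N. cmod (c n) * sobolev_norm r (\<lambda>x. f x ^ n)) \<le> B"
    and S: "uniform_limit UNIV (\<lambda>N x. \<Sum>n<N. c n * f x ^ n) S sequentially"
  shows "S \<in> sobolev r"
proof -
  have circ: "circ (\<lambda>x. \<Sum>n<N. c n * f x ^ n)" for N using sobolevD(1)[OF f] by auto
  have le: "sobolev_le r (\<lambda>x. \<Sum>n<N. c n * f x ^ n) B" for N
  proof -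
    have "sobolev_le r (\<lambda>x. \<Sum>n<N. c n * f x ^ n) (\<Sum>n<N. cmod (c n) * sobolev_norm r (\<lambda>x. f x ^ n))"
      using sobolevD[OF sobolev_power[OF r f]] sobolevD(1)[OF f] by (intro sobolev_le_sum sobolev_le_scale) auto
    then show ?thesis using sobolev_le_mono bd by blast
  qed
  have "sobolev_le r S B" by (rule sobolev_le_limit[OF S circ _ le]) simp
  moreover have "circ S" by (rule circ_uniform_limit[OF S circ]) simp
  ultimately show ?thesis using sobolev_le_imp_sobolev by blast
qed

lemma sobolev_exp:
  assumes r: "r > 1/2" and f: "f \<in> sobolev r"
  shows "(\<lambda>x. exp (f x)) \<in> sobolev r"
proof -
  obtain D where D: "D > 0" and nm: "\<And>f g. f \<in> sobolev r \<Longrightarrow> g \<in> sobolev r \<Longrightarrow>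
      sobolev_norm r (\<lambda>x. f x * g x) \<le> D * sobolev_norm r f * sobolev_norm r g"
    by (rule sobolev_algebra[OF r]) blast
  \<comment> \<open>The norm is submultiplicative only up to \<open>D\<close>, so \<open>D\<close>
    times the norm takes the place of the norm in the exponential series.\<close>
  have pw: "sobolev_norm r (\<lambda>x. f x ^ n) \<le> sobolev_norm r (\<lambda>_. 1) * (D * sobolev_norm r f) ^ n" for n
  proof (induction n)
    case (Suc n)
    have "sobolev_norm r (\<lambda>x. f x * f x ^ n) \<le> D * sobolev_norm r f * sobolev_norm r (\<lambda>x. f x ^ n)"
      by (intro nm f sobolev_power r)
    also have "\<dots> \<le> D * sobolev_norm r f * (sobolev_norm r (\<lambda>_. 1) * (D * sobolev_norm r f) ^ n)"
      using D by (intro mult_left_mono Suc) auto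
    finally show ?case by (simp add: mult_ac)
  qed simp
  obtain R where R: "\<And>x. cmod (f x) \<le> R" using circ_bounded[OF sobolevD(1)[OF f]] by blast
  show ?thesis
  proof (rule sobolev_power_series[OF r f, where c = "\<lambda>n. 1 / fact n"])
    fix N
    have "(\<Sum>n<N. cmod (1 / fact n) * sobolev_norm r (\<lambda>x. f x ^ n))
        \<le> (\<Sum>n<N. sobolev_norm r (\<lambda>_. 1) * ((D * sobolev_norm r f) ^ n /\<^sub>R fact n))"
      using pw by (intro sum_mono) (auto simp: divide_simps norm_divide)
    also have "\<dots> = sobolev_norm r (\<lambda>_. 1) * (\<Sum>n<N. (D * sobolev_norm r f) ^ n /\<^sub>R fact n)"
      by (simp add: sum_distrib_left)
    also have "\<dots> \<le> sobolev_norm r (\<lambda>_. 1) * exp (D * sobolev_norm r f)"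
      unfolding exp_def using D
      by (intro mult_left_mono sum_le_suminf summable_exp_generic) auto
    finally show "(\<Sum>n<N. cmod (1 / fact n) * sobolev_norm r (\<lambda>x. f x ^ n))
        \<le> sobolev_norm r (\<lambda>_. 1) * exp (D * sobolev_norm r f)" .
  next
    have "uniform_limit UNIV (\<lambda>N x. \<Sum>n<N. f x ^ n /\<^sub>R fact n) (\<lambda>x. \<Sum>n. f x ^ n /\<^sub>R fact n) sequentially"
    proof (rule Weierstrass_m_test)
      fix n x
      show "norm (f x ^ n /\<^sub>R fact n) \<le> R ^ n /\<^sub>R fact n"
        using power_mono[OF R[of x], of n] by (auto simp: norm_power divide_simps)
    qed (rule summable_exp_generic)
    then show "uniform_limit UNIV (\<lambda>N x. \<Sum>n<N. 1 / fact n * f x ^ n) (\<lambda>x. exp (f x)) sequentially"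
      by (simp add: exp_def scaleR_conv_of_real divide_inverse mult.commute)
  qed
qed

text \<open>The spectral radius in the Sobolev algebra is the sup norm: squaring gains the factor
  \<open>\<parallel>f\<^sup>n\<parallel>\<close> in the Wiener algebra, which tends to \<open>0\<close> since \<open>f\<close> is \<open>C\<^sup>1\<close>.\<close>

lemma sobolev_powers_summable:
  assumes r: "r > 3/2" and f: "f \<in> sobolev r" and q: "0 < q" "q < 1" "\<And>x. cmod (f x) \<le> q"
  obtains B where "\<And>N. (\<Sum>n<N. sobolev_norm r (\<lambda>x. f x ^ n)) \<le> B"
proof -
  define a where "a n = sobolev_norm r (\<lambda>x. f x ^ n)" for n
  have r': "r > 1/2" using r by simp
  have a0: "a n \<ge> 0" for n by (simp add: a_def)
  obtain D where D: "D > 0" and nm: "\<And>f g. f \<in> sobolev r \<Longrightarrow> g \<in> sobolev r \<Longrightarrow>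
      sobolev_norm r (\<lambda>x. f x * g x) \<le> D * sobolev_norm r f * sobolev_norm r g"
    by (rule sobolev_algebra[OF r']) blast
  note sp = sobolev_power[OF r' f]
  obtain f' where f': "\<And>x. (f has_vector_derivative f' x) (at x)" "circ f'"
    by (rule sobolev_C1[OF r sobolevD[OF f]]) blast
  obtain L where L: "L > 0" "\<And>x. cmod (f' x) \<le> L" using circ_bounded[OF f'(2)] by blast
  obtain C where C: "C > 0" "\<And>f f' X Y. (\<And>x. (f has_vector_derivative f' x) (at x)) \<Longrightarrow> circ f \<Longrightarrow> circ f' \<Longrightarrow>
     (\<And>x. cmod (f x) \<le> X) \<Longrightarrow> (\<And>x. cmod (f' x) \<le> Y) \<Longrightarrow> wiener_le f (C * (X + Y))"
    by (rule C1_wiener) blast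
  \<comment> \<open>The derivative of \<open>f ^ n\<close> costs only one factor \<open>n\<close>
    beside \<open>q ^ (n - 1)\<close>, so the Wiener bound still tends to 0, independently of the
    Sobolev norm of \<open>f\<close>.\<close>
  have w: "wiener_le (\<lambda>x. f x ^ n) (C * (q ^ n + real n * q ^ (n - 1) * L))" for n
  proof (rule C(2)[where f' = "\<lambda>x. of_nat n * f x ^ (n - 1) * f' x"])
    fix x
    show "((\<lambda>x. f x ^ n) has_vector_derivative of_nat n * f x ^ (n - 1) * f' x) (at x)"
      using has_derivative_power[OF f'(1)[unfolded has_vector_derivative_def], of n]
      unfolding has_vector_derivative_def by (simp add: scaleR_conv_of_real mult_ac)
    show "cmod (f x ^ n) \<le> q ^ n" using q by (auto simp: norm_power intro: power_mono)
    show "cmod (of_nat n * f x ^ (n - 1) * f' x) \<le> real n * q ^ (n - 1) * L"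
      unfolding norm_mult norm_power using q L by (auto intro!: mult_mono power_mono)
  qed (use f' sobolevD(1)[OF f] in auto)
  define A where "A n = C * (q ^ n + real n * q ^ (n - 1) * L)" for n
  have "(\<lambda>n. real n * q ^ n) \<longlonglongrightarrow> 0" using q by (intro lim_n_over_pown powser_times_n_limit_0) auto
  then have "(\<lambda>n. C * (q ^ n + (real n * q ^ n) / q * L)) \<longlonglongrightarrow> C * (0 + 0 / q * L)"
    using q by (intro tendsto_intros LIMSEQ_realpow_zero) auto
  moreover have "real n * q ^ (n - 1) = (real n * q ^ n) / q" for n using q by (cases n) auto
  ultimately have A: "A \<longlonglongrightarrow> 0" by (simp add: A_def[abs_def])
  \<comment> \<open>Both factors are \<open>f ^ n\<close>, so both halves of the tame estimate carry
    the decaying factor \<open>A n\<close>.\<close>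
  have dbl: "a (2 * n) \<le> 2 powr r * 2 * A n * a n" for n
  proof -
    have "sobolev_le r (\<lambda>x. f x ^ n * f x ^ n) (2 powr r * (A n * a n + A n * a n))"
      unfolding a_def A_def by (rule sobolev_le_mult) (use r w sobolevD[OF sp] in auto)
    then have "sobolev_norm r (\<lambda>x. f x ^ n * f x ^ n) \<le> 2 powr r * (A n * a n + A n * a n)"
      using sobolevD(1)[OF f] by (intro sobolev_le_imp_sobolev) auto
    moreover have "f x ^ n * f x ^ n = f x ^ (2 * n)" for x
      by (simp only: mult_2 power_add)
    ultimately show ?thesis by (simp add: a_def)
  qed
  have "(\<lambda>n. 2 powr r * 2 * A n) \<longlonglongrightarrow> 2 powr r * 2 * 0" by (intro tendsto_intros A)
  then have "\<forall>\<^sub>F n in sequentially. 2 powr r * 2 * A n < 1/2" by (rule order_tendstoD) simp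
  then obtain n0 where n0: "\<And>n. n \<ge> n0 \<Longrightarrow> 2 powr r * 2 * A n < 1/2"
    by (auto simp: eventually_sequentially)
  define n1 where "n1 = max 1 n0"
  have half: "a (2 ^ k * n1) \<le> a n1 * (1/2) ^ k" for k
  proof (induction k)
    case (Suc k)
    have "1 * n1 \<le> 2 ^ k * n1" by (intro mult_right_mono) auto
    then have "n0 \<le> 2 ^ k * n1" by (simp add: n1_def)
    have "a (2 ^ Suc k * n1) \<le> 2 powr r * 2 * A (2 ^ k * n1) * a (2 ^ k * n1)"
      using dbl[of "2 ^ k * n1"] by (simp add: mult_ac)
    also have "\<dots> \<le> 1/2 * (a n1 * (1/2) ^ k)"
      using n0[OF \<open>n0 \<le> _\<close>] a0 Suc.IH by (intro mult_mono) auto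
    finally show ?case by simp
  qed simp
  have "(\<lambda>k. a n1 * (1/2) ^ k) \<longlonglongrightarrow> a n1 * 0" by (intro tendsto_intros LIMSEQ_realpow_zero) auto
  then have "\<forall>\<^sub>F k in sequentially. a n1 * (1/2) ^ k < 1 / (2 * D)"
    by (rule order_tendstoD) (use D in simp)
  then obtain k where k: "a n1 * (1/2) ^ k < 1 / (2 * D)"
    by (auto simp: eventually_sequentially)
  \<comment> \<open>Repeated doubling makes the norm of some power smaller than
    \<open>1 / (2 * D)\<close>. Multiplication by that power then at least halves norms, so the
    whole series is bounded by twice its first \<open>N\<close> terms.\<close>
  define N where "N = 2 ^ k * n1"
  have N: "a N \<le> 1 / (2 * D)" using half[of k] k by (simp add: N_def)
  have step: "a (N + j) \<le> 1/2 * a j" for j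
  proof -
    have "a (N + j) \<le> D * a N * a j"
      unfolding a_def power_add by (intro nm sp)
    also have "\<dots> \<le> D * (1 / (2 * D)) * a j"
      using N D a0 by (intro mult_right_mono mult_left_mono) auto
    finally show ?thesis using D by simp
  qed
  have "(\<Sum>n<M. a n) \<le> 2 * (\<Sum>n<N. a n)" for M
  proof -
    have "(\<Sum>n<M. a n) \<le> (\<Sum>n<N + M. a n)" by (rule sum_mono2) (auto simp: a0)
    also have "\<dots> = (\<Sum>n<N. a n) + (\<Sum>n<M. a (N + n))"
      by (induction M) (simp_all add: algebra_simps)
    also have "\<dots> \<le> (\<Sum>n<N. a n) + (\<Sum>n<M. 1/2 * a n)" by (intro add_left_mono sum_mono step)
    finally show ?thesis by (simp flip: sum_distrib_left sum_divide_distrib)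
  qed
  then show thesis using that unfolding a_def by blast
qed

text \<open>Consecutive coefficients have ratio \<open>(a - n) / (n + 1)\<close>, of modulus at most
  1. The exponents needed later are 1/2 and -1/2.\<close>

lemma abs_gbinomial_le_1:
  fixes a :: real assumes "\<bar>a\<bar> \<le> 1" shows "\<bar>a gchoose n\<bar> \<le> 1"
proof (induction n)
  case (Suc n)
  have "a gchoose (Suc n) = (a gchoose n) * ((a - n) / (n + 1))"
    using gbinomial_absorb_comp[of a n] gbinomial_absorption[of n a]
    by (simp add: field_simps)
  then have "\<bar>a gchoose (Suc n)\<bar> = \<bar>a gchoose n\<bar> * (\<bar>a - n\<bar> / (n + 1))"
    by (simp add: abs_mult)
  also have "\<dots> \<le> 1 * 1" using assms by (intro mult_mono Suc) (auto simp: divide_simps)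
  finally show ?case by simp
qed simp

text \<open>Rescale \<open>p\<close> into an interval around 1 where the binomial series converges.
  Its coefficients are bounded by 1, so summability of the Sobolev norms of the powers of
  \<open>h\<close> suffices.\<close>

lemma sobolev_powr:
  assumes r: "r > 3/2" and p: "(\<lambda>x. complex_of_real (p x)) \<in> sobolev r" and pos: "\<And>x. p x > 0"
    and a: "\<bar>a\<bar> \<le> 1"
  shows "(\<lambda>x. complex_of_real (p x powr a)) \<in> sobolev r"
proof -
  note cp = sobolevD(1)[OF p]
  have r': "r > 1/2" using r by simp
  have contp: "continuous_on {0..1} p"
    using continuous_on_Re[OF circ_cont[OF cp, of "{0..1}"]] by simp
  have ne: "{0..1::real} \<noteq> {}" by simp
  obtain x0 where x0: "\<And>x. x \<in> {0..1} \<Longrightarrow> p x0 \<le> p x"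
    using continuous_attains_inf[OF compact_Icc ne contp] by blast
  obtain x1 where x1: "\<And>x. x \<in> {0..1} \<Longrightarrow> p x \<le> p x1"
    using continuous_attains_sup[OF compact_Icc ne contp] by blast
  have bd: "p x0 \<le> p x" "p x \<le> p x1" for x
    using circ_ball[OF cp, of "\<lambda>y. p x0 \<le> Re y" x] circ_ball[OF cp, of "\<lambda>y. Re y \<le> p x1" x] x0 x1
    by auto
  \<comment> \<open>Dividing by twice the maximum of \<open>p\<close> puts \<open>h\<close> between
    \<open>-q\<close> and \<open>-1/2\<close>. The factor 2 keeps \<open>q\<close> positive even
    when \<open>p\<close> is constant.\<close>
  define h where "h x = p x / (2 * p x1) - 1" for x
  define q where "q = 1 - p x0 / (2 * p x1)"
  have P: "p x1 > 0" "p x0 > 0" using pos by auto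
  have q: "0 < q" "q < 1" using P bd(2)[of x0] by (auto simp: q_def)
  have hq: "\<bar>h x\<bar> \<le> q" for x
    using bd[of x] P unfolding h_def q_def by (auto simp: abs_if divide_simps)
  have h: "(\<lambda>x. complex_of_real (h x)) \<in> sobolev r"
    using sobolev_diff[OF sobolev_scale(1)[OF p, of "1 / (2 * p x1)"] sobolev_one]
    by (simp add: h_def)
  obtain B where B: "\<And>N. (\<Sum>n<N. sobolev_norm r (\<lambda>x. complex_of_real (h x) ^ n)) \<le> B"
    using sobolev_powers_summable[OF r h q] hq by auto
  have "(\<lambda>x. complex_of_real ((1 + h x) powr a)) \<in> sobolev r"
  proof (rule sobolev_power_series[OF r' h, where c = "\<lambda>n. of_real (a gchoose n)"])
    fix N
    have "(\<Sum>n<N. cmod (of_real (a gchoose n)) * sobolev_norm r (\<lambda>x. complex_of_real (h x) ^ n))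
      \<le> (\<Sum>n<N. 1 * sobolev_norm r (\<lambda>x. complex_of_real (h x) ^ n))"
      using abs_gbinomial_le_1[OF a] by (intro sum_mono mult_right_mono) auto
    then show "(\<Sum>n<N. cmod (of_real (a gchoose n)) * sobolev_norm r (\<lambda>x. complex_of_real (h x) ^ n)) \<le> B"
      using B[of N] by simp
  next
    have "uniform_limit UNIV (\<lambda>N x. \<Sum>n<N. complex_of_real (a gchoose n) * complex_of_real (h x) ^ n)
        (\<lambda>x. \<Sum>n. complex_of_real (a gchoose n) * complex_of_real (h x) ^ n) sequentially"
    proof (rule Weierstrass_m_test)
      fix n x
      show "norm (complex_of_real (a gchoose n) * complex_of_real (h x) ^ n) \<le> q ^ n"
        using mult_mono[OF abs_gbinomial_le_1[OF a, of n] power_mono[OF hq[of x], of n]] q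
        by (simp add: norm_mult norm_power)
    qed (use q in \<open>auto intro: summable_geometric\<close>)
    moreover have "(\<Sum>n. complex_of_real (a gchoose n) * complex_of_real (h x) ^ n) =
        of_real ((1 + h x) powr a)" for x
    proof -
      have "(\<lambda>n. (a gchoose n) * h x ^ n) sums (1 + h x) powr a"
        by (rule gen_binomial_real) (use hq[of x] q in simp)
      then have "(\<lambda>n. complex_of_real ((a gchoose n) * h x ^ n)) sums of_real ((1 + h x) powr a)"
        by (simp only: sums_of_real_iff)
      then show ?thesis by (simp add: sums_iff)
    qed
    ultimately show "uniform_limit UNIV (\<lambda>N x. \<Sum>n<N. complex_of_real (a gchoose n) * complex_of_real (h x) ^ n)
        (\<lambda>x. complex_of_real ((1 + h x) powr a)) sequentially" by simp
  qed
  then have "(\<lambda>x. of_real ((2 * p x1) powr a) * complex_of_real ((1 + h x) powr a)) \<in> sobolev r"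
    by (rule sobolev_scale)
  moreover have "(2 * p x1) powr a * (1 + h x) powr a = p x powr a" for x
    using P pos[of x] by (simp add: h_def flip: powr_mult)
  ultimately show ?thesis by (simp flip: of_real_mult)
qed

subsection \<open>The sphere\<close>

lemma sobolev_norm_minus: "sobolev_norm r (\<lambda>x. - f x) = sobolev_norm r f"
  using fourier_scale[of "-1" f] by (simp add: sobolev_norm_def)

lemma sobolev_norm_0_imp:
  assumes "f \<in> sobolev r" "sobolev_norm r f = 0" shows "f x = 0"
proof (rule fourier_zero_imp_zero[OF sobolevD(1)[OF assms(1)]])
  fix k
  have "L2_set (\<lambda>k. weight r k * cmod (fourier f k)) {k} \<le> 0"
    using sobolev_leD[OF sobolevD(2)[OF assms(1)], of "{k}"] assms(2) by simp
  then have "weight r k * cmod (fourier f k) \<le> 0" by simp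
  then show "fourier f k = 0"
    using weight_pos[of r k] by (metis mult_le_0_iff norm_le_zero_iff not_less)
qed

lemma Metric_space_sobolev: "Metric_space (sobolev r) (\<lambda>f g. sobolev_norm r (\<lambda>x. f x - g x))"
proof
  fix f g
  show "sobolev_norm r (\<lambda>x. f x - g x) = sobolev_norm r (\<lambda>x. g x - f x)"
    using sobolev_norm_minus[of r "\<lambda>x. f x - g x"] by simp
  show "(sobolev_norm r (\<lambda>x. f x - g x) = 0) = (f = g)" if fg: "f \<in> sobolev r" "g \<in> sobolev r"
  proof
    assume "sobolev_norm r (\<lambda>x. f x - g x) = 0"
    from sobolev_norm_0_imp[OF sobolev_diff[OF fg] this] show "f = g" by auto
  qed (simp add: sobolev_norm_def fourier_eq)
  fix h assume fgh: "f \<in> sobolev r" "g \<in> sobolev r" "h \<in> sobolev r"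
  show "sobolev_norm r (\<lambda>x. f x - h x) \<le> sobolev_norm r (\<lambda>x. f x - g x) + sobolev_norm r (\<lambda>x. g x - h x)"
    using sobolev_add(2)[OF sobolev_diff[OF fgh(1,2)] sobolev_diff[OF fgh(2,3)]] by simp
qed simp

lemma limitin_sphere:
  "limitin (sphere_topology r) c l F \<longleftrightarrow> l \<in> sphere_set r \<and> (\<forall>\<^sub>F t in F. c t \<in> sphere_set r) \<and>
     ((\<lambda>t. sobolev_norm r (\<lambda>x. c t x - l x)) \<longlongrightarrow> 0) F"
proof -
  interpret Metric_space "sobolev r" "\<lambda>f g. sobolev_norm r (\<lambda>x. f x - g x)"
    by (rule Metric_space_sobolev)
  have sub: "sphere_set r \<subseteq> sobolev r" by (auto simp: sphere_set_def)
  show ?thesis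
    unfolding sphere_topology_def limitin_subtopology limitin_metric tendsto_iff
    using sub by (auto simp: dist_real_def eventually_conj_iff elim: eventually_mono)
qed

lemma limitin_sphere_uniform_limit:
  assumes r: "r > 1/2" and lim: "limitin (sphere_topology r) c l F"
  shows "uniform_limit UNIV c l F"
proof (rule uniform_limitI)
  fix e :: real assume e: "e > 0"
  obtain C where C: "C > 0" "\<And>f x. f \<in> sobolev r \<Longrightarrow> cmod (f x) \<le> C * sobolev_norm r f"
    using sobolev_sup[OF r] by blast
  have l: "l \<in> sobolev r" and c: "\<forall>\<^sub>F t in F. c t \<in> sobolev r"
    and t: "((\<lambda>t. sobolev_norm r (\<lambda>x. c t x - l x)) \<longlongrightarrow> 0) F"
    using lim by (auto simp: limitin_sphere sphere_set_def elim: eventually_mono)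
  have "\<forall>\<^sub>F t in F. sobolev_norm r (\<lambda>x. c t x - l x) < e / C"
    by (rule order_tendstoD[OF t]) (use C e in auto)
  with c show "\<forall>\<^sub>F t in F. \<forall>x\<in>UNIV. dist (c t x) (l x) < e"
  proof eventually_elim
    case (elim t)
    show ?case
    proof
      fix x
      have "dist (c t x) (l x) \<le> C * sobolev_norm r (\<lambda>x. c t x - l x)"
        using C(2)[OF sobolev_diff[OF elim(1) l]] by (simp add: dist_norm)
      also have "\<dots> < C * (e / C)" using elim(2) C(1) by (rule mult_strict_left_mono)
      finally show "dist (c t x) (l x) < e" using C(1) by simp
    qed
  qed
qed

lemma circ_nonvanishing_bound:
  assumes "circ f" "\<And>x. f x \<noteq> 0"
  obtains e where "e > 0" "\<And>x. cmod (f x) \<ge> e"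
proof -
  have c: "continuous_on {0..1} (\<lambda>x. cmod (f x))"
    by (intro continuous_intros circ_cont assms)
  have "{0..1::real} \<noteq> {}" by simp
  then obtain x0 where "\<And>x. x \<in> {0..1} \<Longrightarrow> cmod (f x0) \<le> cmod (f x)"
    using continuous_attains_inf[OF compact_Icc _ c] by blast
  then have "cmod (f x0) \<le> cmod (f x)" for x
    using circ_ball[OF assms(1), of "\<lambda>y. cmod (f x0) \<le> cmod y" x] by blast
  then show thesis using that[of "cmod (f x0)"] assms(2) by auto
qed

text \<open>By compactness \<open>|f|\<close> has a positive minimum \<open>e\<close>; the sup
  embedding with constant \<open>C\<close> then excludes zeros in the ball of radius
  \<open>e / C\<close>.\<close>

lemma openin_nonvanishing:
  assumes r: "r > 1/2"
  shows "openin (sphere_topology r) (nonvanishing r)"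
proof -
  interpret Metric_space "sobolev r" "\<lambda>f g. sobolev_norm r (\<lambda>x. f x - g x)"
    by (rule Metric_space_sobolev)
  obtain C where C: "C > 0" "\<And>f x. f \<in> sobolev r \<Longrightarrow> cmod (f x) \<le> C * sobolev_norm r f"
    using sobolev_sup[OF r] by blast
  define U where "U = {f \<in> sobolev r. \<forall>x. f x \<noteq> 0}"
  have "openin mtopology U"
    unfolding openin_mtopology
  proof (intro conjI allI impI)
    show "U \<subseteq> sobolev r" by (auto simp: U_def)
    fix f assume f: "f \<in> U"
    then obtain e where e: "e > 0" "\<And>x. cmod (f x) \<ge> e"
      using circ_nonvanishing_bound[of f] sobolevD(1)[of f r] by (auto simp: U_def)
    have "mball f (e / C) \<subseteq> U"
    proof
      fix g assume "g \<in> mball f (e / C)"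
      then have g: "g \<in> sobolev r" "sobolev_norm r (\<lambda>x. f x - g x) < e / C" by auto
      have "g x \<noteq> 0" for x
      proof
        assume "g x = 0"
        then have "e \<le> cmod (f x - g x)" using e(2)[of x] by simp
        also have "\<dots> \<le> C * sobolev_norm r (\<lambda>x. f x - g x)"
          using C(2)[OF sobolev_diff[of f r g]] f g by (auto simp: U_def)
        also have "\<dots> < C * (e / C)" using g(2) C(1) by (rule mult_strict_left_mono)
        finally show False using C(1) by simp
      qed
      then show "g \<in> U" using g by (auto simp: U_def)
    qed
    then show "\<exists>d>0. mball f d \<subseteq> U" using e C by (intro exI[of _ "e / C"]) auto
  qed
  moreover have "nonvanishing r = U \<inter> sphere_set r"
    by (auto simp: U_def nonvanishing_def sphere_set_def)
  ultimately show ?thesis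
    unfolding sphere_topology_def openin_subtopology by blast
qed

text \<open>A limit of nonvanishing functions lies in the closure, and for an open set the frontier
  is the closure minus the set. On the sphere, leaving the set means having a zero.\<close>

lemma frontier_nonvanishing_limit_iff:
  assumes r: "r > 1/2" and lim: "limitin (sphere_topology r) c l F" and F: "F \<noteq> bot"
    and c: "\<forall>\<^sub>F t in F. c t \<in> nonvanishing r"
  shows "l \<in> sphere_topology r frontier_of nonvanishing r \<longleftrightarrow> (\<exists>x. l x = 0)"
proof -
  have "l \<in> sphere_topology r closure_of nonvanishing r"
    unfolding in_closure_of
  proof (intro conjI allI impI)
    show "l \<in> topspace (sphere_topology r)" using lim by (rule limitin_topspace)
    fix U assume "l \<in> U \<and> openin (sphere_topology r) U"
    then have "\<forall>\<^sub>F t in F. c t \<in> U" using lim by (auto simp: limitin_def)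
    with c have "\<forall>\<^sub>F t in F. c t \<in> nonvanishing r \<and> c t \<in> U" by (rule eventually_conj)
    then show "\<exists>y. y \<in> nonvanishing r \<and> y \<in> U"
      using F eventually_happens' by blast
  qed
  moreover have "l \<in> sphere_set r" using lim by (simp add: limitin_sphere)
  ultimately show ?thesis
    unfolding frontier_of_def interior_of_openin[OF openin_nonvanishing[OF r]]
    by (auto simp: nonvanishing_def)
qed

subsection \<open>Real-valued functions and curves\<close>

lemma sobolev_real_cont: "f \<in> sobolev_real r \<Longrightarrow> continuous_on S f"
  using continuous_on_Re[OF circ_cont[OF sobolevD(1)], of "\<lambda>x. of_real (f x)" r S]
  by (simp add: sobolev_real_def)

lemma sobolev_real_per: "f \<in> sobolev_real r \<Longrightarrow> f (x + 1) = f x"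
  using circ_per[OF sobolevD(1), of "\<lambda>x. of_real (f x)" r x] by (simp add: sobolev_real_def)

lemma sobolev_real_sup:
  assumes "r > 1/2"
  obtains C where "C > 0" "\<And>f x. f \<in> sobolev_real r \<Longrightarrow> \<bar>f x\<bar> \<le> C * sobolev_real_norm r f"
proof -
  obtain C where C: "C > 0" "\<And>f x. f \<in> sobolev r \<Longrightarrow> cmod (f x) \<le> C * sobolev_norm r f"
    using sobolev_sup[OF assms] by blast
  have "\<bar>f x\<bar> \<le> C * sobolev_real_norm r f" if "f \<in> sobolev_real r" for f x
    using C(2)[of "\<lambda>x. of_real (f x)" x] that by (simp add: sobolev_real_def sobolev_real_norm_def)
  with C(1) show thesis using that by blast
qed

lemma sobolev_real_norm_nonneg [simp]: "sobolev_real_norm r f \<ge> 0"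
  by (simp add: sobolev_real_norm_def)

lemma sobolev_real_C1:
  assumes r: "r > 3/2" and f: "f \<in> sobolev_real r"
  shows "(f has_real_derivative deriv f x) (at x)" "deriv f \<in> sobolev_real (r - 1)"
    "sobolev_real_norm (r - 1) (deriv f) \<le> 2 * pi * sobolev_real_norm r f"
proof -
  have fc: "(\<lambda>x. complex_of_real (f x)) \<in> sobolev r" using f by (simp add: sobolev_real_def)
  obtain f' where f': "\<And>x. ((\<lambda>x. complex_of_real (f x)) has_vector_derivative f' x) (at x)" "circ f'"
    "sobolev_le (r - 1) f' (2 * pi * sobolev_norm r (\<lambda>x. complex_of_real (f x)))"
    by (rule sobolev_C1[OF r sobolevD[OF fc]]) blast
  have d: "(f has_real_derivative Re (f' x)) (at x)" for x
    using bounded_linear.has_vector_derivative[OF bounded_linear_Re f'(1)[of x]]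
    by (simp add: has_real_derivative_iff_has_vector_derivative)
  have "((\<lambda>x. 0::real) has_vector_derivative Im (f' x)) (at x)" for x
    using bounded_linear.has_vector_derivative[OF bounded_linear_Im f'(1)[of x]] by simp
  then have "Im (f' x) = 0" for x
    using vector_derivative_unique_at has_vector_derivative_const by blast
  then have eq: "f' = (\<lambda>x. complex_of_real (deriv f x))"
    using DERIV_imp_deriv[OF d] by (auto simp: complex_eq_iff)
  show "(f has_real_derivative deriv f x) (at x)" using d DERIV_imp_deriv[OF d] by simp
  show "deriv f \<in> sobolev_real (r - 1)"
    "sobolev_real_norm (r - 1) (deriv f) \<le> 2 * pi * sobolev_real_norm r f"
    using sobolev_le_imp_sobolev[OF f'(2,3)] by (auto simp: sobolev_real_def sobolev_real_norm_def eq)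
qed

lemma sobolev_real_add: "f \<in> sobolev_real r \<Longrightarrow> g \<in> sobolev_real r \<Longrightarrow> (\<lambda>x. f x + g x) \<in> sobolev_real r"
  using sobolev_add(1)[of "\<lambda>x. of_real (f x)" r "\<lambda>x. of_real (g x)"] by (simp add: sobolev_real_def)

lemma sobolev_real_diff: "f \<in> sobolev_real r \<Longrightarrow> g \<in> sobolev_real r \<Longrightarrow> (\<lambda>x. f x - g x) \<in> sobolev_real r"
  using sobolev_diff[of "\<lambda>x. of_real (f x)" r "\<lambda>x. of_real (g x)"] by (simp add: sobolev_real_def)

lemma sobolev_real_scale: "f \<in> sobolev_real r \<Longrightarrow> (\<lambda>x. c * f x) \<in> sobolev_real r"
  using sobolev_scale(1)[of "\<lambda>x. of_real (f x)" r "of_real c"] by (simp add: sobolev_real_def)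

lemma sobolev_real_const: "(\<lambda>x. c) \<in> sobolev_real r"
  using sobolev_const by (simp add: sobolev_real_def)

text \<open>Only differences have to be Sobolev functions: \<open>\<phi> t\<close> is the lift of a
  diffeomorphism and \<open>\<tau> t\<close> may have nonzero degree, so neither need be
  periodic.\<close>

definition scurve_cont :: "real \<Rightarrow> real set \<Rightarrow> (real \<Rightarrow> real \<Rightarrow> real) \<Rightarrow> bool" where
  "scurve_cont r I h \<longleftrightarrow> (\<forall>t\<in>I. \<forall>q\<in>I. (\<lambda>x. h q x - h t x) \<in> sobolev_real r) \<and>
     (\<forall>t\<in>I. ((\<lambda>q. sobolev_real_norm r (\<lambda>x. h q x - h t x)) \<longlongrightarrow> 0) (at t within I))"

definition scurve_deriv :: "real \<Rightarrow> real set \<Rightarrow> (real \<Rightarrow> real \<Rightarrow> real) \<Rightarrow> (real \<Rightarrow> real \<Rightarrow> real) \<Rightarrow> bool" where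
  "scurve_deriv r I h h' \<longleftrightarrow> (\<forall>t\<in>I. \<forall>q\<in>I. (\<lambda>x. h q x - h t x) \<in> sobolev_real r) \<and>
     (\<forall>t\<in>I. h' t \<in> sobolev_real r \<and>
        ((\<lambda>q. sobolev_real_norm r (\<lambda>x. 1 / (q - t) * (h q x - h t x) - h' t x)) \<longlongrightarrow> 0) (at t within I))"

section \<open>From curves of pairs to their components\<close>

lemma tangent_norm_ge:
  "sobolev_real_norm m (fst U) \<le> tangent_norm m U"
  "sobolev_real_norm (m - 1) (snd U) \<le> tangent_norm m U"
  by (auto simp: tangent_norm_def)

lemma continuous_curve_components:
  assumes "continuous_curve m I (\<lambda>t. (h t, k t))"
  shows "scurve_cont m I h" "scurve_cont (m - 1) I k"
proof -
  have 1: "(\<lambda>x. h q x - h t x) \<in> sobolev_real m \<and> (\<lambda>x. k q x - k t x) \<in> sobolev_real (m - 1)"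
    if "t \<in> I" "q \<in> I" for t q
    using assms that by (auto simp: continuous_curve_def tangent_def fun_diff_def)
  have 2: "((\<lambda>q. tangent_norm m (\<lambda>x. h q x - h t x, \<lambda>x. k q x - k t x)) \<longlongrightarrow> 0) (at t within I)"
    if "t \<in> I" for t
    using assms that by (auto simp: continuous_curve_def fun_diff_def)
  have "((\<lambda>q. sobolev_real_norm m (\<lambda>x. h q x - h t x)) \<longlongrightarrow> 0) (at t within I)" if "t \<in> I" for t
    by (rule tendsto_sandwich[OF _ _ tendsto_const 2[OF that]])
       (use tangent_norm_ge(1)[of m "(\<lambda>x. h _ x - h t x, \<lambda>x. k _ x - k t x)"] in auto)
  moreover have "((\<lambda>q. sobolev_real_norm (m - 1) (\<lambda>x. k q x - k t x)) \<longlongrightarrow> 0) (at t within I)" if "t \<in> I" for t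
    by (rule tendsto_sandwich[OF _ _ tendsto_const 2[OF that]])
       (use tangent_norm_ge(2)[of m "(\<lambda>x. h _ x - h t x, \<lambda>x. k _ x - k t x)"] in auto)
  ultimately show "scurve_cont m I h" "scurve_cont (m - 1) I k"
    using 1 by (auto simp: scurve_cont_def)
qed

lemma curve_derivative_components:
  assumes "has_curve_derivative m I (\<lambda>t. (h t, k t)) (\<lambda>t. (h' t, k' t))"
  shows "scurve_deriv m I h h'" "scurve_deriv (m - 1) I k k'"
proof -
  have 1: "(\<lambda>x. h q x - h t x) \<in> sobolev_real m \<and> (\<lambda>x. k q x - k t x) \<in> sobolev_real (m - 1)"
    if "t \<in> I" "q \<in> I" for t q
    using assms that by (auto simp: has_curve_derivative_def tangent_def fun_diff_def)
  have 2: "((\<lambda>q. tangent_norm m (\<lambda>x. 1 / (q - t) * (h q x - h t x) - h' t x,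
        \<lambda>x. 1 / (q - t) * (k q x - k t x) - k' t x)) \<longlongrightarrow> 0) (at t within I)"
    and 3: "h' t \<in> sobolev_real m" "k' t \<in> sobolev_real (m - 1)"
    if "t \<in> I" for t
    using assms that by (auto simp: has_curve_derivative_def fun_diff_def scl_def tangent_def)
  have "((\<lambda>q. sobolev_real_norm m (\<lambda>x. 1 / (q - t) * (h q x - h t x) - h' t x)) \<longlongrightarrow> 0) (at t within I)" if "t \<in> I" for t
    by (rule tendsto_sandwich[OF _ _ tendsto_const 2[OF that]])
       (use tangent_norm_ge(1)[of m "(\<lambda>x. 1 / (_ - t) * (h _ x - h t x) - h' t x,
        \<lambda>x. 1 / (_ - t) * (k _ x - k t x) - k' t x)"] in auto)
  moreover have "((\<lambda>q. sobolev_real_norm (m - 1) (\<lambda>x. 1 / (q - t) * (k q x - k t x) - k' t x)) \<longlongrightarrow> 0) (at t within I)" if "t \<in> I" for t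
    by (rule tendsto_sandwich[OF _ _ tendsto_const 2[OF that]])
       (use tangent_norm_ge(2)[of m "(\<lambda>x. 1 / (_ - t) * (h _ x - h t x) - h' t x,
        \<lambda>x. 1 / (_ - t) * (k _ x - k t x) - k' t x)"] in auto)
  ultimately show "scurve_deriv m I h h'" "scurve_deriv (m - 1) I k k'"
    using 1 3 by (auto simp: scurve_deriv_def)
qed

text \<open>Differentiation is bounded from order \<open>r\<close> to order \<open>r - 1\<close>.
  Differentiability of the slices is a separate premise because \<open>h t\<close> itself may lie
  outside the Sobolev space, as \<open>\<phi> t\<close> does.\<close>

lemma scurve_cont_deriv:
  assumes r: "r > 3/2" and h: "scurve_cont r I h" and d: "\<And>t x. t \<in> I \<Longrightarrow> h t field_differentiable at x"
  shows "scurve_cont (r - 1) I (\<lambda>t. deriv (h t))"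
proof -
  have eq: "(\<lambda>x. deriv (h q) x - deriv (h t) x) = deriv (\<lambda>x. h q x - h t x)" if "t \<in> I" "q \<in> I" for t q
    using d that by (intro ext deriv_diff[symmetric]) auto
  have mem: "(\<lambda>x. h q x - h t x) \<in> sobolev_real r" if "t \<in> I" "q \<in> I" for t q
    using h that by (auto simp: scurve_cont_def)
  show ?thesis
    unfolding scurve_cont_def
  proof (intro conjI ballI)
    fix t q assume tq: "t \<in> I" "q \<in> I"
    show "(\<lambda>x. deriv (h q) x - deriv (h t) x) \<in> sobolev_real (r - 1)"
      unfolding eq[OF tq] by (rule sobolev_real_C1[OF r mem[OF tq]])
  next
    fix t assume t: "t \<in> I"
    have "((\<lambda>q. 2 * pi * sobolev_real_norm r (\<lambda>x. h q x - h t x)) \<longlongrightarrow> 2 * pi * 0) (at t within I)"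
      using h t by (intro tendsto_intros) (auto simp: scurve_cont_def)
    then have lim: "((\<lambda>q. 2 * pi * sobolev_real_norm r (\<lambda>x. h q x - h t x)) \<longlongrightarrow> 0) (at t within I)" by simp
    show "((\<lambda>q. sobolev_real_norm (r - 1) (\<lambda>x. deriv (h q) x - deriv (h t) x)) \<longlongrightarrow> 0) (at t within I)"
    proof (rule tendsto_sandwich[OF _ _ tendsto_const lim])
      show "\<forall>\<^sub>F q in at t within I. sobolev_real_norm (r - 1) (\<lambda>x. deriv (h q) x - deriv (h t) x)
          \<le> 2 * pi * sobolev_real_norm r (\<lambda>x. h q x - h t x)"
        unfolding eventually_at_filter
        by (intro always_eventually allI impI, subst eq[OF t]) (auto intro: sobolev_real_C1[OF r] mem t)
    qed simp
  qed
qed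

text \<open>Space and time derivatives commute, since the bounded operator of spatial
  differentiation can be applied to the error of the difference quotient in time.\<close>

lemma scurve_deriv_deriv:
  assumes r: "r > 3/2" and h: "scurve_deriv r I h h'" and d: "\<And>t x. t \<in> I \<Longrightarrow> h t field_differentiable at x"
  shows "scurve_deriv (r - 1) I (\<lambda>t. deriv (h t)) (\<lambda>t. deriv (h' t))"
proof -
  have mem: "(\<lambda>x. h q x - h t x) \<in> sobolev_real r" if "t \<in> I" "q \<in> I" for t q
    using h that by (auto simp: scurve_deriv_def)
  have h': "h' t \<in> sobolev_real r" if "t \<in> I" for t
    using h that by (auto simp: scurve_deriv_def)
  have dh': "h' t field_differentiable at x" if "t \<in> I" for t x
    using sobolev_real_C1(1)[OF r h'[OF that]] by (auto simp: field_differentiable_def)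
  have eq: "(\<lambda>x. deriv (h q) x - deriv (h t) x) = deriv (\<lambda>x. h q x - h t x)" if "t \<in> I" "q \<in> I" for t q
    using d that by (intro ext deriv_diff[symmetric]) auto
  have eq2: "(\<lambda>x. c * (deriv (h q) x - deriv (h t) x) - deriv (h' t) x) = deriv (\<lambda>x. c * (h q x - h t x) - h' t x)"
    if "t \<in> I" "q \<in> I" for t q c
  proof (rule ext, rule DERIV_imp_deriv[symmetric])
    fix x
    show "((\<lambda>x. c * (h q x - h t x) - h' t x) has_real_derivative
        c * (deriv (h q) x - deriv (h t) x) - deriv (h' t) x) (at x)"
      using that by (intro derivative_intros DERIV_cmult field_differentiable_derivI d dh')
  qed
  have mem2: "(\<lambda>x. c * (h q x - h t x) - h' t x) \<in> sobolev_real r" if "t \<in> I" "q \<in> I" for t q c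
    by (intro sobolev_real_diff[OF sobolev_real_scale] mem h' that)
  show ?thesis
    unfolding scurve_deriv_def
  proof (intro conjI ballI)
    fix t q assume tq: "t \<in> I" "q \<in> I"
    show "(\<lambda>x. deriv (h q) x - deriv (h t) x) \<in> sobolev_real (r - 1)"
      unfolding eq[OF tq] by (rule sobolev_real_C1[OF r mem[OF tq]])
  next
    fix t assume t: "t \<in> I"
    show "deriv (h' t) \<in> sobolev_real (r - 1)" by (rule sobolev_real_C1[OF r h'[OF t]])
    have "((\<lambda>q. 2 * pi * sobolev_real_norm r (\<lambda>x. 1 / (q - t) * (h q x - h t x) - h' t x)) \<longlongrightarrow> 2 * pi * 0) (at t within I)"
      using h t by (intro tendsto_intros) (auto simp: scurve_deriv_def)
    then have lim: "((\<lambda>q. 2 * pi * sobolev_real_norm r (\<lambda>x. 1 / (q - t) * (h q x - h t x) - h' t x)) \<longlongrightarrow> 0) (at t within I)" by simp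
    show "((\<lambda>q. sobolev_real_norm (r - 1) (\<lambda>x. 1 / (q - t) * (deriv (h q) x - deriv (h t) x) - deriv (h' t) x)) \<longlongrightarrow> 0) (at t within I)"
    proof (rule tendsto_sandwich[OF _ _ tendsto_const lim])
      show "\<forall>\<^sub>F q in at t within I. sobolev_real_norm (r - 1) (\<lambda>x. 1 / (q - t) * (deriv (h q) x - deriv (h t) x) - deriv (h' t) x)
          \<le> 2 * pi * sobolev_real_norm r (\<lambda>x. 1 / (q - t) * (h q x - h t x) - h' t x)"
        unfolding eventually_at_filter
        by (intro always_eventually allI impI, subst eq2[OF t], assumption)
           (rule sobolev_real_C1(3)[OF r mem2[OF t]])
    qed simp
  qed
qed

text \<open>Sobolev convergence in time is uniform in space, so it combines with spatial continuity
  of one slice.\<close>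

lemma scurve_cont_joint:
  assumes r: "r > 1/2" and h: "scurve_cont r I h" and c: "\<And>t. t \<in> I \<Longrightarrow> continuous_on UNIV (h t)"
  shows "continuous_on (I \<times> UNIV) (\<lambda>(t, x). h t x)"
proof -
  obtain C where C: "C > 0" "\<And>f x. f \<in> sobolev_real r \<Longrightarrow> \<bar>f x\<bar> \<le> C * sobolev_real_norm r f"
    using sobolev_real_sup[OF r] by blast
  show ?thesis
    unfolding continuous_on_def
  proof (clarsimp)
    fix t x assume t: "t \<in> I"
    define F where "F = at (t, x) within I \<times> (UNIV :: real set)"
    have fst: "filterlim fst (nhds t) F" and snd: "filterlim snd (nhds x) F"
      unfolding F_def by (auto intro!: tendsto_eq_intros)
    have inI: "\<forall>\<^sub>F z in F. fst z \<in> I" unfolding F_def eventually_at_filter by (intro always_eventually) auto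
    have "((\<lambda>q. C * sobolev_real_norm r (\<lambda>x. h q x - h t x)) \<longlongrightarrow> C * 0) (at t within I)"
      using h t by (intro tendsto_intros) (auto simp: scurve_cont_def)
    moreover have 0: "sobolev_real_norm r (\<lambda>x. h t x - h t x) = 0"
      by (simp add: sobolev_real_norm_def sobolev_norm_def fourier_eq)
    ultimately have "continuous (at t within I) (\<lambda>q. C * sobolev_real_norm r (\<lambda>x. h q x - h t x))"
      by (simp add: continuous_within)
    from continuous_within_tendsto_compose[OF this inI fst]
    have 1: "((\<lambda>z. C * sobolev_real_norm r (\<lambda>x. h (fst z) x - h t x)) \<longlongrightarrow> 0) F"
      by (simp only: 0 mult_zero_right)
    have "((\<lambda>z. h (fst z) (snd z) - h t (snd z)) \<longlongrightarrow> 0) F"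
    proof (rule Lim_null_comparison[OF _ 1])
      show "\<forall>\<^sub>F z in F. norm (h (fst z) (snd z) - h t (snd z)) \<le> C * sobolev_real_norm r (\<lambda>x. h (fst z) x - h t x)"
        using inI
      proof eventually_elim
        case (elim z)
        then show ?case using C(2)[of "\<lambda>x. h (fst z) x - h t x" "snd z"] h t by (auto simp: scurve_cont_def)
      qed
    qed
    moreover have "((\<lambda>z. h t (snd z)) \<longlongrightarrow> h t x) F"
      by (rule isCont_tendsto_compose[OF _ snd]) (use c[OF t] in \<open>simp add: continuous_on_eq_continuous_at\<close>)
    ultimately have "((\<lambda>z. (h (fst z) (snd z) - h t (snd z)) + h t (snd z)) \<longlongrightarrow> 0 + h t x) F"
      by (rule tendsto_add)
    then show "((\<lambda>(t, x). h t x) \<longlongrightarrow> h t x) (at (t, x) within I \<times> UNIV)"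
      by (simp add: case_prod_unfold F_def)
  qed
qed

lemma scurve_deriv_pointwise:
  assumes r: "r > 1/2" and h: "scurve_deriv r I h h'" and t: "t \<in> I"
  shows "((\<lambda>q. h q x) has_real_derivative h' t x) (at t within I)"
proof -
  obtain C where C: "C > 0" "\<And>f x. f \<in> sobolev_real r \<Longrightarrow> \<bar>f x\<bar> \<le> C * sobolev_real_norm r f"
    using sobolev_real_sup[OF r] by blast
  have "((\<lambda>q. C * sobolev_real_norm r (\<lambda>x. 1 / (q - t) * (h q x - h t x) - h' t x)) \<longlongrightarrow> C * 0) (at t within I)"
    using h t by (intro tendsto_intros) (auto simp: scurve_deriv_def)
  then have 1: "((\<lambda>q. C * sobolev_real_norm r (\<lambda>x. 1 / (q - t) * (h q x - h t x) - h' t x)) \<longlongrightarrow> 0) (at t within I)"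
    by simp
  have "((\<lambda>q. 1 / (q - t) * (h q x - h t x) - h' t x) \<longlongrightarrow> 0) (at t within I)"
  proof (rule Lim_null_comparison[OF _ 1])
    have "norm (1 / (q - t) * (h q x - h t x) - h' t x) \<le>
        C * sobolev_real_norm r (\<lambda>x. 1 / (q - t) * (h q x - h t x) - h' t x)" if "q \<in> I" for q
    proof -
      have "(\<lambda>x. h q x - h t x) \<in> sobolev_real r" "h' t \<in> sobolev_real r"
        using h t that by (auto simp: scurve_deriv_def)
      from C(2)[OF sobolev_real_diff[OF sobolev_real_scale[OF this(1)] this(2)]]
      show ?thesis unfolding real_norm_def .
    qed
    then show "\<forall>\<^sub>F q in at t within I. norm (1 / (q - t) * (h q x - h t x) - h' t x) \<le>
        C * sobolev_real_norm r (\<lambda>x. 1 / (q - t) * (h q x - h t x) - h' t x)"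
      unfolding eventually_at_filter by auto
  qed
  then have "((\<lambda>q. 1 / (q - t) * (h q x - h t x)) \<longlongrightarrow> h' t x) (at t within I)"
    by (simp only: LIM_zero_iff)
  then show ?thesis by (simp add: has_field_derivative_iff)
qed

lemma scurve_deriv_imp_cont:
  assumes h: "scurve_deriv r I h h'"
  shows "scurve_cont r I h"
  unfolding scurve_cont_def
proof (intro conjI ballI)
  show mem: "(\<lambda>x. h q x - h t x) \<in> sobolev_real r" if "t \<in> I" "q \<in> I" for t q
    using h that by (auto simp: scurve_deriv_def)
  fix t assume t: "t \<in> I"
  define R where "R q x = 1 / (q - t) * (h q x - h t x) - h' t x" for q x
  have h': "h' t \<in> sobolev_real r" and R0: "((\<lambda>q. sobolev_real_norm r (R q)) \<longlongrightarrow> 0) (at t within I)"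
    using h t by (auto simp: scurve_deriv_def R_def[abs_def])
  have R: "R q \<in> sobolev_real r" if "q \<in> I" for q
    unfolding R_def by (intro sobolev_real_diff[OF sobolev_real_scale] mem t that h')
  have "((\<lambda>q. \<bar>q - t\<bar> * (sobolev_real_norm r (R q) + sobolev_real_norm r (h' t))) \<longlongrightarrow>
      \<bar>t - t\<bar> * (0 + sobolev_real_norm r (h' t))) (at t within I)"
    by (intro tendsto_intros R0)
  then have lim: "((\<lambda>q. \<bar>q - t\<bar> * (sobolev_real_norm r (R q) + sobolev_real_norm r (h' t))) \<longlongrightarrow> 0) (at t within I)"
    by simp
  have le: "sobolev_real_norm r (\<lambda>x. h q x - h t x) \<le> \<bar>q - t\<bar> * (sobolev_real_norm r (R q) + sobolev_real_norm r (h' t))"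
    if q: "q \<in> I" "q \<noteq> t" for q
  proof -
    have 1: "(\<lambda>x. complex_of_real (R q x)) \<in> sobolev r" "(\<lambda>x. complex_of_real (h' t x)) \<in> sobolev r"
      using R[OF q(1)] h' by (auto simp: sobolev_real_def)
    have "(\<lambda>x. complex_of_real (h q x - h t x)) = (\<lambda>x. of_real (q - t) * (of_real (R q x) + of_real (h' t x)))"
    proof
      fix x
      have "h q x - h t x = (q - t) * (R q x + h' t x)" using q(2) by (simp add: R_def)
      then show "complex_of_real (h q x - h t x) = of_real (q - t) * (of_real (R q x) + of_real (h' t x))"
        by (simp only: of_real_mult of_real_add)
    qed
    then have "sobolev_real_norm r (\<lambda>x. h q x - h t x) =
        sobolev_norm r (\<lambda>x. of_real (q - t) * (of_real (R q x) + of_real (h' t x)))"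
      by (simp add: sobolev_real_norm_def)
    also have "\<dots> \<le> cmod (of_real (q - t)) * sobolev_norm r (\<lambda>x. of_real (R q x) + of_real (h' t x))"
      by (intro sobolev_scale sobolev_add 1)
    also have "\<dots> \<le> \<bar>q - t\<bar> * (sobolev_real_norm r (R q) + sobolev_real_norm r (h' t))"
      using sobolev_add(2)[OF 1] by (auto simp: sobolev_real_norm_def intro!: mult_left_mono simp flip: of_real_diff)
    finally show ?thesis .
  qed
  show "((\<lambda>q. sobolev_real_norm r (\<lambda>x. h q x - h t x)) \<longlongrightarrow> 0) (at t within I)"
  proof (rule tendsto_sandwich[OF _ _ tendsto_const lim])
    show "\<forall>\<^sub>F q in at t within I. sobolev_real_norm r (\<lambda>x. h q x - h t x)
        \<le> \<bar>q - t\<bar> * (sobolev_real_norm r (R q) + sobolev_real_norm r (h' t))"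
      unfolding eventually_at_filter by (intro always_eventually) (use le in auto)
  qed simp
qed

text \<open>Chain rule along a particle path. The time derivative is required at one point only,
  provided the spatial one is jointly continuous; derivatives within \<open>I\<close> cover the
  initial time.\<close>

lemma has_real_derivative_along_curve:
  fixes h hx :: "real \<Rightarrow> real \<Rightarrow> real"
  assumes ht: "((\<lambda>q. h q (g t)) has_real_derivative D) (at t within I)"
    and hx: "\<And>q y. q \<in> I \<Longrightarrow> (h q has_real_derivative hx q y) (at y)"
    and cont: "continuous_on (I \<times> UNIV) (\<lambda>(t, x). hx t x)"
    and g: "(g has_real_derivative v) (at t within I)" and t: "t \<in> I"
  shows "((\<lambda>q. h q (g q)) has_real_derivative D + hx t (g t) * v) (at t within I)"
proof -
  have A: "((\<lambda>(q, y). h q y) has_derivative (\<lambda>(tx, ty). D * tx + blinfun_apply (blinfun_mult_right (hx t (g t))) ty))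
      (at (t, g t) within I \<times> UNIV)"
  proof (rule has_derivative_partialsI)
    show "((\<lambda>q. h q (g t)) has_derivative (*) D) (at t within I)"
      using ht by (simp add: has_field_derivative_def)
    show "(h q has_derivative blinfun_apply (blinfun_mult_right (hx q y))) (at y within UNIV)" if "q \<in> I" for q y
      using hx[OF that, of y] by (simp add: has_field_derivative_def)
    have "continuous_on (I \<times> UNIV) (\<lambda>z. blinfun_mult_right (hx (fst z) (snd z)))"
      using cont by (intro continuous_intros) (simp add: case_prod_unfold)
    then show "continuous (at (t, g t) within I \<times> UNIV) (\<lambda>(q, y). blinfun_mult_right (hx q y))"
      using t by (simp add: continuous_on_eq_continuous_within case_prod_unfold)
  qed auto
  have B: "((\<lambda>q. (q, g q)) has_derivative (\<lambda>s. (s, v * s))) (at t within I)"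
    using g by (auto simp: has_field_derivative_def intro!: derivative_intros)
  have sub: "(\<lambda>q. (q, g q)) ` I \<subseteq> I \<times> UNIV" by auto
  have "((\<lambda>(q, y). h q y) \<circ> (\<lambda>q. (q, g q)) has_derivative
      (\<lambda>(tx, ty). D * tx + blinfun_apply (blinfun_mult_right (hx t (g t))) ty) \<circ> (\<lambda>s. (s, v * s))) (at t within I)"
    by (rule diff_chain_within[OF B has_derivative_subset[OF A sub]])
  moreover have "(\<lambda>(tx, ty). D * tx + blinfun_apply (blinfun_mult_right (hx t (g t))) ty) \<circ> (\<lambda>s. (s, v * s))
      = (*) (D + hx t (g t) * v)"
    by (auto simp: algebra_simps)
  ultimately show ?thesis by (simp add: has_field_derivative_def o_def)
qed

subsection \<open>Second-order linear equations with constant coefficients\<close>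

lemma exp_line_has_vector_derivative:
  "((\<lambda>t. exp (l * complex_of_real t)) has_vector_derivative l * exp (l * of_real t)) (at t within S)"
  by (rule has_vector_derivative_eq_rhs, rule has_vector_derivative_real_field,
      (rule derivative_eq_intros refl | simp)+)

text \<open>\<open>l1\<close> and \<open>l2\<close> are the roots of \<open>x^2 = p * x + q\<close>,
  so solutions are explicit and defined for all real times.\<close>

lemma linear_ode2_exists:
  fixes p q y0 z0 :: complex
  obtains y z :: "real \<Rightarrow> complex" where
    "\<And>t. (y has_vector_derivative z t) (at t)"
    "\<And>t. (z has_vector_derivative p * z t + q * y t) (at t)" "y 0 = y0" "z 0 = z0"
proof -
  define l1 where "l1 = (p + csqrt (p\<^sup>2 + 4 * q)) / 2"
  define l2 where "l2 = (p - csqrt (p\<^sup>2 + 4 * q)) / 2"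
  define w where "w = csqrt (p\<^sup>2 + 4 * q)"
  have w: "w * w = p * p + 4 * q" by (simp add: w_def flip: power2_eq_square)
  have l: "2 * l1 = p + w" "2 * l2 = p - w" by (simp_all add: l1_def l2_def w_def)
  have "l1 + l2 = p" by (simp add: l1_def l2_def field_simps)
  have "4 * (l1 * l2) = (2 * l1) * (2 * l2)" by simp
  also have "\<dots> = p * p - w * w" unfolding l by (simp add: algebra_simps)
  also have "\<dots> = - (4 * q)" by (simp add: w)
  finally have "l1 * l2 = - q" by simp
  then have pq: "p = l1 + l2" "q = - (l1 * l2)" using \<open>l1 + l2 = p\<close> by simp_all
  define e1 where "e1 t = exp (l1 * complex_of_real t)" for t
  define e2 where "e2 t = exp (l2 * complex_of_real t)" for t
  have e: "(e1 has_vector_derivative l1 * e1 t) (at t)" "(e2 has_vector_derivative l2 * e2 t) (at t)" for t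
    unfolding e1_def e2_def by (rule exp_line_has_vector_derivative)+
  have e0: "e1 0 = 1" "e2 0 = 1" by (simp_all add: e1_def e2_def)
  show thesis
  proof (cases "l1 = l2")
    case False
    \<comment> \<open>\<open>c\<close> and \<open>d\<close> solve \<open>c + d = y0\<close> and
      \<open>c * l1 + d * l2 = z0\<close>.\<close>
    define c where "c = (z0 - l2 * y0) / (l1 - l2)"
    define d where "d = (l1 * y0 - z0) / (l1 - l2)"
    have nz: "l1 - l2 \<noteq> 0" using False by simp
    have "c + d = ((l1 - l2) * y0) / (l1 - l2)" "c * l1 + d * l2 = ((l1 - l2) * z0) / (l1 - l2)"
      unfolding c_def d_def times_divide_eq_left add_divide_distrib[symmetric]
      by (simp_all add: algebra_simps)
    then have cd: "c + d = y0" "c * l1 + d * l2 = z0" using nz by simp_all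
    show thesis
    proof (rule that[of "\<lambda>t. c * e1 t + d * e2 t" "\<lambda>t. c * l1 * e1 t + d * l2 * e2 t"])
      fix t
      show "((\<lambda>t. c * e1 t + d * e2 t) has_vector_derivative c * l1 * e1 t + d * l2 * e2 t) (at t)"
        using has_vector_derivative_add[OF has_vector_derivative_mult_right[OF e(1)] has_vector_derivative_mult_right[OF e(2)], of c d t]
        by (simp add: algebra_simps)
      show "((\<lambda>t. c * l1 * e1 t + d * l2 * e2 t) has_vector_derivative
          p * (c * l1 * e1 t + d * l2 * e2 t) + q * (c * e1 t + d * e2 t)) (at t)"
        using has_vector_derivative_add[OF has_vector_derivative_mult_right[OF e(1)] has_vector_derivative_mult_right[OF e(2)],
            of "c * l1" "d * l2" t]
        by (simp add: pq algebra_simps)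
    qed (use cd e0 in auto)
  next
    case True
    \<comment> \<open>For a double root the second solution is \<open>t\<close> times the
      exponential; \<open>d\<close> matches the initial derivative.\<close>
    define d where "d = z0 - l1 * y0"
    have lin: "((\<lambda>t. y0 + d * complex_of_real t) has_vector_derivative d) (at t)" for t
      by (rule has_vector_derivative_eq_rhs, rule has_vector_derivative_real_field,
          (rule derivative_eq_intros refl | simp)+)
    have y: "((\<lambda>t. (y0 + d * of_real t) * e1 t) has_vector_derivative
        l1 * ((y0 + d * of_real t) * e1 t) + d * e1 t) (at t)" for t
      using has_vector_derivative_mult[OF lin e(1)] by (simp add: algebra_simps)
    show thesis
    proof (rule that[of "\<lambda>t. (y0 + d * of_real t) * e1 t" "\<lambda>t. l1 * ((y0 + d * of_real t) * e1 t) + d * e1 t"])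
      fix t
      show "((\<lambda>t. (y0 + d * of_real t) * e1 t) has_vector_derivative
        l1 * ((y0 + d * of_real t) * e1 t) + d * e1 t) (at t)" by (rule y)
      show "((\<lambda>t. l1 * ((y0 + d * of_real t) * e1 t) + d * e1 t) has_vector_derivative
          p * (l1 * ((y0 + d * of_real t) * e1 t) + d * e1 t) + q * ((y0 + d * of_real t) * e1 t)) (at t)"
        using has_vector_derivative_add[OF has_vector_derivative_mult_right[OF y] has_vector_derivative_mult_right[OF e(1)],
            of l1 d t]
        by (simp add: pq True algebra_simps)
    qed (use e0 in \<open>auto simp: d_def\<close>)
  qed
qed

text \<open>Abel's identity: the Wronskian times \<open>exp (- p * t)\<close> has derivative 0. It
  is stated within an interval \<open>I\<close> so that global solutions can be paired with one
  living only on \<open>[0, T)\<close>.\<close>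

lemma wronskian:
  fixes y1 z1 y2 z2 :: "real \<Rightarrow> complex"
  assumes I: "convex I" "0 \<in> I" "t \<in> I"
    and y1: "\<And>t. t \<in> I \<Longrightarrow> (y1 has_vector_derivative z1 t) (at t within I)"
      "\<And>t. t \<in> I \<Longrightarrow> (z1 has_vector_derivative p * z1 t + q * y1 t) (at t within I)"
    and y2: "\<And>t. t \<in> I \<Longrightarrow> (y2 has_vector_derivative z2 t) (at t within I)"
      "\<And>t. t \<in> I \<Longrightarrow> (z2 has_vector_derivative p * z2 t + q * y2 t) (at t within I)"
  shows "y1 t * z2 t - z1 t * y2 t = exp (p * of_real t) * (y1 0 * z2 0 - z1 0 * y2 0)"
proof -
  define E where "E t = exp (- p * complex_of_real t)" for t
  define V where "V t = E t * (y1 t * z2 t - z1 t * y2 t)" for t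
  have "V t = V 0"
  proof (rule has_derivative_zero_unique[OF I(1) _ I(3,2)])
    fix t assume t: "t \<in> I"
    have "(V has_vector_derivative
        E t * ((y1 t * (p * z2 t + q * y2 t) + z1 t * z2 t) - (z1 t * z2 t + (p * z1 t + q * y1 t) * y2 t))
        + (- p * E t) * (y1 t * z2 t - z1 t * y2 t)) (at t within I)"
      unfolding V_def E_def
      by (intro has_vector_derivative_mult has_vector_derivative_diff exp_line_has_vector_derivative y1 y2 t)
    also have "E t * ((y1 t * (p * z2 t + q * y2 t) + z1 t * z2 t) - (z1 t * z2 t + (p * z1 t + q * y1 t) * y2 t))
        + (- p * E t) * (y1 t * z2 t - z1 t * y2 t) = 0"
      by (simp add: algebra_simps)
    finally show "(V has_derivative (\<lambda>h. 0)) (at t within I)"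
      by (simp add: has_vector_derivative_def)
  qed
  then have "exp (p * of_real t) * V t = exp (p * of_real t) * V 0" by simp
  moreover have "exp (p * of_real t) * V t = y1 t * z2 t - z1 t * y2 t"
    by (simp add: V_def E_def mult.assoc[symmetric] flip: exp_add)
  ultimately show ?thesis by (simp add: V_def E_def)
qed

text \<open>The representation follows by Cramer's rule from the Wronskians of \<open>y\<close> with
  \<open>A\<close> and with \<open>B\<close>, so uniqueness of solutions comes for free.\<close>

lemma linear_ode2_fundamental:
  fixes p q :: complex
  obtains A A' B B' :: "real \<Rightarrow> complex" where
    "\<And>t. (A has_vector_derivative A' t) (at t)" "\<And>t. (B has_vector_derivative B' t) (at t)"
    "continuous_on UNIV A'" "continuous_on UNIV B'"
    "\<And>t. A t * B' t - A' t * B t \<noteq> 0"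
    "\<And>I y z t. convex I \<Longrightarrow> 0 \<in> I \<Longrightarrow> (\<And>t. t \<in> I \<Longrightarrow> (y has_vector_derivative z t) (at t within I)) \<Longrightarrow>
      (\<And>t. t \<in> I \<Longrightarrow> (z has_vector_derivative p * z t + q * y t) (at t within I)) \<Longrightarrow> t \<in> I \<Longrightarrow>
      y t = A t * y 0 + B t * z 0 \<and> z t = A' t * y 0 + B' t * z 0"
proof -
  obtain A A' where A: "\<And>t. (A has_vector_derivative A' t) (at t)"
    "\<And>t. (A' has_vector_derivative p * A' t + q * A t) (at t)" "A 0 = 1" "A' 0 = 0"
    by (rule linear_ode2_exists[of p q 1 0]) blast
  obtain B B' where B: "\<And>t. (B has_vector_derivative B' t) (at t)"
    "\<And>t. (B' has_vector_derivative p * B' t + q * B t) (at t)" "B 0 = 0" "B' 0 = 1"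
    by (rule linear_ode2_exists[of p q 0 1]) blast
  note AI = has_vector_derivative_at_within[OF A(1)] has_vector_derivative_at_within[OF A(2)]
  note BI = has_vector_derivative_at_within[OF B(1)] has_vector_derivative_at_within[OF B(2)]
  have W: "A t * B' t - A' t * B t = exp (p * of_real t)" for t
    using wronskian[of UNIV t A A' p q B B', OF _ _ _ AI BI] A(3,4) B(3,4) by simp
  show thesis
  proof (rule that[OF A(1) B(1)])
    show "continuous_on UNIV A'" "continuous_on UNIV B'"
      using has_vector_derivative_continuous[OF A(2)] has_vector_derivative_continuous[OF B(2)]
      by (auto simp: continuous_on_eq_continuous_at)
    show "A t * B' t - A' t * B t \<noteq> 0" for t by (simp add: W)
    fix I y z t
    assume I: "convex I" "0 \<in> I" and y: "\<And>t. t \<in> I \<Longrightarrow> (y has_vector_derivative z t) (at t within I)"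
      "\<And>t. t \<in> I \<Longrightarrow> (z has_vector_derivative p * z t + q * y t) (at t within I)" and t: "t \<in> I"
    have 1: "y t * B' t - z t * B t = exp (p * of_real t) * y 0"
      using wronskian[OF I t y BI] B(3,4) by simp
    have 2: "A t * z t - A' t * y t = exp (p * of_real t) * z 0"
      using wronskian[OF I t AI y] A(3,4) by simp
    have "exp (p * of_real t) * y t = y t * (A t * B' t - A' t * B t)" by (simp add: W)
    also have "\<dots> = A t * (y t * B' t - z t * B t) + B t * (A t * z t - A' t * y t)" by (simp add: algebra_simps)
    also have "\<dots> = exp (p * of_real t) * (A t * y 0 + B t * z 0)" unfolding 1 2 by (simp add: algebra_simps)
    finally have "y t = A t * y 0 + B t * z 0" by simp
    moreover have "exp (p * of_real t) * z t = z t * (A t * B' t - A' t * B t)" by (simp add: W)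
    then have "exp (p * of_real t) * z t = A' t * (y t * B' t - z t * B t) + B' t * (A t * z t - A' t * y t)"
      by (simp add: algebra_simps)
    then have "exp (p * of_real t) * z t = exp (p * of_real t) * (A' t * y 0 + B' t * z 0)"
      unfolding 1 2 by (simp add: algebra_simps)
    then have "z t = A' t * y 0 + B' t * z 0" by simp
    ultimately show "y t = A t * y 0 + B t * z 0 \<and> z t = A' t * y 0 + B' t * z 0" by blast
  qed
qed

section \<open>Divergence at a simple zero\<close>

lemma filterlim_inverse_at_top_left_diff:
  "filterlim (\<lambda>t. 1 / (T - t)) at_top (at_left (T::real))"
proof -
  have "filterlim (\<lambda>t. T - t) (at_right 0) (at_left T)"
    unfolding filterlim_at
    by (auto simp: eventually_at_filter intro!: tendsto_eq_intros)
  from filterlim_compose[OF filterlim_inverse_at_top_right this]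
  show ?thesis by (simp add: inverse_eq_divide)
qed

text \<open>At a simple zero \<open>y t / (t - T)\<close> tends to \<open>z T\<close>, so
  \<open>(t - T) * (z t / y t)\<close> tends to 1. This limit is real and nonzero, hence the real
  part alone diverges, and as a full limit.\<close>

lemma logarithmic_derivative_blowup:
  fixes y z :: "real \<Rightarrow> complex"
  assumes y: "(y has_vector_derivative z T) (at T)" "y T = 0" and z: "isCont z T" "z T \<noteq> 0"
  shows "filterlim (\<lambda>t. \<bar>Re (z t / y t)\<bar>) at_top (at_left T)"
proof -
  have "((\<lambda>t. norm ((1 / norm (t - T)) *\<^sub>R (y t - (y T + (t - T) *\<^sub>R z T)))) \<longlongrightarrow> 0) (at T)"
    by (rule tendsto_norm_zero)
       (use y(1) in \<open>simp add: has_vector_derivative_def has_derivative_within\<close>)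
  moreover have "\<forall>\<^sub>F t in at T. norm ((1 / norm (t - T)) *\<^sub>R (y t - (y T + (t - T) *\<^sub>R z T))) =
      norm ((1 / (t - T)) *\<^sub>R y t - z T)"
    unfolding eventually_at_filter
  proof (intro always_eventually allI impI)
    fix t assume "t \<noteq> T"
    then have "(1 / (t - T)) *\<^sub>R y t - z T = (1 / (t - T)) *\<^sub>R (y t - (y T + (t - T) *\<^sub>R z T))"
      using y(2) by (simp add: scaleR_diff_right)
    then show "norm ((1 / norm (t - T)) *\<^sub>R (y t - (y T + (t - T) *\<^sub>R z T))) =
      norm ((1 / (t - T)) *\<^sub>R y t - z T)" by (simp del: norm_minus_cancel)
  qed
  ultimately have "((\<lambda>t. norm ((1 / (t - T)) *\<^sub>R y t - z T)) \<longlongrightarrow> 0) (at T)"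
    by (rule Lim_transform_eventually)
  then have "((\<lambda>t. (1 / (t - T)) *\<^sub>R y t) \<longlongrightarrow> z T) (at T)"
    by (simp only: tendsto_norm_zero_iff LIM_zero_iff)
  then have 1: "((\<lambda>t. (1 / (t - T)) *\<^sub>R y t) \<longlongrightarrow> z T) (at_left T)"
    by (rule tendsto_mono[OF at_le, rotated]) auto
  have "(z \<longlongrightarrow> z T) (at_left T)"
    using z(1) by (auto simp: isCont_def intro: tendsto_mono[OF at_le])
  from tendsto_divide[OF this 1 z(2)]
  have "((\<lambda>t. Re (z t / ((1 / (t - T)) *\<^sub>R y t))) \<longlongrightarrow> Re (z T / z T)) (at_left T)"
    by (rule tendsto_Re)
  then have "((\<lambda>t. \<bar>Re (z t / ((1 / (t - T)) *\<^sub>R y t))\<bar>) \<longlongrightarrow> \<bar>Re (z T / z T)\<bar>) (at_left T)"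
    by (rule tendsto_rabs)
  then have lim: "((\<lambda>t. \<bar>Re (z t / ((1 / (t - T)) *\<^sub>R y t))\<bar>) \<longlongrightarrow> 1) (at_left T)"
    using z(2) by simp
  have "filterlim (\<lambda>t. 1 / (T - t)) at_top (at_left T)"
    by (rule filterlim_inverse_at_top_left_diff)
  from filterlim_tendsto_pos_mult_at_top[OF lim _ this]
  have "filterlim (\<lambda>t. \<bar>Re (z t / ((1 / (t - T)) *\<^sub>R y t))\<bar> * (1 / (T - t))) at_top (at_left T)" by simp
  moreover have "\<forall>\<^sub>F t in at_left T. \<bar>Re (z t / ((1 / (t - T)) *\<^sub>R y t))\<bar> * (1 / (T - t)) = \<bar>Re (z t / y t)\<bar>"
  proof -
    have "\<bar>Re (z t / ((1 / (t - T)) *\<^sub>R y t))\<bar> * (1 / (T - t)) = \<bar>Re (z t / y t)\<bar>" if "t < T" for t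
    proof -
      have "z t / ((1 / (t - T)) *\<^sub>R y t) = of_real (t - T) * (z t / y t)"
        by (simp add: scaleR_conv_of_real)
      then have "Re (z t / ((1 / (t - T)) *\<^sub>R y t)) = (t - T) * Re (z t / y t)"
        by (simp only: Re_complex_of_real times_complex.sel Im_complex_of_real)
      then show ?thesis using that by (simp add: abs_mult)
    qed
    then show ?thesis by (auto simp: eventually_at_filter)
  qed
  ultimately show ?thesis by (rule filterlim_mono_eventually[OF _ order_refl order_refl])
qed

subsection \<open>Lagrangian form of the system\<close>

lemma Diff0D:
  assumes m: "m > 3/2" and f: "f \<in> Diff0 m"
  shows Diff0_deriv: "(f has_real_derivative deriv f x) (at x)"
    and Diff0_deriv_pos: "deriv f x > 0"
    and Diff0_zero: "f 0 = 0"
    and Diff0_per: "f (x + 1) = f x + 1"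
    and Diff0_deriv_sobolev: "deriv f \<in> sobolev_real (m - 1)"
    and Diff0_strict_mono: "strict_mono f"
    and Diff0_surj: "surj f"
proof -
  have s: "(\<lambda>x. f x - x) \<in> sobolev_real m" and z: "f 0 = 0"
    and d: "\<And>x. \<exists>d>0. (f has_real_derivative d) (at x)"
    using f by (auto simp: Diff0_def)
  show der: "(f has_real_derivative deriv f x) (at x)" and pos: "deriv f x > 0" for x
    using d[of x] DERIV_imp_deriv by blast+
  show "f 0 = 0" by (rule z)
  show "f (x + 1) = f x + 1" using sobolev_real_per[OF s, of x] by simp
  have "deriv (\<lambda>x. f x - x) x = deriv f x - 1" for x
    by (rule DERIV_imp_deriv) (rule derivative_intros der)+
  then have "deriv (\<lambda>x. f x - x) = (\<lambda>x. deriv f x - 1)" by (rule ext)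
  then have "(\<lambda>x. deriv f x - 1) \<in> sobolev_real (m - 1)"
    using sobolev_real_C1(2)[OF m s] by simp
  from sobolev_real_add[OF this sobolev_real_const[of 1]]
  show "deriv f \<in> sobolev_real (m - 1)" by simp
  show sm: "strict_mono f"
    by (rule strict_monoI, rule DERIV_pos_imp_increasing) (use der pos in blast)+
  obtain C where C: "\<And>g x. g \<in> sobolev_real m \<Longrightarrow> \<bar>g x\<bar> \<le> C * sobolev_real_norm m g"
    by (rule sobolev_real_sup[of m]) (use m in auto)
  \<comment> \<open>\<open>f\<close> stays within distance \<open>B\<close> of the identity, so it
    takes the value \<open>y\<close> between \<open>y - B\<close> and \<open>y + B\<close>.\<close>
  define B where "B = C * sobolev_real_norm m (\<lambda>x. f x - x)"
  have B: "\<bar>f x - x\<bar> \<le> B" for x using C[OF s, of x] by (simp add: B_def)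
  have "\<exists>x. f x = y" for y
  proof -
    have "f (y - B) \<le> y" "y \<le> f (y + B)" "y - B \<le> y + B"
      using B[of "y - B"] B[of "y + B"] by (auto simp: abs_le_iff)
    moreover have "continuous_on {y - B..y + B} f"
      using der DERIV_isCont by (blast intro: continuous_at_imp_continuous_on)
    ultimately show ?thesis using IVT'[of f "y - B" y "y + B"] by blast
  qed
  then show "surj f" by (metis surj_def)
qed

text \<open>Substitution, with \<open>f 0 = 0\<close> and \<open>f 1 = 1\<close>; it moves integrals
  over the circle between Eulerian and Lagrangian coordinates.\<close>

lemma Diff0_integral:
  assumes m: "m > 3/2" and f: "f \<in> Diff0 m" and g: "continuous_on UNIV (g :: real \<Rightarrow> real)"
  shows "integral {0..1} (\<lambda>x. g (f x) * deriv f x) = integral {0..1} g"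
proof -
  note D = Diff0D[OF m f]
  have f1: "f 1 = 1" using D(3) D(4)[of 0] by simp
  have "((\<lambda>x. deriv f x *\<^sub>R g (f x)) has_integral integral {f 0..f 1} g) {0..1}"
  proof (rule has_integral_substitution)
    show "f ` {0..1} \<subseteq> {0..1}"
      using strict_mono_mono[OF D(6)] D(3) f1 by (force simp: mono_def)
  qed (use D(1,3) f1 g in \<open>auto intro: continuous_on_subset has_field_derivative_at_within\<close>)
  then show ?thesis using D(3) f1 by (simp add: has_integral_iff mult.commute)
qed

section \<open>The solution in Eulerian and Lagrangian coordinates\<close>

locale magnetic_HS_solution =
  fixes m s T :: real
    and \<phi> \<tau> \<phi>_t \<tau>_t \<phi>_tt \<tau>_tt u \<rho> u_t \<rho>_t :: "real \<Rightarrow> real \<Rightarrow> real"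
  assumes m: "m > 5/2" and T: "T > 0"
    and C2: "C2_curve m {0..<T} (\<lambda>t. (\<phi> t, \<tau> t)) (\<lambda>t. (\<phi>_t t, \<tau>_t t)) (\<lambda>t. (\<phi>_tt t, \<tau>_tt t))"
    and Gm: "\<And>t. t \<in> {0..<T} \<Longrightarrow> (\<phi> t, \<tau> t) \<in> Gm m"
    and u: "\<And>t. t \<in> {0..<T} \<Longrightarrow> u t = \<phi>_t t \<circ> inv (\<phi> t)"
    and \<rho>: "\<And>t. t \<in> {0..<T} \<Longrightarrow> \<rho> t = \<tau>_t t \<circ> inv (\<phi> t)"
    and u\<rho>_tangent: "\<And>t. t \<in> {0..<T} \<Longrightarrow> (u t, \<rho> t) \<in> tangent m"
    and u\<rho>_C0: "continuous_curve m {0..<T} (\<lambda>t. (u t, \<rho> t))"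
    and u\<rho>_C1: "C1_curve (m - 1) {0..<T} (\<lambda>t. (u t, \<rho> t)) (\<lambda>t. (u_t t, \<rho>_t t))"
    and pde: "magnetic_2HS s {0..<T} u \<rho> u_t \<rho>_t"
begin

abbreviation "J \<equiv> {0..<T}"

text \<open>Orders above 3/2 allow one spatial derivative, orders above 1/2 give sup bounds. The
  last one is for \<open>u_xx\<close> and \<open>\<rho>_x\<close>, and is exactly
  \<open>m > 5/2\<close>.\<close>

lemma m': "m > 3/2" "m - 1 > 3/2" "m > 1/2" "m - 1 > 1/2" "m - 1 - 1 > 1/2"
  using m by auto

lemma zero_J: "0 \<in> J" using T by simp

declare atLeastLessThan_iff [simp del]

lemma \<phi>_Diff0: "t \<in> J \<Longrightarrow> \<phi> t \<in> Diff0 m"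
  using Gm by (auto simp: Gm_def)

lemmas \<phi>D = Diff0D[OF m'(1) \<phi>_Diff0]

lemma \<phi>_t_sob: "t \<in> J \<Longrightarrow> \<phi>_t t \<in> sobolev_real m" and \<tau>_t_sob: "t \<in> J \<Longrightarrow> \<tau>_t t \<in> sobolev_real (m - 1)"
  using C2 by (auto simp: C2_curve_def C1_curve_def has_curve_derivative_def tangent_def)

lemma u_sob: "t \<in> J \<Longrightarrow> u t \<in> sobolev_real m" and \<rho>_sob: "t \<in> J \<Longrightarrow> \<rho> t \<in> sobolev_real (m - 1)"
  using u\<rho>_tangent by (auto simp: tangent_def)

lemma u_\<phi>: "t \<in> J \<Longrightarrow> u t (\<phi> t x) = \<phi>_t t x" and \<rho>_\<phi>: "t \<in> J \<Longrightarrow> \<rho> t (\<phi> t x) = \<tau>_t t x"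
  using \<phi>D(6) u \<rho> by (auto simp: strict_mono_imp_inj_on)

lemma scurves:
  "scurve_deriv m J \<phi> \<phi>_t" "scurve_deriv (m - 1) J \<tau> \<tau>_t"
  "scurve_cont m J \<phi>_t" "scurve_cont (m - 1) J \<tau>_t"
  "scurve_cont m J u" "scurve_cont (m - 1) J \<rho>"
  "scurve_deriv (m - 1) J u u_t" "scurve_deriv (m - 1 - 1) J \<rho> \<rho>_t"
  using C2 u\<rho>_C0 u\<rho>_C1 unfolding C2_curve_def C1_curve_def
  by (blast intro: continuous_curve_components curve_derivative_components)+

lemma differentiable_slices:
  "t \<in> J \<Longrightarrow> \<phi> t field_differentiable at x" "t \<in> J \<Longrightarrow> \<phi>_t t field_differentiable at x"
  "t \<in> J \<Longrightarrow> u t field_differentiable at x" "t \<in> J \<Longrightarrow> \<rho> t field_differentiable at x"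
  "t \<in> J \<Longrightarrow> deriv (u t) field_differentiable at x"
  unfolding field_differentiable_def
  using \<phi>D(1) sobolev_real_C1(1)[OF m'(1) \<phi>_t_sob] sobolev_real_C1(1)[OF m'(1) u_sob]
    sobolev_real_C1(1)[OF m'(2) \<rho>_sob] sobolev_real_C1(1)[OF m'(2) sobolev_real_C1(2)[OF m'(1) u_sob]]
  by blast+

section \<open>Evolution along particle paths\<close>

abbreviation a :: "real \<Rightarrow> real \<Rightarrow> real" where "a t \<equiv> deriv (\<phi> t)"
abbreviation p :: "real \<Rightarrow> real \<Rightarrow> real" where "p t \<equiv> deriv (\<phi>_t t)"

text \<open>The gradient \<open>u_x\<close> seen by a particle, which is the relative growth rate of
  the Jacobian: \<open>a_t = w * a\<close>.\<close>

definition w :: "real \<Rightarrow> real \<Rightarrow> real" where "w t x = deriv (u t) (\<phi> t x)"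
text \<open>This is \<open>c^2 - s * \<delta>\<close> evaluated at time \<open>t\<close>; its
  independence of \<open>t\<close> is established below.\<close>

definition \<kappa> :: "real \<Rightarrow> real" where
  "\<kappa> t = 1/4 * integral {0..1} (\<lambda>x. (deriv (u t) x)\<^sup>2 + (\<rho> t x)\<^sup>2) - s * (1/2 * integral {0..1} (\<rho> t))"

lemma a_pos: "t \<in> J \<Longrightarrow> a t x > 0"
  by (rule \<phi>D(2))

lemma w_a: "t \<in> J \<Longrightarrow> w t x * a t x = p t x"
proof -
  assume t: "t \<in> J"
  have "(u t \<circ> \<phi> t has_real_derivative w t x * a t x) (at x)"
    unfolding w_def using differentiable_slices[OF t] by (intro DERIV_chain field_differentiable_derivI)
  moreover have "u t \<circ> \<phi> t = \<phi>_t t" using u_\<phi>[OF t] by auto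
  ultimately show ?thesis using DERIV_imp_deriv by metis
qed

lemma a_t: "t \<in> J \<Longrightarrow> ((\<lambda>t. a t x) has_real_derivative p t x) (at t within J)"
  by (rule scurve_deriv_pointwise[OF m'(4) scurve_deriv_deriv[OF m'(1) scurves(1)]]) (auto intro: differentiable_slices)

lemma \<phi>_t_deriv: "t \<in> J \<Longrightarrow> ((\<lambda>t. \<phi> t x) has_real_derivative \<phi>_t t x) (at t within J)"
  by (rule scurve_deriv_pointwise[OF m'(3) scurves(1)])

lemma \<tau>_t_deriv: "t \<in> J \<Longrightarrow> ((\<lambda>t. \<tau> t x) has_real_derivative \<tau>_t t x) (at t within J)"
  by (rule scurve_deriv_pointwise[OF m'(4) scurves(2)])

lemma a_sob: "t \<in> J \<Longrightarrow> a t \<in> sobolev_real (m - 1)"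
  by (rule \<phi>D(5))

lemma p_sob: "t \<in> J \<Longrightarrow> p t \<in> sobolev_real (m - 1)"
  by (rule sobolev_real_C1[OF m'(1) \<phi>_t_sob])

lemma a_joint: "continuous_on (J \<times> UNIV) (\<lambda>(t, x). a t x)"
  by (rule scurve_cont_joint[OF m'(4) scurve_cont_deriv[OF m'(1) scurve_deriv_imp_cont[OF scurves(1)]]])
     (auto intro: differentiable_slices sobolev_real_cont[OF a_sob])

lemma p_joint: "continuous_on (J \<times> UNIV) (\<lambda>(t, x). p t x)"
  by (rule scurve_cont_joint[OF m'(4) scurve_cont_deriv[OF m'(1) scurves(3)]])
     (auto intro: differentiable_slices sobolev_real_cont[OF p_sob])

lemma b_joint: "continuous_on (J \<times> UNIV) (\<lambda>(t, x). \<tau>_t t x)"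
  by (rule scurve_cont_joint[OF m'(4) scurves(4)]) (auto intro: sobolev_real_cont[OF \<tau>_t_sob])

lemma pde1: "t \<in> J \<Longrightarrow> deriv (u_t t) x = - 1/2 * (deriv (u t) x)\<^sup>2 - u t x * deriv (deriv (u t)) x
    + 1/2 * (\<rho> t x)\<^sup>2 - s * \<rho> t x - 2 * \<kappa> t"
  using pde by (auto simp: magnetic_2HS_def Let_def \<kappa>_def)

lemma pde2: "t \<in> J \<Longrightarrow> \<rho>_t t x = - (deriv (\<rho> t) x * u t x + \<rho> t x * deriv (u t) x) + s * deriv (u t) x"
proof -
  assume t: "t \<in> J"
  have "deriv (\<lambda>y. \<rho> t y * u t y) x = deriv (\<rho> t) x * u t x + \<rho> t x * deriv (u t) x"
    by (rule DERIV_imp_deriv)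
       (rule derivative_eq_intros field_differentiable_derivI differentiable_slices[OF t] refl | simp)+
  then show ?thesis using pde t by (auto simp: magnetic_2HS_def Let_def)
qed

text \<open>The term \<open>u * u_xx\<close> from moving with the particle cancels the transport
  term of the system and leaves a Riccati equation at each fixed \<open>x\<close>.\<close>

lemma w_t: "t \<in> J \<Longrightarrow> ((\<lambda>t. w t x) has_real_derivative
    - 1/2 * (w t x)\<^sup>2 + 1/2 * (\<tau>_t t x)\<^sup>2 - s * \<tau>_t t x - 2 * \<kappa> t) (at t within J)"
proof -
  assume t: "t \<in> J"
  have "((\<lambda>q. deriv (u q) (\<phi> q x)) has_real_derivative
      deriv (u_t t) (\<phi> t x) + deriv (deriv (u t)) (\<phi> t x) * \<phi>_t t x) (at t within J)"
  proof (rule has_real_derivative_along_curve[OF _ _ _ \<phi>_t_deriv[OF t] t])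
    show "((\<lambda>q. deriv (u q) (\<phi> t x)) has_real_derivative deriv (u_t t) (\<phi> t x)) (at t within J)"
      by (rule scurve_deriv_pointwise[OF m'(5) scurve_deriv_deriv[OF m'(2) scurves(7)]]) (auto intro: differentiable_slices t)
    show "(deriv (u q) has_real_derivative deriv (deriv (u q)) y) (at y)" if "q \<in> J" for q y
      using differentiable_slices[OF that] by (intro field_differentiable_derivI)
    show "continuous_on (J \<times> UNIV) (\<lambda>(t, x). deriv (deriv (u t)) x)"
      by (rule scurve_cont_joint[OF m'(5) scurve_cont_deriv[OF m'(2) scurve_cont_deriv[OF m'(1) scurves(5)]]])
         (auto intro: differentiable_slices sobolev_real_cont[OF sobolev_real_C1(2)[OF m'(2) sobolev_real_C1(2)[OF m'(1) u_sob]]])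
  qed
  then show ?thesis
    unfolding w_def[symmetric] using t by (simp add: pde1 u_\<phi> \<rho>_\<phi> w_def[symmetric] algebra_simps)
qed

text \<open>In the same way \<open>u * \<rho>_x\<close> cancels, and only the stretching terms
  \<open>- \<rho> * u_x\<close> and \<open>s * u_x\<close> survive.\<close>

lemma b_t: "t \<in> J \<Longrightarrow> ((\<lambda>t. \<tau>_t t x) has_real_derivative (s - \<tau>_t t x) * w t x) (at t within J)"
proof -
  assume t: "t \<in> J"
  have "((\<lambda>q. \<rho> q (\<phi> q x)) has_real_derivative
      \<rho>_t t (\<phi> t x) + deriv (\<rho> t) (\<phi> t x) * \<phi>_t t x) (at t within J)"
  proof (rule has_real_derivative_along_curve[OF _ _ _ \<phi>_t_deriv[OF t] t])
    show "((\<lambda>q. \<rho> q (\<phi> t x)) has_real_derivative \<rho>_t t (\<phi> t x)) (at t within J)"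
      by (rule scurve_deriv_pointwise[OF m'(5) scurves(8) t])
    show "(\<rho> q has_real_derivative deriv (\<rho> q) y) (at y)" if "q \<in> J" for q y
      using differentiable_slices[OF that] by (intro field_differentiable_derivI)
    show "continuous_on (J \<times> UNIV) (\<lambda>(t, x). deriv (\<rho> t) x)"
      by (rule scurve_cont_joint[OF m'(5) scurve_cont_deriv[OF m'(2) scurves(6)]])
         (auto intro: differentiable_slices sobolev_real_cont[OF sobolev_real_C1(2)[OF m'(2) \<rho>_sob]])
  qed
  then have "((\<lambda>q. \<rho> q (\<phi> q x)) has_real_derivative (s - \<tau>_t t x) * w t x) (at t within J)"
    using t by (simp add: pde2 u_\<phi> \<rho>_\<phi> w_def[symmetric] algebra_simps)
  then show ?thesis
    by (rule has_field_derivative_transform_within[OF _ zero_less_one t]) (auto simp: \<rho>_\<phi>)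
qed

subsection \<open>Conservation laws\<close>

lemma integral_a: "t \<in> J \<Longrightarrow> integral {0..1} (a t) = 1"
  using Diff0_integral[OF m'(1) \<phi>_Diff0, of t "\<lambda>_. 1"] by simp

lemma integral_p: "t \<in> J \<Longrightarrow> integral {0..1} (p t) = 0"
proof -
  assume t: "t \<in> J"
  have "(p t has_integral \<phi>_t t 1 - \<phi>_t t 0) {0..1}"
    by (rule fundamental_theorem_of_calculus)
       (use sobolev_real_C1(1)[OF m'(1) \<phi>_t_sob[OF t]] in
        \<open>auto simp: has_real_derivative_iff_has_vector_derivative[symmetric] intro: has_field_derivative_at_within\<close>)
  then show ?thesis using sobolev_real_per[OF \<phi>_t_sob[OF t], of 0] by (simp add: has_integral_iff)
qed

text \<open>\<open>\<tau>_t - s\<close> decays at the rate \<open>w\<close> at which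
  \<open>a\<close> grows. Integrated over the circle, this makes \<open>\<delta>\<close>
  constant.\<close>

lemma momentum: "t \<in> J \<Longrightarrow> (\<tau>_t t x - s) * a t x = (\<tau>_t 0 x - s) * a 0 x"
proof -
  assume t: "t \<in> J"
  show ?thesis
  proof (rule has_derivative_zero_unique[where f = "\<lambda>t. (\<tau>_t t x - s) * a t x" and s = J])
    fix t assume t: "t \<in> J"
    have "((\<lambda>t. (\<tau>_t t x - s) * a t x) has_real_derivative
        ((s - \<tau>_t t x) * w t x - 0) * a t x + p t x * (\<tau>_t t x - s)) (at t within J)"
      by (intro DERIV_mult DERIV_diff b_t a_t t DERIV_const)
    also have "((s - \<tau>_t t x) * w t x - 0) * a t x + p t x * (\<tau>_t t x - s) = 0"
      unfolding w_a[OF t, symmetric] by (simp add: algebra_simps)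
    finally show "((\<lambda>t. (\<tau>_t t x - s) * a t x) has_derivative (\<lambda>h. 0)) (at t within J)"
      by (simp add: has_field_derivative_def lambda_zero)
  qed (use t zero_J in auto)
qed

text \<open>The density of \<open>4 * c^2\<close> after the change of variables by
  \<open>\<phi> t\<close>.\<close>

definition energy :: "real \<Rightarrow> real \<Rightarrow> real" where
  "energy t x = ((w t x)\<^sup>2 + (\<tau>_t t x)\<^sup>2) * a t x"

text \<open>The energy of a particle is not conserved, but its rate is a scalar depending on time
  only, times \<open>p\<close>, whose integral over a period is 0.\<close>

lemma energy_t: "t \<in> J \<Longrightarrow> ((\<lambda>t. energy t x) has_real_derivative - 4 * \<kappa> t * p t x) (at t within J)"
proof -
  assume t: "t \<in> J"
  have "((\<lambda>t. energy t x) has_real_derivative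
     (2 * w t x * (- 1/2 * (w t x)\<^sup>2 + 1/2 * (\<tau>_t t x)\<^sup>2 - s * \<tau>_t t x - 2 * \<kappa> t)
     + 2 * \<tau>_t t x * ((s - \<tau>_t t x) * w t x)) * a t x + p t x * ((w t x)\<^sup>2 + (\<tau>_t t x)\<^sup>2)) (at t within J)"
    unfolding energy_def
    by (rule derivative_eq_intros w_t[OF t] b_t[OF t] a_t[OF t] refl | simp)+
  also have "(2 * w t x * (- 1/2 * (w t x)\<^sup>2 + 1/2 * (\<tau>_t t x)\<^sup>2 - s * \<tau>_t t x - 2 * \<kappa> t)
     + 2 * \<tau>_t t x * ((s - \<tau>_t t x) * w t x)) * a t x + p t x * ((w t x)\<^sup>2 + (\<tau>_t t x)\<^sup>2) = - 4 * \<kappa> t * p t x"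
    unfolding w_a[OF t, symmetric] by (simp add: algebra_simps power2_eq_square)
  finally show ?thesis .
qed

text \<open>Joint continuity is available for \<open>p\<close> and \<open>a\<close>, so
  \<open>w\<close> is written as their quotient.\<close>

lemma energy_joint: "continuous_on (J \<times> UNIV) (\<lambda>(t, x). energy t x)"
proof -
  have "continuous_on (J \<times> UNIV) (\<lambda>(t, x). ((p t x / a t x)\<^sup>2 + (\<tau>_t t x)\<^sup>2) * a t x)"
    using a_joint p_joint b_joint unfolding case_prod_unfold
    by (intro continuous_intros) (auto simp: less_imp_neq[OF a_pos, symmetric])
  moreover have "energy t x = ((p t x / a t x)\<^sup>2 + (\<tau>_t t x)\<^sup>2) * a t x" if "t \<in> J" for t x
  proof -
    have "p t x / a t x = w t x" using w_a[OF that, of x] a_pos[OF that, of x] by (simp add: field_simps)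
    then show ?thesis by (simp add: energy_def)
  qed
  ultimately show ?thesis by (subst continuous_on_cong[OF refl]) auto
qed

lemma \<kappa>_lagrangian:
  assumes t: "t \<in> J"
  shows "\<kappa> t = 1/4 * integral {0..1} (energy t) - s/2 * integral {0..1} (\<lambda>x. \<tau>_t t x * a t x)"
proof -
  have "continuous_on UNIV (deriv (u t))" "continuous_on UNIV (\<rho> t)"
    using sobolev_real_cont[OF sobolev_real_C1(2)[OF m'(1) u_sob[OF t]]] sobolev_real_cont[OF \<rho>_sob[OF t]] by auto
  then show ?thesis
    using Diff0_integral[OF m'(1) \<phi>_Diff0[OF t], of "\<lambda>x. (deriv (u t) x)\<^sup>2 + (\<rho> t x)\<^sup>2"]
      Diff0_integral[OF m'(1) \<phi>_Diff0[OF t], of "\<rho> t"]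
    by (simp add: \<kappa>_def energy_def[abs_def] w_def \<rho>_\<phi>[OF t] continuous_intros)
qed

lemma integral_b: "t \<in> J \<Longrightarrow> integral {0..1} (\<lambda>x. \<tau>_t t x * a t x) = integral {0..1} (\<lambda>x. \<tau>_t 0 x * a 0 x)"
proof -
  assume t: "t \<in> J"
  have i: "(\<lambda>x. \<tau>_t t x * a t x) integrable_on {0..1}" "a t integrable_on {0..1}" if "t \<in> J" for t
    using that by (auto intro!: integrable_continuous_interval continuous_intros sobolev_real_cont[OF a_sob]
        sobolev_real_cont[OF \<tau>_t_sob])
  have e: "integral {0..1} (\<lambda>x. (\<tau>_t t x - s) * a t x) = integral {0..1} (\<lambda>x. \<tau>_t t x * a t x) - s" if "t \<in> J" for t
  proof -
    have "integral {0..1} (\<lambda>x. (\<tau>_t t x - s) * a t x) = integral {0..1} (\<lambda>x. \<tau>_t t x * a t x - s * a t x)"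
      by (simp add: algebra_simps)
    also have "\<dots> = integral {0..1} (\<lambda>x. \<tau>_t t x * a t x) - integral {0..1} (\<lambda>x. s * a t x)"
      using i[OF that] by (intro integral_diff integrable_on_mult_right)
    finally show ?thesis using integral_a[OF that] by simp
  qed
  have "integral {0..1} (\<lambda>x. (\<tau>_t t x - s) * a t x) = integral {0..1} (\<lambda>x. (\<tau>_t 0 x - s) * a 0 x)"
    using momentum[OF t] by simp
  then show ?thesis unfolding e[OF t] e[OF zero_J] by simp
qed

text \<open>The derivative of the energy contains \<open>\<kappa>\<close> itself. Continuity of
  \<open>\<kappa>\<close> is therefore obtained first, from joint continuity of the energy density
  and constancy of \<open>\<delta>\<close>; only then can the integral be differentiated.\<close>

lemma \<kappa>_const: "t \<in> J \<Longrightarrow> \<kappa> t = \<kappa> 0"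
proof -
  assume t: "t \<in> J"
  have en01: "continuous_on (J \<times> cbox 0 1) (\<lambda>(t, x). energy t x)"
    by (rule continuous_on_subset[OF energy_joint]) auto
  have "continuous_on J (\<lambda>t. integral (cbox 0 1) (energy t))"
    by (rule integral_continuous_on_param[OF en01])
  then have "continuous_on J (\<lambda>t. 1/4 * integral {0..1} (energy t) - s/2 * integral {0..1} (\<lambda>x. \<tau>_t 0 x * a 0 x))"
    by (intro continuous_intros) simp
  then have \<kappa>: "continuous_on J \<kappa>"
  proof (rule continuous_on_eq)
    fix t assume "t \<in> J"
    then show "1/4 * integral {0..1} (energy t) - s/2 * integral {0..1} (\<lambda>x. \<tau>_t 0 x * a 0 x) = \<kappa> t"
      by (simp only: \<kappa>_lagrangian[of t] integral_b[of t])
  qed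
  have "((\<lambda>t. integral (cbox 0 1) (energy t)) has_field_derivative integral (cbox 0 1) (\<lambda>x. - 4 * \<kappa> t * p t x)) (at t within J)"
    if t: "t \<in> J" for t
  proof (rule leibniz_rule_field_derivative[OF energy_t _ _ t])
    show "energy q integrable_on cbox 0 1" if "q \<in> J" for q
    proof -
      have "continuous_on (cbox 0 1) ((\<lambda>(t, x). energy t x) \<circ> (\<lambda>x. (q, x)))"
        by (intro continuous_on_compose continuous_intros continuous_on_subset[OF energy_joint]) (use that in auto)
      then show ?thesis by (intro integrable_continuous) (simp add: o_def)
    qed
    show "continuous_on (J \<times> cbox 0 1) (\<lambda>(t, x). - 4 * \<kappa> t * p t x)"
      using continuous_on_subset[OF p_joint, of "J \<times> cbox 0 1"] unfolding case_prod_unfold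
      by (intro continuous_intros continuous_on_compose2[OF \<kappa>]) auto
  qed auto
  note der = this
  have "((\<lambda>t. integral {0..1} (energy t)) has_derivative (\<lambda>h. 0)) (at t within J)" if t: "t \<in> J" for t
    using der[OF that] integral_p[OF that] by (simp add: has_field_derivative_def lambda_zero)
  then have "integral {0..1} (energy t) = integral {0..1} (energy 0)"
    by (intro has_derivative_zero_unique[where s = J]) (use t zero_J in auto)
  then show ?thesis using t zero_J by (simp add: \<kappa>_lagrangian integral_b[OF t])
qed

subsection \<open>The Madelung transform of the solution\<close>

definition f :: "real \<Rightarrow> real \<Rightarrow> complex" where
  "f t = madelung (\<phi> t, \<tau> t)"

text \<open>The time derivative of \<open>f\<close>: a factor 1/2 arises from the square root of the
  Jacobian and another from the half phase.\<close>

definition g :: "real \<Rightarrow> real \<Rightarrow> complex" where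
  "g t x = f t x * (of_real (w t x / 2) + \<i> * of_real (\<tau>_t t x / 2))"

lemma f_eq: "f t x = of_real (sqrt (a t x)) * exp (\<i> * of_real (\<tau> t x / 2))"
  by (simp add: f_def madelung_def)

lemma f_nonzero: "t \<in> J \<Longrightarrow> f t x \<noteq> 0"
  using a_pos[of t x] by (simp add: f_eq)

lemma norm_f: "t \<in> J \<Longrightarrow> (cmod (f t x))\<^sup>2 = a t x"
  using a_pos[of t x] by (simp add: f_eq norm_mult less_imp_le)

lemma f_t: "t \<in> J \<Longrightarrow> ((\<lambda>t. f t x) has_vector_derivative g t x) (at t within J)"
proof -
  assume t: "t \<in> J"
  have "((\<lambda>t. sqrt (a t x)) has_real_derivative inverse (sqrt (a t x)) / 2 * p t x) (at t within J)"
    using a_pos[OF t, of x] by (intro DERIV_chain'[OF a_t[OF t], of sqrt] DERIV_real_sqrt)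
  also have "inverse (sqrt (a t x)) / 2 * p t x = sqrt (a t x) * (w t x / 2)"
    unfolding w_a[OF t, symmetric] using a_pos[OF t, of x]
    by (simp add: field_simps)
  finally have 1: "((\<lambda>t. complex_of_real (sqrt (a t x))) has_vector_derivative of_real (sqrt (a t x) * (w t x / 2))) (at t within J)"
    by (intro has_vector_derivative_of_real) (simp add: has_real_derivative_iff_has_vector_derivative)
  have "((\<lambda>t. \<i> * complex_of_real (\<tau> t x / 2)) has_vector_derivative \<i> * of_real (\<tau>_t t x / 2)) (at t within J)"
    by (intro has_vector_derivative_mult_right has_vector_derivative_of_real)
       (use DERIV_cdivide[OF \<tau>_t_deriv[OF t], of x 2] in \<open>simp add: has_real_derivative_iff_has_vector_derivative\<close>)
  from field_vector_diff_chain_within[OF this, of exp]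
  have 2: "((\<lambda>t. exp (\<i> * complex_of_real (\<tau> t x / 2))) has_vector_derivative
      \<i> * of_real (\<tau>_t t x / 2) * exp (\<i> * of_real (\<tau> t x / 2))) (at t within J)"
    by (simp add: o_def DERIV_exp has_field_derivative_at_within)
  show ?thesis
    using has_vector_derivative_mult[OF 1 2] by (simp add: f_eq g_def algebra_simps)
qed

text \<open>Put \<open>l = (w + \<i> * \<tau>_t) / 2\<close>, so that \<open>g = l * f\<close>. The
  equations for \<open>w\<close> and \<open>\<tau>_t\<close> combine into
  \<open>l_t + l^2 = \<i> * s * l - \<kappa>\<close>, in which the quadratic terms are absorbed by
  \<open>f\<close>.\<close>

lemma g_t: "t \<in> J \<Longrightarrow> ((\<lambda>t. g t x) has_vector_derivative (\<i> * s) * g t x + (- \<kappa> 0) * f t x) (at t within J)"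
proof -
  assume t: "t \<in> J"
  have 1: "((\<lambda>t. complex_of_real (w t x / 2)) has_vector_derivative
      of_real ((- 1/2 * (w t x)\<^sup>2 + 1/2 * (\<tau>_t t x)\<^sup>2 - s * \<tau>_t t x - 2 * \<kappa> t) / 2)) (at t within J)"
    by (intro has_vector_derivative_of_real)
       (use DERIV_cdivide[OF w_t[OF t], of x 2] in \<open>simp add: has_real_derivative_iff_has_vector_derivative\<close>)
  have 2: "((\<lambda>t. \<i> * complex_of_real (\<tau>_t t x / 2)) has_vector_derivative \<i> * of_real ((s - \<tau>_t t x) * w t x / 2)) (at t within J)"
    by (intro has_vector_derivative_mult_right has_vector_derivative_of_real)
       (use DERIV_cdivide[OF b_t[OF t], of x 2] in \<open>simp add: has_real_derivative_iff_has_vector_derivative\<close>)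
  define W where "W = complex_of_real (w t x)"
  define b where "b = complex_of_real (\<tau>_t t x)"
  have "((\<lambda>t. g t x) has_vector_derivative
     f t x * (of_real ((- 1/2 * (w t x)\<^sup>2 + 1/2 * (\<tau>_t t x)\<^sup>2 - s * \<tau>_t t x - 2 * \<kappa> t) / 2)
       + \<i> * of_real ((s - \<tau>_t t x) * w t x / 2)) + g t x * (of_real (w t x / 2) + \<i> * of_real (\<tau>_t t x / 2))) (at t within J)"
    unfolding g_def
    by (intro has_vector_derivative_mult has_vector_derivative_add 1 2 f_t[OF t, unfolded g_def])
  also have "f t x * (of_real ((- 1/2 * (w t x)\<^sup>2 + 1/2 * (\<tau>_t t x)\<^sup>2 - s * \<tau>_t t x - 2 * \<kappa> t) / 2)
       + \<i> * of_real ((s - \<tau>_t t x) * w t x / 2)) + g t x * (of_real (w t x / 2) + \<i> * of_real (\<tau>_t t x / 2))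
     = f t x * ((- 1/2 * W * W + 1/2 * b * b - of_real s * b - 2 * of_real (\<kappa> t)) / 2
       + \<i> * ((of_real s - b) * W / 2) + (W / 2 + \<i> * (b / 2)) * (W / 2 + \<i> * (b / 2)))"
    unfolding g_def W_def b_def by (simp add: power2_eq_square algebra_simps)
  also have "(- 1/2 * W * W + 1/2 * b * b - of_real s * b - 2 * of_real (\<kappa> t)) / 2
       + \<i> * ((of_real s - b) * W / 2) + (W / 2 + \<i> * (b / 2)) * (W / 2 + \<i> * (b / 2))
     = \<i> * of_real s * (W / 2 + \<i> * (b / 2)) - of_real (\<kappa> t)"
    by (simp add: field_simps)
  also have "f t x * \<dots> = (\<i> * s) * g t x + (- \<kappa> 0) * f t x"
    unfolding g_def W_def b_def \<kappa>_const[OF t] by (simp add: algebra_simps)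
  finally show ?thesis .
qed

text \<open>For nonzero degree \<open>\<tau> t\<close> is not periodic. Halving the linear part
  \<open>4 * pi * k * x\<close> gives exactly the phase of \<open>chi k\<close>, which splits off as
  a factor.\<close>

lemma exp_\<tau>_sob: "t \<in> J \<Longrightarrow> (\<lambda>x. exp (\<i> * complex_of_real (\<tau> t x / 2))) \<in> sobolev (m - 1)"
proof -
  assume "t \<in> J"
  then obtain k :: int where k: "(\<lambda>x. complex_of_real (\<tau> t x - 4 * pi * of_int k * x)) \<in> sobolev (m - 1)"
    using Gm by (auto simp: Gm_def circle_map_lifts_def sobolev_real_def)
  have "(\<lambda>x. chi k x * exp ((\<i> / 2) * complex_of_real (\<tau> t x - 4 * pi * of_int k * x))) \<in> sobolev (m - 1)"
    by (intro sobolev_mult[OF m'(4)] sobolev_exp[OF m'(4)] sobolev_scale sobolev_chi k)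
  moreover have "chi k x * exp ((\<i> / 2) * complex_of_real (\<tau> t x - 4 * pi * of_int k * x)) =
      exp (\<i> * complex_of_real (\<tau> t x / 2))" for x
    unfolding chi_def exp_add[symmetric] by (rule arg_cong[where f = exp]) (simp add: field_simps)
  ultimately show ?thesis by simp
qed

lemma a_powr_sob: "t \<in> J \<Longrightarrow> \<bar>e\<bar> \<le> 1 \<Longrightarrow> (\<lambda>x. complex_of_real (a t x powr e)) \<in> sobolev (m - 1)"
  using sobolev_powr[OF m'(2), of "a t" e] a_sob[of t] a_pos by (auto simp: sobolev_real_def)

lemma f_sob: "t \<in> J \<Longrightarrow> f t \<in> sobolev (m - 1)"
proof -
  assume t: "t \<in> J"
  have "(\<lambda>x. complex_of_real (a t x powr (1/2)) * exp (\<i> * complex_of_real (\<tau> t x / 2))) \<in> sobolev (m - 1)"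
    by (intro sobolev_mult[OF m'(4)] a_powr_sob exp_\<tau>_sob t) auto
  moreover have "f t = (\<lambda>x. complex_of_real (a t x powr (1/2)) * exp (\<i> * complex_of_real (\<tau> t x / 2)))"
    using a_pos[OF t] by (auto simp: f_eq powr_half_sqrt less_imp_le)
  ultimately show ?thesis by simp
qed

text \<open>\<open>w\<close> is a composition with \<open>\<phi> t\<close>. Replacing
  \<open>w * sqrt a\<close> by \<open>p * a powr (-1/2)\<close> leaves only products and powers, to
  which the algebra property applies.\<close>

lemma g_sob: "t \<in> J \<Longrightarrow> g t \<in> sobolev (m - 1)"
proof -
  assume t: "t \<in> J"
  have pb: "(\<lambda>x. complex_of_real (p t x)) \<in> sobolev (m - 1)" "(\<lambda>x. complex_of_real (\<tau>_t t x)) \<in> sobolev (m - 1)"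
    using p_sob[OF t] \<tau>_t_sob[OF t] by (auto simp: sobolev_real_def)
  have 1: "(\<lambda>x. (1/2) * (complex_of_real (p t x) * (complex_of_real (a t x powr (-1/2)) * exp (\<i> * complex_of_real (\<tau> t x / 2))))
      + (\<i>/2) * (complex_of_real (\<tau>_t t x) * f t x)) \<in> sobolev (m - 1)"
    by (intro sobolev_add sobolev_scale sobolev_mult[OF m'(4)] a_powr_sob exp_\<tau>_sob f_sob pb t) auto
  have eq: "g t x = (1/2) * (complex_of_real (p t x) * (complex_of_real (a t x powr (-1/2)) * exp (\<i> * complex_of_real (\<tau> t x / 2))))
      + (\<i>/2) * (complex_of_real (\<tau>_t t x) * f t x)" for x
  proof -
    have "p t x * a t x powr (-1/2) = w t x * sqrt (a t x)"
      unfolding w_a[OF t, symmetric] using a_pos[OF t, of x]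
      by (simp add: powr_minus powr_half_sqrt less_imp_le real_sqrt_divide field_simps)
    then have "complex_of_real (p t x) * complex_of_real (a t x powr (-1/2)) = of_real (w t x * sqrt (a t x))"
      by (simp flip: of_real_mult)
    then have "complex_of_real (p t x) * (complex_of_real (a t x powr (-1/2)) * exp (\<i> * complex_of_real (\<tau> t x / 2)))
        = of_real (w t x) * f t x"
      by (simp add: f_eq mult.assoc[symmetric])
    then show ?thesis by (simp add: g_def algebra_simps)
  qed
  show ?thesis using 1 unfolding eq[symmetric] .
qed

lemma f_nonvanishing: "t \<in> J \<Longrightarrow> f t \<in> nonvanishing (m - 1)"
  using f_sob[of t] f_nonzero[of t] integral_a[of t]
  by (simp add: nonvanishing_def sphere_set_def L2_norm_def norm_f)

lemma w_eq: "t \<in> J \<Longrightarrow> w t x = 2 * Re (g t x / f t x)"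
  using f_nonzero[of t x] by (simp add: g_def)

section \<open>Behaviour at the final time\<close>

lemma eventually_J: "\<forall>\<^sub>F t in at_left T. t \<in> J"
  using eventually_at_left_real[OF T]
  by eventually_elim (auto simp: atLeastLessThan_iff)

text \<open>Makes the real supremum in the blow-up condition a genuine upper bound.\<close>

lemma bdd_above_u_x: "t \<in> J \<Longrightarrow> bdd_above (range (\<lambda>x. \<bar>deriv (u t) x\<bar>))"
proof -
  assume t: "t \<in> J"
  obtain C where "\<And>g x. g \<in> sobolev_real (m - 1) \<Longrightarrow> \<bar>g x\<bar> \<le> C * sobolev_real_norm (m - 1) g"
    by (rule sobolev_real_sup[OF m'(4)]) auto
  from this[OF sobolev_real_C1(2)[OF m'(1) u_sob[OF t]]] show ?thesis
    by (auto intro!: bdd_aboveI)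
qed

theorem blowup_iff_frontier:
  "filterlim (\<lambda>t. SUP x. \<bar>deriv (u t) x\<bar>) at_top (at_left T) \<longleftrightarrow>
   (\<exists>F. limitin (sphere_topology (m - 1)) f F (at_left T) \<and>
        F \<in> sphere_topology (m - 1) frontier_of nonvanishing (m - 1))"
proof -
  obtain A A' B B' :: "real \<Rightarrow> complex" where AB: "\<And>t. (A has_vector_derivative A' t) (at t)"
    "\<And>t. (B has_vector_derivative B' t) (at t)" "continuous_on UNIV A'" "continuous_on UNIV B'"
    and W: "\<And>t. A t * B' t - A' t * B t \<noteq> 0"
    and rep: "\<And>I (y :: real \<Rightarrow> complex) z t. convex I \<Longrightarrow> 0 \<in> I \<Longrightarrow> (\<And>t. t \<in> I \<Longrightarrow> (y has_vector_derivative z t) (at t within I)) \<Longrightarrow>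
      (\<And>t. t \<in> I \<Longrightarrow> (z has_vector_derivative (\<i> * s) * z t + (- \<kappa> 0) * y t) (at t within I)) \<Longrightarrow> t \<in> I \<Longrightarrow>
      y t = A t * y 0 + B t * z 0 \<and> z t = A' t * y 0 + B' t * z 0"
    by (rule linear_ode2_fundamental[of "\<i> * s" "- \<kappa> 0"]) blast
  have conv: "convex J" by simp
  have fg: "f t x = A t * f 0 x + B t * g 0 x" "g t x = A' t * f 0 x + B' t * g 0 x" if "t \<in> J" for t x
    using rep[OF conv zero_J f_t g_t that] by blast+
  have contAB: "continuous_on UNIV A" "continuous_on UNIV B"
    using has_vector_derivative_continuous[OF AB(1)] has_vector_derivative_continuous[OF AB(2)]
    by (auto simp: continuous_on_eq_continuous_at)
  have left: "(h \<longlongrightarrow> h T) (at_left T)" if "continuous_on UNIV h" for h :: "real \<Rightarrow> complex"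
    using that by (auto simp: continuous_on_def intro: tendsto_mono[OF at_le])
  note f0 = f_sob[OF zero_J] and g0 = g_sob[OF zero_J]
  \<comment> \<open>\<open>F\<close> and \<open>G\<close> are the values at \<open>T\<close> of the
    solution formulas for \<open>f\<close> and \<open>g\<close>, whose coefficients exist beyond the
    interval of the solution.\<close>
  define F where "F x = A T * f 0 x + B T * g 0 x" for x
  define G where "G x = A' T * f 0 x + B' T * g 0 x" for x
  have F_sob: "F \<in> sobolev (m - 1)"
    unfolding F_def by (intro sobolev_add sobolev_scale f0 g0)
  have F_sphere: "F \<in> sphere_set (m - 1)"
  proof -
    \<comment> \<open>The squared modulus of the formula for \<open>f\<close>. Its integral is
      continuous in \<open>t\<close> through \<open>T\<close> and equals 1 before \<open>T\<close>,
      hence also at \<open>T\<close>.\<close>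
    define H where "H t x = (cmod (A t * f 0 x + B t * g 0 x))\<^sup>2" for t x
    have "continuous_on (UNIV \<times> cbox 0 1) (\<lambda>(t, x). H t x)"
      unfolding H_def case_prod_unfold
      by (intro continuous_intros continuous_on_compose2[OF contAB(1)] continuous_on_compose2[OF contAB(2)]
          continuous_on_compose2[OF circ_cont[OF sobolevD(1)[OF f0], of UNIV]]
          continuous_on_compose2[OF circ_cont[OF sobolevD(1)[OF g0], of UNIV]]) auto
    then have "continuous_on UNIV (\<lambda>t. integral (cbox 0 1) (H t))"
      by (rule integral_continuous_on_param)
    then have lim: "((\<lambda>t. integral {0..1} (H t)) \<longlongrightarrow> integral {0..1} (H T)) (at_left T)"
      by (auto simp: continuous_on_def intro: tendsto_mono[OF at_le])
    have "\<forall>\<^sub>F t in at_left T. integral {0..1} (H t) = 1"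
      using eventually_J
    proof eventually_elim
      case (elim t)
      then have "H t = a t" by (auto simp: H_def norm_f simp flip: fg)
      then show ?case using integral_a[OF elim] by simp
    qed
    then have "((\<lambda>t. integral {0..1} (H t)) \<longlongrightarrow> 1) (at_left T)" by (rule tendsto_eventually)
    from tendsto_unique[OF _ lim this] have "integral {0..1} (H T) = 1" by simp
    then show ?thesis using F_sob by (simp add: sphere_set_def L2_norm_def H_def[abs_def] F_def)
  qed
  have lim: "limitin (sphere_topology (m - 1)) f F (at_left T)"
    unfolding limitin_sphere
  proof (intro conjI F_sphere)
    show "\<forall>\<^sub>F t in at_left T. f t \<in> sphere_set (m - 1)"
      using eventually_J by eventually_elim (use f_nonvanishing in \<open>auto simp: nonvanishing_def\<close>)
    have "((\<lambda>t. cmod (A t - A T) * sobolev_norm (m - 1) (f 0) + cmod (B t - B T) * sobolev_norm (m - 1) (g 0))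
        \<longlongrightarrow> cmod (A T - A T) * sobolev_norm (m - 1) (f 0) + cmod (B T - B T) * sobolev_norm (m - 1) (g 0)) (at_left T)"
      by (intro tendsto_intros left contAB)
    then have 0: "((\<lambda>t. cmod (A t - A T) * sobolev_norm (m - 1) (f 0) + cmod (B t - B T) * sobolev_norm (m - 1) (g 0))
        \<longlongrightarrow> 0) (at_left T)" by simp
    show "((\<lambda>t. sobolev_norm (m - 1) (\<lambda>x. f t x - F x)) \<longlongrightarrow> 0) (at_left T)"
    proof (rule tendsto_sandwich[OF _ _ tendsto_const 0])
      show "\<forall>\<^sub>F t in at_left T. sobolev_norm (m - 1) (\<lambda>x. f t x - F x) \<le>
          cmod (A t - A T) * sobolev_norm (m - 1) (f 0) + cmod (B t - B T) * sobolev_norm (m - 1) (g 0)"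
        using eventually_J
      proof eventually_elim
        case (elim t)
        have "(\<lambda>x. f t x - F x) = (\<lambda>x. (A t - A T) * f 0 x + (B t - B T) * g 0 x)"
          by (rule ext) (simp add: fg[OF elim] F_def algebra_simps)
        then have "sobolev_norm (m - 1) (\<lambda>x. f t x - F x) \<le>
          sobolev_norm (m - 1) (\<lambda>x. (A t - A T) * f 0 x) + sobolev_norm (m - 1) (\<lambda>x. (B t - B T) * g 0 x)"
          by (simp only:) (intro sobolev_add(2) sobolev_scale(1) f0 g0)
        also have "\<dots> \<le> cmod (A t - A T) * sobolev_norm (m - 1) (f 0) + cmod (B t - B T) * sobolev_norm (m - 1) (g 0)"
          by (intro add_mono sobolev_scale(2) f0 g0)
        finally show ?case .
      qed
    qed simp
  qed
  have nv: "\<forall>\<^sub>F t in at_left T. f t \<in> nonvanishing (m - 1)"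
    using eventually_J by eventually_elim (rule f_nonvanishing)
  note ul = limitin_sphere_uniform_limit[OF m'(4)]
  have "(\<exists>L. limitin (sphere_topology (m - 1)) f L (at_left T) \<and>
        L \<in> sphere_topology (m - 1) frontier_of nonvanishing (m - 1)) \<longleftrightarrow> (\<exists>x. F x = 0)"
  proof -
    \<comment> \<open>Limits on the sphere are pointwise limits, so \<open>F\<close> is the only
      candidate for the existential.\<close>
    have "L = F" if "limitin (sphere_topology (m - 1)) f L (at_left T)" for L
    proof
      fix x
      show "L x = F x"
        using tendsto_uniform_limitI[OF ul[OF that], of x] tendsto_uniform_limitI[OF ul[OF lim], of x]
        by (intro tendsto_unique[of "at_left T" "\<lambda>t. f t x"]) auto
    qed
    then show ?thesis
      using lim frontier_nonvanishing_limit_iff[OF m'(4) lim trivial_limit_at_left_real nv] by metis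
  qed
  moreover have "filterlim (\<lambda>t. SUP x. \<bar>deriv (u t) x\<bar>) at_top (at_left T) \<longleftrightarrow> (\<exists>x. F x = 0)"
  proof
    assume blow: "filterlim (\<lambda>t. SUP x. \<bar>deriv (u t) x\<bar>) at_top (at_left T)"
    show "\<exists>x. F x = 0"
    proof (rule ccontr)
      assume "\<nexists>x. F x = 0"
      then obtain e where e: "e > 0" "\<And>x. cmod (F x) \<ge> e"
        using circ_nonvanishing_bound[OF sobolevD(1)[OF F_sob]] by blast
      obtain K0 where K0: "K0 > 0" "\<And>x. cmod (f 0 x) \<le> K0" using circ_bounded[OF sobolevD(1)[OF f0]] by blast
      obtain K1 where K1: "K1 > 0" "\<And>x. cmod (g 0 x) \<le> K1" using circ_bounded[OF sobolevD(1)[OF g0]] by blast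
      \<comment> \<open>\<open>K\<close> bounds \<open>|g|\<close> close to \<open>T\<close> by
        continuity of \<open>A'\<close> and \<open>B'\<close>, while \<open>|f|\<close> stays above
        \<open>e / 2\<close>; this yields the bound on \<open>w\<close>.\<close>
      define K where "K = (cmod (A' T) + 1) * K0 + (cmod (B' T) + 1) * K1"
      have evA: "\<forall>\<^sub>F t in at_left T. cmod (A' t) < cmod (A' T) + 1"
        by (rule order_tendstoD(2)[OF tendsto_norm[OF left[OF AB(3)]]]) simp
      have evB: "\<forall>\<^sub>F t in at_left T. cmod (B' t) < cmod (B' T) + 1"
        by (rule order_tendstoD(2)[OF tendsto_norm[OF left[OF AB(4)]]]) simp
      have evf: "\<forall>\<^sub>F t in at_left T. \<forall>x\<in>UNIV. dist (f t x) (F x) < e / 2"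
        by (rule uniform_limitD[OF ul[OF lim]]) (use e in simp)
      have "\<forall>\<^sub>F t in at_left T. (SUP x. \<bar>deriv (u t) x\<bar>) \<le> 2 * (K / (e / 2))"
        using evA evB evf eventually_J
      proof eventually_elim
        case (elim t)
        have "\<bar>w t x\<bar> \<le> 2 * (K / (e / 2))" for x
        proof -
          have "cmod (g t x) \<le> cmod (A' t) * cmod (f 0 x) + cmod (B' t) * cmod (g 0 x)"
            unfolding fg(2)[OF elim(4)] using norm_triangle_ineq by (metis norm_mult)
          also have "\<dots> \<le> K"
            unfolding K_def using elim K0 K1 by (intro add_mono mult_mono) auto
          finally have g: "cmod (g t x) \<le> K" .
          have "cmod (F x) \<le> cmod (f t x) + cmod (f t x - F x)"
            by (metis norm_minus_commute norm_triangle_sub)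
          then have f: "cmod (f t x) \<ge> e / 2" using e(2)[of x] elim(3) by (auto simp: dist_norm)
              (smt (verit) field_sum_of_halves)
          have "\<bar>w t x\<bar> = 2 * \<bar>Re (g t x / f t x)\<bar>" by (simp add: w_eq[OF elim(4)] abs_mult)
          also have "\<dots> \<le> 2 * (cmod (g t x) / cmod (f t x))"
            using abs_Re_le_cmod[of "g t x / f t x"] by (simp add: norm_divide)
          also have "\<dots> \<le> 2 * (K / (e / 2))"
            using f g e(1) order_trans[OF norm_ge_zero g] by (intro mult_left_mono frac_le) auto
          finally show ?thesis .
        qed
        \<comment> \<open>Every point of the line is the position of some particle, so the bound on
          \<open>w\<close> holds for all of \<open>u_x\<close>.\<close>
        then have "\<bar>deriv (u t) y\<bar> \<le> 2 * (K / (e / 2))" for y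
          using \<phi>D(7)[OF elim(4)] unfolding w_def by (metis surjD)
        then show ?case by (intro cSUP_least) auto
      qed
      moreover have "\<forall>\<^sub>F t in at_left T. (SUP x. \<bar>deriv (u t) x\<bar>) > 2 * (K / (e / 2))"
        using blow by (simp only: filterlim_at_top_dense)
      ultimately have "\<forall>\<^sub>F t in at_left T. False" by eventually_elim simp
      then show False by simp
    qed
  next
    assume "\<exists>x. F x = 0"
    then obtain x where x: "F x = 0" by blast
    \<comment> \<open>Eliminating \<open>g 0 x\<close> expresses the nonzero number
      \<open>f 0 x\<close> times the Wronskian through \<open>F x\<close> and \<open>G x\<close>, so
      both cannot vanish.\<close>
    have "f 0 x * (A T * B' T - A' T * B T) = B' T * F x - B T * G x"
      by (simp add: F_def G_def algebra_simps)
    then have Gx: "G x \<noteq> 0" using x W f_nonzero[OF zero_J] by auto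
    define y where "y t = A t * f 0 x + B t * g 0 x" for t
    define z where "z t = A' t * f 0 x + B' t * g 0 x" for t
    have "filterlim (\<lambda>t. \<bar>Re (z t / y t)\<bar>) at_top (at_left T)"
    proof (rule logarithmic_derivative_blowup)
      show "(y has_vector_derivative z T) (at T)"
        unfolding y_def z_def
        by (intro has_vector_derivative_add has_vector_derivative_mult_left AB)
      show "isCont z T"
        unfolding z_def using AB(3,4) by (auto simp: continuous_on_eq_continuous_at intro!: continuous_intros)
    qed (use x Gx in \<open>auto simp: y_def z_def F_def G_def\<close>)
    then show "filterlim (\<lambda>t. SUP x. \<bar>deriv (u t) x\<bar>) at_top (at_left T)"
    proof (rule filterlim_at_top_mono)
      \<comment> \<open>The single particle starting at the zero \<open>x\<close> suffices: the
        supremum dominates its value of \<open>|w|\<close>.\<close>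
      show "\<forall>\<^sub>F t in at_left T. \<bar>Re (z t / y t)\<bar> \<le> (SUP x. \<bar>deriv (u t) x\<bar>)"
        using eventually_J
      proof eventually_elim
        case (elim t)
        have "\<bar>Re (z t / y t)\<bar> \<le> \<bar>w t x\<bar>"
          using w_eq[OF elim, of x] by (simp add: y_def z_def abs_mult flip: fg[OF elim])
        also have "\<dots> \<le> (SUP x. \<bar>deriv (u t) x\<bar>)"
          unfolding w_def by (rule cSUP_upper[OF UNIV_I bdd_above_u_x[OF elim]])
        finally show ?case .
      qed
    qed
  qed
  ultimately show ?thesis by simp
qed

end

theorem theorem6p1:
  fixes m s T :: real
    and \<phi> \<tau> \<phi>_t \<tau>_t \<phi>_tt \<tau>_tt u \<rho> u_t \<rho>_t :: "real \<Rightarrow> real \<Rightarrow> real"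
  assumes m: "m > 5/2" and T: "T > 0"
    and C2: "C2_curve m {0..<T} (\<lambda>t. (\<phi> t, \<tau> t)) (\<lambda>t. (\<phi>_t t, \<tau>_t t)) (\<lambda>t. (\<phi>_tt t, \<tau>_tt t))"
    and geodesic: "magnetic_geodesic (Gm m) (tangent m) H1_metric
          (\<lambda>q U V. s * pullback_d_alpha q U V) {0..<T}
          (\<lambda>t. (\<phi> t, \<tau> t)) (\<lambda>t. (\<phi>_t t, \<tau>_t t)) (\<lambda>t. (\<phi>_tt t, \<tau>_tt t))"
    and u: "\<And>t. t \<in> {0..<T} \<Longrightarrow> u t = \<phi>_t t \<circ> inv (\<phi> t)"
    and \<rho>: "\<And>t. t \<in> {0..<T} \<Longrightarrow> \<rho> t = \<tau>_t t \<circ> inv (\<phi> t)"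
    and u\<rho>_tangent: "\<And>t. t \<in> {0..<T} \<Longrightarrow> (u t, \<rho> t) \<in> tangent m"
    and u\<rho>_C0: "continuous_curve m {0..<T} (\<lambda>t. (u t, \<rho> t))"
    and u\<rho>_C1: "C1_curve (m - 1) {0..<T} (\<lambda>t. (u t, \<rho> t)) (\<lambda>t. (u_t t, \<rho>_t t))"
    and pde: "magnetic_2HS s {0..<T} u \<rho> u_t \<rho>_t"
  shows "filterlim (\<lambda>t. SUP x. \<bar>deriv (u t) x\<bar>) at_top (at_left T) \<longleftrightarrow>
         (\<exists>F. limitin (sphere_topology (m - 1)) (\<lambda>t. madelung (\<phi> t, \<tau> t)) F (at_left T) \<and>
              F \<in> sphere_topology (m - 1) frontier_of nonvanishing (m - 1))"
proof -
  interpret magnetic_HS_solution m s T \<phi> \<tau> \<phi>_t \<tau>_t \<phi>_tt \<tau>_tt u \<rho> u_t \<rho>_t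
  proof
    show "(\<phi> t, \<tau> t) \<in> Gm m" if "t \<in> {0..<T}" for t
      using geodesic that by (auto simp: magnetic_geodesic_def)
  qed (rule m T C2 u \<rho> u\<rho>_tangent u\<rho>_C0 u\<rho>_C1 pde, assumption?)+
  show ?thesis
    using blowup_iff_frontier unfolding f_def .
qed

end
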